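(* Let $B=\mathbb{C}[x,y,z,t]/(x+x^2y+z^2+t^3)$ be the coordinate ring of the Russell cubic threefold over $\mathbb{C}$. Then $B\notin\mathcal{U}_{\mathbb{C}}(3,\mathbf{G})$; that is, $B$ (which is a unique factorization domain of transcendence degree $3$ over $\mathbb{C}$) admits no positive $\mathbb{Z}$-grading over $\mathbb{C}$.
   Context: $\mathcal{U}_{\mathbb{C}}(3,\mathbf{G})$ denotes the set of $\mathbb{C}$-isomorphism classes of unique factorization domains containing $\mathbb{C}$, of transcendence degree $3$ over $\mathbb{C}$, which admit a positive $\mathbb{Z}$-grading over $\mathbb{C}$. A $\mathbb{Z}$-grading $B=\bigoplus_{i\in\mathbb{Z}}B_i$ over $\mathbb{C}$ (so $\mathbb{C}\subset B_0$) is positive if $B_i=\{0\}$ for $i<0$ and $B_0=\mathbb{C}$. *)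

theory Defs
  imports "HOL-Algebra.Algebraic_Closure_Type" "HOL-Library.Poly_Mapping"
begin

section \<open>Commutative complex algebras and their isomorphism classes\<close>

text \<open>
  A complex algebra is a commutative ring \<open>R\<close> together with its structure map
  \<open>\<phi>\<close> from the complex numbers; it contains the complex numbers if \<open>\<phi>\<close> is injective.
\<close>

abbreviation complex_ring :: "complex ring" where
  "complex_ring \<equiv> ring_of_type_algebra"

definition C_algebra :: "('a, 'b) ring_scheme \<Rightarrow> (complex \<Rightarrow> 'a) \<Rightarrow> bool" where
  "C_algebra R \<phi> \<longleftrightarrow> cring R \<and> \<phi> \<in> ring_hom complex_ring R"

definition contains_C :: "('a, 'b) ring_scheme \<Rightarrow> (complex \<Rightarrow> 'a) \<Rightarrow> bool" where
  "contains_C R \<phi> \<longleftrightarrow> C_algebra R \<phi> \<and> inj \<phi>"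

definition C_isomorphic ::
    "('a, 'b) ring_scheme \<Rightarrow> (complex \<Rightarrow> 'a) \<Rightarrow> ('c, 'd) ring_scheme \<Rightarrow> (complex \<Rightarrow> 'c) \<Rightarrow> bool" where
  "C_isomorphic R \<phi> S \<psi> \<longleftrightarrow> (\<exists>h \<in> ring_iso R S. \<forall>c. h (\<phi> c) = \<psi> c)"

text \<open>
  The explicit condition \<open>C_algebra S \<psi>\<close> is needed because elements of \<open>ring_iso R S\<close> are
  not required to respect the \<open>zero\<close> field of the record \<open>S\<close>.
\<close>

definition C_iso_class ::
    "'a ring \<Rightarrow> (complex \<Rightarrow> 'a) \<Rightarrow> ('a ring \<times> (complex \<Rightarrow> 'a)) set" where
  "C_iso_class R \<phi> = {(S, \<psi>). C_algebra S \<psi> \<and> C_isomorphic R \<phi> S \<psi>}"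


section \<open>Transcendence degree\<close>

text \<open>
  Polynomials with complex coefficients in a set of indeterminates \<open>'v\<close> are finitely supported
  functions from monomials \<open>'v \<Rightarrow>\<^sub>0 nat\<close> to coefficients. In \<open>eval_at\<close> the indeterminates are
  the elements of the ring themselves, each evaluated at itself.
\<close>

definition eval_at ::
    "('a, 'b) ring_scheme \<Rightarrow> (complex \<Rightarrow> 'a) \<Rightarrow> (('a \<Rightarrow>\<^sub>0 nat) \<Rightarrow>\<^sub>0 complex) \<Rightarrow> 'a" where
  "eval_at R \<phi> p =
     (\<Oplus>\<^bsub>R\<^esub>m \<in> Poly_Mapping.keys p. \<phi> (Poly_Mapping.lookup p m) \<otimes>\<^bsub>R\<^esub>
        (\<Otimes>\<^bsub>R\<^esub>s \<in> Poly_Mapping.keys m. s [^]\<^bsub>R\<^esub> Poly_Mapping.lookup m s))"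

definition alg_independent ::
    "('a, 'b) ring_scheme \<Rightarrow> (complex \<Rightarrow> 'a) \<Rightarrow> 'a set \<Rightarrow> bool" where
  "alg_independent R \<phi> S \<longleftrightarrow>
     S \<subseteq> carrier R \<and>
     (\<forall>p. (\<forall>m \<in> Poly_Mapping.keys p. Poly_Mapping.keys m \<subseteq> S) \<and> eval_at R \<phi> p = \<zero>\<^bsub>R\<^esub> \<longrightarrow> p = 0)"

definition transcendence_basis ::
    "('a, 'b) ring_scheme \<Rightarrow> (complex \<Rightarrow> 'a) \<Rightarrow> 'a set \<Rightarrow> bool" where
  "transcendence_basis R \<phi> S \<longleftrightarrow>
     alg_independent R \<phi> S \<and> (\<forall>T. alg_independent R \<phi> T \<and> S \<subseteq> T \<longrightarrow> T = S)"

text \<open>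
  Used for integral domains only: there a maximal algebraically independent subset of the ring is
  a transcendence basis of its fraction field, and all of these have the same cardinality.
\<close>

definition has_trdeg :: "('a, 'b) ring_scheme \<Rightarrow> (complex \<Rightarrow> 'a) \<Rightarrow> nat \<Rightarrow> bool" where
  "has_trdeg R \<phi> n \<longleftrightarrow> (\<exists>S. transcendence_basis R \<phi> S \<and> finite S \<and> card S = n)"


section \<open>Gradings by the integers\<close>

definition Z_grading ::
    "('a, 'b) ring_scheme \<Rightarrow> (complex \<Rightarrow> 'a) \<Rightarrow> (int \<Rightarrow> 'a set) \<Rightarrow> bool" where
  "Z_grading R \<phi> G \<longleftrightarrow>
     (\<forall>i. additive_subgroup (G i) R) \<and>
     (\<forall>b \<in> carrier R. \<exists>!f. (\<forall>i. f i \<in> G i) \<and> finite {i. f i \<noteq> \<zero>\<^bsub>R\<^esub>} \<and>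
                           b = (\<Oplus>\<^bsub>R\<^esub>i \<in> {i. f i \<noteq> \<zero>\<^bsub>R\<^esub>}. f i)) \<and>
     (\<forall>i j. \<forall>a \<in> G i. \<forall>b \<in> G j. a \<otimes>\<^bsub>R\<^esub> b \<in> G (i + j)) \<and>
     range \<phi> \<subseteq> G 0"

definition positive_Z_grading ::
    "('a, 'b) ring_scheme \<Rightarrow> (complex \<Rightarrow> 'a) \<Rightarrow> (int \<Rightarrow> 'a set) \<Rightarrow> bool" where
  "positive_Z_grading R \<phi> G \<longleftrightarrow>
     Z_grading R \<phi> G \<and> (\<forall>i<0. G i = {\<zero>\<^bsub>R\<^esub>}) \<and> G 0 = range \<phi>"

definition admits_positive_Z_grading :: "('a, 'b) ring_scheme \<Rightarrow> (complex \<Rightarrow> 'a) \<Rightarrow> bool" where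
  "admits_positive_Z_grading R \<phi> \<longleftrightarrow> (\<exists>G. positive_Z_grading R \<phi> G)"


section \<open>Isomorphism classes of positively graded factorial domains\<close>

text \<open>
  The rings range over those whose carrier lies in the type \<open>'a\<close>. An integral domain of finite
  transcendence degree over the complex numbers has the cardinality of the continuum, so every
  isomorphism class is represented as soon as \<open>'a\<close> has at least that cardinality.
\<close>

definition U_C_G :: "nat \<Rightarrow> ('a ring \<times> (complex \<Rightarrow> 'a)) set set" where
  "U_C_G n = {C_iso_class R \<phi> | R \<phi>.
     contains_C R \<phi> \<and> factorial_domain R \<and> has_trdeg R \<phi> n \<and> admits_positive_Z_grading R \<phi>}"


section \<open>The coordinate ring of the Russell cubic threefold\<close>

datatype russell_var = Var_x | Var_y | Var_z | Var_t

type_synonym poly4 = "(russell_var \<Rightarrow>\<^sub>0 nat) \<Rightarrow>\<^sub>0 complex"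

definition indet :: "russell_var \<Rightarrow> poly4" where
  "indet v = Poly_Mapping.single (Poly_Mapping.single v 1) 1"

abbreviation poly4_ring :: "poly4 ring" where
  "poly4_ring \<equiv> ring_of_type_algebra"

definition russell_poly :: poly4 where
  "russell_poly =
     indet Var_x + indet Var_x ^ 2 * indet Var_y + indet Var_z ^ 2 + indet Var_t ^ 3"

definition russell_ideal :: "poly4 set" where
  "russell_ideal = PIdl\<^bsub>poly4_ring\<^esub> russell_poly"

definition russell_ring :: "poly4 set ring" where
  "russell_ring = poly4_ring Quot russell_ideal"

definition russell_const :: "complex \<Rightarrow> poly4 set" where
  "russell_const c = russell_ideal +>\<^bsub>poly4_ring\<^esub> Poly_Mapping.single 0 c"

end

theory Submission
  imports Defs
begin

text \<open>
  A positive grading makes the coordinate ring \<open>B\<close> of the smooth threefold a polynomial ring: by graded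
  Nakayama, homogeneous lifts of a basis of the three-dimensional cotangent space at the irrelevant
  maximal ideal generate \<open>B\<close>, and they are algebraically independent by a Jacobian argument. Hence each
  of the three generators is killed by a nonzero locally nilpotent derivation \<open>D\<close>.

  On the other hand, \<open>ker D \<subseteq> \<complex>[x,z,t]\<close> for every such \<open>D\<close> (Makar-Limanov), which contradicts
  \<open>y \<in> B\<close>. To see this, embed \<open>B\<close> into Laurent series in \<open>x\<close> over \<open>\<complex>[z,t]\<close> and let \<open>D'\<close> be
  the part of \<open>D\<close> of lowest degree in \<open>x\<close>. It is locally nilpotent on lowest terms. If
  \<open>f \<in> ker D\<close> has a pole in \<open>x\<close>, its lowest term is divisible by \<open>y' = (z\<^sup>2 + t\<^sup>3)/x\<^sup>2\<close>, so \<open>D' y' = 0\<close>.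
  Parity of the degree in \<open>x\<close> then forces \<open>deg x = 1\<close> and \<open>deg z\<close>, \<open>deg t\<close> even for the degree function
  of \<open>D'\<close>, so \<open>deg (z\<^sup>2 + t\<^sup>3) = deg (x\<^sup>2 y') = 2\<close>, which Davenport's inequality excludes.

  Factoriality is Nagata's criterion for the prime element \<open>x\<close>, whose localization is
  \<open>\<complex>[x, 1/x, z, t]\<close>.
\<close>

section \<open>Locally nilpotent elements of a derivation\<close>

text \<open>The threefold is not rigid: \<open>x^2 d/dz - 2 z d/dy\<close> and
  \<open>x^2 d/dt - 3 t^2 d/dy\<close> are nonzero locally nilpotent derivations of
  \<open>B\<close>. It is also smooth and contractible, so neither singularities nor homotopy type
  tell it apart from affine space; what remains is to bound the kernels of all such derivations at
  once. Passing to the part of lowest order in \<open>x\<close> makes everything homogeneous, with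
  \<open>x\<close> of degree 1, \<open>y'\<close> of degree -2 and \<open>z\<close>,
  \<open>t\<close> of degree 0. Hence every lowest term of odd degree is divisible by
  \<open>x\<close>, and this is the source of all parity statements. The price is that the
  homogeneous derivation acts on Laurent series and is only known to be nilpotent on lowest terms of
  \<open>B\<close>. The exponents 2 and 3 of the cusp enter at the very end: if \<open>z\<close> and
  \<open>t\<close> have even degrees, neither \<open>z^2\<close> nor \<open>t^3\<close> can have
  degree 2, so a sum of degree 2 requires cancellation, and cancellation that deep is
  impossible.\<close>

locale derivation =
  fixes D :: "'a::{idom,semiring_char_0} \<Rightarrow> 'a"
  assumes D_add: "D (a + b) = D a + D b"
    and D_mult: "D (a * b) = D a * b + a * D b"
begin

lemma D_0 [simp]: "D 0 = 0"
  using D_add[of 0 0] by simp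

lemma D_1 [simp]: "D 1 = 0"
  using D_mult[of 1 1] by simp

lemma D_minus: "D (- a) = - D a"
  using D_add[of a "- a"] by (simp add: eq_neg_iff_add_eq_0 add.commute)

lemma D_of_nat [simp]: "D (of_nat n) = 0"
  by (induction n) (auto simp: D_add)

lemma D_numeral [simp]: "D (numeral n) = 0"
  using D_of_nat[of "numeral n"] by simp

lemma D_sum: "D (\<Sum>i\<in>A. f i) = (\<Sum>i\<in>A. D (f i))"
  by (induction A rule: infinite_finite_induct) (auto simp: D_add)

lemma D_power: "D (a ^ Suc n) = of_nat (Suc n) * a ^ n * D a"
proof (induction n)
  case (Suc n)
  have "D (a ^ Suc (Suc n)) = D a * a ^ Suc n + a * D (a ^ Suc n)"
    using D_mult[of a "a ^ Suc n"] by simp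
  also have "\<dots> = of_nat (Suc (Suc n)) * a ^ Suc n * D a"
    unfolding Suc by (simp add: algebra_simps)
  finally show ?case .
qed simp

lemma Dn_0 [simp]: "(D ^^ n) 0 = 0"
  by (induction n) auto

lemma Dn_add: "(D ^^ n) (a + b) = (D ^^ n) a + (D ^^ n) b"
  by (induction n) (auto simp: D_add)

lemma Dn_eq_0_mono: "(D ^^ m) a = 0 \<Longrightarrow> m \<le> n \<Longrightarrow> (D ^^ n) a = 0"
  by (metis Dn_0 funpow_add le_add_diff_inverse2 comp_apply)

lemma Leibniz: "(D ^^ n) (a * b) = (\<Sum>k\<le>n. of_nat (n choose k) * (D ^^ k) a * (D ^^ (n - k)) b)"
proof (induction n)
  case (Suc n)
  define F where "F = (\<lambda>i j. (D ^^ i) a * (D ^^ j) b)"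
  have "(D ^^ Suc n) (a * b) = (\<Sum>k\<le>n. of_nat (n choose k) * (F (Suc k) (n - k) + F k (Suc (n - k))))"
    by (simp add: Suc D_sum D_mult F_def algebra_simps)
  also have "\<dots> = (\<Sum>k\<le>n. of_nat (n choose k) * F (Suc k) (n - k)) + (\<Sum>k\<le>n. of_nat (n choose k) * F k (Suc n - k))"
    by (simp add: sum.distrib algebra_simps Suc_diff_le)
  also have "(\<Sum>k\<le>n. of_nat (n choose k) * F k (Suc n - k)) = (\<Sum>k\<le>Suc n. of_nat (n choose k) * F k (Suc n - k))"
    by simp
  also have "\<dots> = F 0 (Suc n) + (\<Sum>k\<le>n. of_nat (n choose Suc k) * F (Suc k) (n - k))"
    by (subst sum.atMost_Suc_shift) simp
  also have "(\<Sum>k\<le>n. of_nat (n choose k) * F (Suc k) (n - k)) + (F 0 (Suc n) + (\<Sum>k\<le>n. of_nat (n choose Suc k) * F (Suc k) (n - k)))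
     = F 0 (Suc n) + (\<Sum>k\<le>n. of_nat (Suc n choose Suc k) * F (Suc k) (Suc n - Suc k))"
    by (simp add: sum.distrib algebra_simps)
  also have "\<dots> = (\<Sum>k\<le>Suc n. of_nat (Suc n choose k) * F k (Suc n - k))"
    unfolding sum.atMost_Suc_shift[of _ n] by simp
  finally show ?case by (simp add: F_def mult.assoc)
qed simp

text \<open>Nilpotency is recorded element by element: the homogeneous derivation to which this is
  applied acts on all Laurent series, but is known to be nilpotent only on those built from lowest
  terms of the coordinate ring.\<close>

definition nil :: "'a \<Rightarrow> bool" where
  "nil a \<longleftrightarrow> (\<exists>n. (D ^^ n) a = 0)"

text \<open>The degree in a slice variable; the junk value is \<open>dg 0 = 0\<close>.\<close>

definition dg :: "'a \<Rightarrow> nat" where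
  "dg a = (LEAST n. (D ^^ Suc n) a = 0)"

lemma nilI: "(D ^^ n) a = 0 \<Longrightarrow> nil a"
  by (auto simp: nil_def)

lemma nil_D_iff: "nil (D a) \<longleftrightarrow> nil a"
proof
  assume "nil (D a)"
  then obtain n where "(D ^^ n) (D a) = 0" by (auto simp: nil_def)
  then show "nil a" by (intro nilI[of "Suc n"]) (simp add: funpow_swap1)
next
  assume "nil a"
  then obtain n where "(D ^^ n) a = 0" by (auto simp: nil_def)
  then show "nil (D a)" by (intro nilI[of n]) (simp add: funpow_swap1[symmetric])
qed

lemma nil_ker: "D a = 0 \<Longrightarrow> nil a"
  by (rule nilI[of 1]) simp

lemma nil_0 [simp]: "nil 0" and nil_1 [simp]: "nil 1" and nil_numeral [simp]: "nil (numeral k)"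
  by (auto intro: nil_ker)

lemma Dn_Suc_dg: "nil a \<Longrightarrow> (D ^^ Suc (dg a)) a = 0"
proof -
  assume "nil a"
  then obtain n where "(D ^^ n) a = 0" by (auto simp: nil_def)
  then have "(D ^^ Suc n) a = 0" by simp
  then show ?thesis unfolding dg_def by (rule LeastI)
qed

lemma dg_le_iff: "nil a \<Longrightarrow> dg a \<le> n \<longleftrightarrow> (D ^^ Suc n) a = 0"
proof
  assume "nil a" "dg a \<le> n"
  then show "(D ^^ Suc n) a = 0" using Dn_eq_0_mono[OF Dn_Suc_dg] by fastforce
next
  assume "(D ^^ Suc n) a = 0"
  then show "dg a \<le> n" unfolding dg_def by (rule Least_le)
qed

lemma Dn_dg: "nil a \<Longrightarrow> a \<noteq> 0 \<Longrightarrow> (D ^^ dg a) a \<noteq> 0"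
  by (cases "dg a") (use dg_le_iff[of a "dg a - 1"] in auto)

lemma dg_0_iff: "nil a \<Longrightarrow> dg a = 0 \<longleftrightarrow> D a = 0"
  using dg_le_iff[of a 0] by simp

lemma dg_eqI: "(D ^^ n) a \<noteq> 0 \<Longrightarrow> (D ^^ Suc n) a = 0 \<Longrightarrow> dg a = n"
proof (rule antisym)
  assume *: "(D ^^ n) a \<noteq> 0" "(D ^^ Suc n) a = 0"
  then have nil: "nil a" by (intro nilI)
  then show "dg a \<le> n" using * by (simp only: dg_le_iff)
  show "n \<le> dg a"
  proof (rule ccontr)
    assume "\<not> n \<le> dg a"
    then have "Suc (dg a) \<le> n" by simp
    then show False using * Dn_eq_0_mono[OF Dn_Suc_dg[OF nil]] by blast
  qed
qed

lemma dg_numeral [simp]: "dg (numeral k) = 0"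
  by (simp add: dg_0_iff)

lemma dg_D: "nil a \<Longrightarrow> D a \<noteq> 0 \<Longrightarrow> dg a = Suc (dg (D a))"
proof (rule dg_eqI)
  assume *: "nil a" "D a \<noteq> 0"
  then have nil: "nil (D a)" by (simp add: nil_D_iff)
  show "(D ^^ Suc (dg (D a))) a \<noteq> 0"
    using Dn_dg[OF nil *(2)] by (simp add: funpow_swap1)
  show "(D ^^ Suc (Suc (dg (D a)))) a = 0"
    using Dn_Suc_dg[OF nil] by (simp add: funpow_swap1)
qed

lemma nil_add: "nil a \<Longrightarrow> nil b \<Longrightarrow> nil (a + b)"
proof -
  assume "nil a" "nil b"
  then obtain m n where "(D ^^ m) a = 0" "(D ^^ n) b = 0" by (auto simp: nil_def)
  then have "(D ^^ (m + n)) a = 0" "(D ^^ (m + n)) b = 0"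
    using Dn_eq_0_mono[of m a "m + n"] Dn_eq_0_mono[of n b "m + n"] by simp_all
  then show ?thesis by (intro nilI[of "m + n"]) (simp add: Dn_add)
qed

lemma dg_add_le: "nil a \<Longrightarrow> nil b \<Longrightarrow> dg a \<le> n \<Longrightarrow> dg b \<le> n \<Longrightarrow> dg (a + b) \<le> n"
  by (simp add: nil_add dg_le_iff D_add Dn_add)

lemma Dn_mult_dg_zero:
  assumes "nil a" "nil b" "n > dg a + dg b"
  shows "(D ^^ n) (a * b) = 0"
proof -
  have "(D ^^ k) a = 0 \<or> (D ^^ (n - k)) b = 0" if "k \<le> n" for k
  proof (cases "k \<le> dg a")
    case True
    then have "Suc (dg b) \<le> n - k" using assms by simp
    then show ?thesis using Dn_eq_0_mono[OF Dn_Suc_dg[OF assms(2)]] by blast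
  next
    case False
    then have "Suc (dg a) \<le> k" by simp
    then show ?thesis using Dn_eq_0_mono[OF Dn_Suc_dg[OF assms(1)]] by blast
  qed
  then show ?thesis unfolding Leibniz by (intro sum.neutral) auto
qed

lemma nil_mult: "nil a \<Longrightarrow> nil b \<Longrightarrow> nil (a * b)"
  by (rule nilI[OF Dn_mult_dg_zero[of a b "Suc (dg a + dg b)"]]) auto

lemma nil_power: "nil a \<Longrightarrow> nil (a ^ n)"
  by (induction n) (auto intro: nil_mult)

lemma nil_minus: "nil a \<Longrightarrow> nil (- a)"
  using nil_mult[of "- 1" a] nil_ker[of "-1"] by (simp add: D_minus)

lemma nil_diff: "nil a \<Longrightarrow> nil b \<Longrightarrow> nil (a - b)"
  using nil_add[of a "- b"] by (simp add: nil_minus)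

text \<open>In the Leibniz sum of order \<open>dg a + dg b\<close> only the term
  \<open>k = dg a\<close> survives; its binomial coefficient is nonzero because the characteristic
  is zero.\<close>

lemma dg_mult:
  assumes "nil a" "nil b" "a \<noteq> 0" "b \<noteq> 0"
  shows "dg (a * b) = dg a + dg b"
proof (rule dg_eqI)
  show "(D ^^ Suc (dg a + dg b)) (a * b) = 0"
    using assms by (intro Dn_mult_dg_zero) auto
  have "(D ^^ k) a * (D ^^ (dg a + dg b - k)) b = 0" if "k \<noteq> dg a" "k \<le> dg a + dg b" for k
  proof (cases "k \<le> dg a")
    case True
    then have "Suc (dg b) \<le> dg a + dg b - k" using that by simp
    then show ?thesis using Dn_eq_0_mono[OF Dn_Suc_dg[OF assms(2)]] by simp
  next
    case False
    then have "Suc (dg a) \<le> k" by simp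
    then show ?thesis using Dn_eq_0_mono[OF Dn_Suc_dg[OF assms(1)]] by simp
  qed
  then have "(\<Sum>k\<in>{..dg a + dg b} - {dg a}. of_nat ((dg a + dg b) choose k) * (D ^^ k) a * (D ^^ (dg a + dg b - k)) b) = 0"
    by (intro sum.neutral) (auto simp: mult.assoc)
  then have "(D ^^ (dg a + dg b)) (a * b) = of_nat ((dg a + dg b) choose dg a) * (D ^^ dg a) a * (D ^^ dg b) b"
    unfolding Leibniz by (subst sum.remove[of _ "dg a"]) auto
  moreover have "(dg a + dg b) choose dg a \<noteq> 0"
    by (simp add: binomial_eq_0_iff)
  ultimately show "(D ^^ (dg a + dg b)) (a * b) \<noteq> 0"
    using Dn_dg[of a] Dn_dg[of b] assms by simp
qed

lemma dg_power:
  assumes "nil a" "a \<noteq> 0"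
  shows "dg (a ^ n) = n * dg a"
proof (induction n)
  case 0
  then show ?case using dg_0_iff[of 1] by simp
next
  case (Suc n)
  then show ?case using assms by (simp add: dg_mult nil_power)
qed

lemma dg_minus: "dg (- a) = dg a"
proof -
  have "(D ^^ n) (- a) = - (D ^^ n) a" for n
    by (induction n) (auto simp: D_minus)
  then show ?thesis by (simp add: dg_def D_minus del: funpow.simps)
qed

lemma dg_numeral_mult: "nil a \<Longrightarrow> dg (numeral k * a) = dg a"
proof (cases "a = 0")
  case False
  assume "nil a"
  then show ?thesis using False by (simp add: dg_mult)
qed simp

lemma dg_add_eq:
  assumes "nil a" "nil b" "dg b < dg a"
  shows "dg (a + b) = dg a"
proof (rule antisym)
  show "dg (a + b) \<le> dg a" using assms by (intro dg_add_le) auto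
  show "dg a \<le> dg (a + b)"
  proof (rule ccontr)
    assume "\<not> dg a \<le> dg (a + b)"
    then have "dg (a + b) \<le> dg a - 1" "dg b \<le> dg a - 1" using assms by auto
    then have "dg ((a + b) + (- b)) \<le> dg a - 1"
      using assms by (intro dg_add_le[of "a + b"] nil_add nil_minus) (simp_all add: dg_minus)
    then have "dg a \<le> dg a - 1" by simp
    then show False using assms by simp
  qed
qed

text \<open>Degrees add and are natural numbers, so a product of degree 0 has factors of degree
  0.\<close>

lemma ker_factorial:
  assumes "nil a" "nil b" "a * b \<noteq> 0" "D (a * b) = 0"
  shows "D a = 0" "D b = 0"
proof -
  have "dg (a * b) = 0" using assms by (simp add: dg_0_iff nil_mult)
  then have "dg a + dg b = 0" using assms by (subst (asm) dg_mult) auto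
  then show "D a = 0" "D b = 0" using assms by (simp_all add: dg_0_iff)
qed

text \<open>\<open>D\<close> lowers the degree by one, while a nonzero multiple of \<open>a\<close>
  has at least the degree of \<open>a\<close>.\<close>

lemma dvd_D_imp_ker:
  assumes "nil a" "nil b" "D a = a * b"
  shows "D a = 0"
proof (rule ccontr)
  assume *: "D a \<noteq> 0"
  then have "a \<noteq> 0" "b \<noteq> 0" using assms by auto
  then have "dg (D a) = dg a + dg b" using assms by (simp add: dg_mult)
  then show False using dg_D[OF assms(1) *] by simp
qed

text \<open>The last hypothesis says that \<open>f/g\<close> is a constant of \<open>D\<close>. All
  iterates of \<open>f\<close> and \<open>g\<close> then stay in the same ratio, so they vanish
  together.\<close>

lemma dg_eq_if_proportional:
  assumes "nil f" "nil g" "f \<noteq> 0" "g \<noteq> 0" "D f * g = f * D g"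
  shows "dg f = dg g"
proof -
  have *: "(D ^^ n) f * g = f * (D ^^ n) g" for n
  proof (induction n)
    case (Suc n)
    have "g * ((D ^^ n) f * D g) = ((D ^^ n) f * g) * D g" by (simp add: algebra_simps)
    also have "\<dots> = (f * D g) * (D ^^ n) g" unfolding Suc by (simp add: algebra_simps)
    also have "\<dots> = g * (D f * (D ^^ n) g)" unfolding assms(5)[symmetric] by (simp add: algebra_simps)
    finally have "(D ^^ n) f * D g = D f * (D ^^ n) g" using assms by simp
    moreover have "D ((D ^^ n) f * g) = D (f * (D ^^ n) g)" using Suc by simp
    ultimately show ?case by (simp add: D_mult)
  qed simp
  show ?thesis
  proof (rule antisym)
    show "dg f \<le> dg g" using *[of "Suc (dg g)"] Dn_Suc_dg[OF assms(2)] assms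
      by (simp only: dg_le_iff mult_zero_right mult_eq_0_iff) auto
    show "dg g \<le> dg f" using *[of "Suc (dg f)"] Dn_Suc_dg[OF assms(1)] assms
      by (simp only: dg_le_iff mult_zero_left) auto
  qed
qed

section \<open>Degree inequalities for the cusp \<open>z^2 + t^3\<close>\<close>

text \<open>The bracket on the left is \<open>z t\<close> times the logarithmic derivative of
  \<open>z^2/t^3\<close>. The identity exhibits \<open>z\<close> as a factor of an expression whose
  degree is governed by the small degree of \<open>z^2 + t^3\<close>.\<close>

lemma cusp_identity:
  "z * (2 * t * D z - 3 * z * D t) = t * D (z\<^sup>2 + t ^ 3) - 3 * (z\<^sup>2 + t ^ 3) * D t"
  using D_power[of z 1] D_power[of t 2] 
  by (simp add: D_add power2_eq_square power3_eq_cube numeral_3_eq_3 algebra_simps)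

text \<open>A vanishing \<open>D (z^2 + t^3)\<close> forces \<open>2 * dg z = 3 * dg t\<close>,
  whereas \<open>cusp_identity\<close> makes \<open>z\<close> a factor of a nonzero element of
  degree \<open>dg t - 1\<close>. Geometrically, the curves \<open>z^2 + t^3 = c\<close> with
  \<open>c\<close> nonzero have no nonconstant polynomial parametrization.\<close>

lemma cusp_ker:
  assumes nil: "nil z" "nil t" and nz: "z\<^sup>2 + t ^ 3 \<noteq> 0" and D: "D (z\<^sup>2 + t ^ 3) = 0"
  shows "D z = 0 \<and> D t = 0"
proof (rule ccontr)
  assume *: "\<not> (D z = 0 \<and> D t = 0)"
  have D': "2 * z * D z = - (3 * t\<^sup>2 * D t)"
    using D D_power[of z 1] D_power[of t 2]
    by (simp add: D_add power2_eq_square power3_eq_cube eq_neg_iff_add_eq_0)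
  have "z \<noteq> 0" "t \<noteq> 0" "D z \<noteq> 0" "D t \<noteq> 0" using * D' nz by auto
  note nz' = this
  have "dg (2 * z * D z) = dg z + dg (D z)"
    using nil nz' by (simp add: dg_mult dg_numeral_mult mult.assoc nil_mult nil_D_iff)
  moreover have "dg (- (3 * t\<^sup>2 * D t)) = 2 * dg t + dg (D t)"
    using nil nz' by (simp add: dg_minus dg_mult dg_power dg_numeral_mult mult.assoc nil_mult nil_D_iff nil_power)
  \<comment> \<open>Each side of \<open>D'\<close> contains one derivative, so the two losses of one
    degree cancel.\<close>
  ultimately have 1: "2 * dg z = 3 * dg t"
    using dg_D[of z] dg_D[of t] nil nz' D' by simp
  have "z * (2 * t * D z - 3 * z * D t) = - (3 * (z\<^sup>2 + t ^ 3) * D t)"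
    unfolding cusp_identity D by simp
  then have 2: "z * (2 * t * D z - 3 * z * D t) = - (3 * ((z\<^sup>2 + t ^ 3) * D t))"
    by (simp add: mult.assoc)
  have "nil (z\<^sup>2 + t ^ 3)" "dg (z\<^sup>2 + t ^ 3) = 0"
    using D nil by (auto simp: dg_0_iff nil_ker)
  then have "dg (- (3 * ((z\<^sup>2 + t ^ 3) * D t))) = dg (D t)"
    using nil nz nz' by (simp add: dg_minus dg_mult dg_numeral_mult nil_mult nil_D_iff)
  moreover have "2 * t * D z - 3 * z * D t \<noteq> 0"
    using 2 nz nz' by auto
  then have "dg (z * (2 * t * D z - 3 * z * D t)) \<ge> dg z"
    using nil nz' by (subst dg_mult) (auto intro!: nil_diff nil_mult simp: nil_D_iff)
  ultimately have "dg z \<le> dg (D t)" using 2 by simp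
  then show False using 1 dg_D[of t] nil nz' by simp
qed

text \<open>A special case of Davenport's bound on the degree of \<open>z\<^sup>2 + t\<^sup>3\<close>.\<close>

lemma no_even_cusp_of_degree_2:
  assumes nil: "nil z" "nil t" and even: "even (dg z)" "even (dg t)"
  shows "dg (z\<^sup>2 + t ^ 3) \<noteq> 2"
proof
  define w where "w = z\<^sup>2 + t ^ 3"
  assume "dg (z\<^sup>2 + t ^ 3) = 2"
  then have w2: "dg w = 2" by (simp add: w_def)
  obtain b c where bc: "dg z = 2 * b" "dg t = 2 * c" using even by (auto elim!: evenE)
  have nilw: "nil w" using nil unfolding w_def by (intro nil_add nil_power)
  have dg0: "dg 0 = 0" by (simp add: dg_0_iff)
  have "z \<noteq> 0"
  proof
    assume "z = 0"
    then have w: "w = t ^ 3" by (simp add: w_def)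
    then have "t \<noteq> 0" using w2 dg0 by auto
    then have "dg w = 3 * dg t" using dg_power[of t 3] nil w by simp
    then show False using bc w2 by presburger
  qed
  have "t \<noteq> 0"
  proof
    assume "t = 0"
    then have w: "w = z\<^sup>2" by (simp add: w_def)
    then have "dg w = 2 * dg z" using dg_power[of z 2] nil w \<open>z \<noteq> 0\<close> by simp
    then show False using bc w2 by presburger
  qed
  have p: "dg (z\<^sup>2) = 4 * b" "dg (t ^ 3) = 6 * c"
    using dg_power[of z 2] dg_power[of t 3] nil \<open>z \<noteq> 0\<close> \<open>t \<noteq> 0\<close> bc by simp_all
  \<comment> \<open>Otherwise the larger of the two would be \<open>dg w = 2\<close>, but neither
    multiple can equal 2.\<close>
  have eq: "4 * b = 6 * c"
  proof (rule ccontr)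
    assume "4 * b \<noteq> 6 * c"
    then consider "6 * c < 4 * b" | "4 * b < 6 * c" by linarith
    then show False
    proof cases
      case 1
      then have "dg w = 4 * b" using dg_add_eq[of "z\<^sup>2" "t ^ 3"] nil p by (simp add: w_def nil_power)
      then show False using w2 by presburger
    next
      case 2
      then have "dg w = 6 * c" using dg_add_eq[of "t ^ 3" "z\<^sup>2"] nil p by (simp add: w_def nil_power add.commute)
      then show False using w2 by presburger
    qed
  qed
  have "dg w \<le> 4 * b" unfolding w_def using nil p eq by (intro dg_add_le nil_power) auto
  \<comment> \<open>\<open>b\<close> is a positive multiple of 3. The bound \<open>c \<ge> 2\<close>
    is what makes \<open>dg z = 3 * c\<close> exceed the bound \<open>2 * c + 1\<close> on
    \<open>z * \<Delta>\<close> below.\<close>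
  then have bc1: "b \<ge> 3" "c \<ge> 2" "2 * b = 3 * c" using w2 eq by presburger+
  have "D t \<noteq> 0" "D w \<noteq> 0"
    using bc bc1 w2 dg_0_iff[of t] dg_0_iff[of w] nil nilw by auto
  have "w \<noteq> 0" using w2 dg0 by auto
  have dgs: "dg (t * D w) = 2 * c + 1" "dg (3 * w * D t) = 2 * c + 1"
    using dg_D[of t] dg_D[of w] nil nilw w2 bc \<open>D t \<noteq> 0\<close> \<open>D w \<noteq> 0\<close> \<open>t \<noteq> 0\<close> \<open>w \<noteq> 0\<close>
    by (simp_all add: dg_mult dg_numeral_mult mult.assoc nil_mult nil_D_iff)
  define \<Delta> where "\<Delta> = 2 * t * D z - 3 * z * D t"
  have z\<Delta>: "z * \<Delta> = t * D w + - (3 * w * D t)"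
    unfolding \<Delta>_def w_def cusp_identity by simp
  show False
  proof (cases "\<Delta> = 0")
    case True
    \<comment> \<open>Here \<open>t^3/w\<close> is a constant of \<open>D\<close>, so
      \<open>6 * c\<close> would have to be 2.\<close>
    then have *: "t * D w = 3 * w * D t" using z\<Delta> by simp
    have "D (t ^ 3) * w = t\<^sup>2 * (3 * w * D t)"
      using D_power[of t 2] by (simp add: numeral_3_eq_3)
    also have "\<dots> = t ^ 3 * D w"
      unfolding *[symmetric] by (simp add: power2_eq_square power3_eq_cube)
    finally have "dg (t ^ 3) = dg w"
      using nil nilw \<open>t \<noteq> 0\<close> \<open>w \<noteq> 0\<close> by (intro dg_eq_if_proportional nil_power) auto
    then show False using p w2 bc1 by simp
  next
    case False
    have nil\<Delta>: "nil \<Delta>" unfolding \<Delta>_def using nil by (intro nil_diff nil_mult) (auto simp: nil_D_iff)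
    have "dg (z * \<Delta>) \<le> 2 * c + 1"
      unfolding z\<Delta> using nil nilw dgs by (intro dg_add_le nil_minus nil_mult) (auto simp: nil_D_iff dg_minus)
    moreover have "dg (z * \<Delta>) = dg z + dg \<Delta>"
      using nil nil\<Delta> False \<open>z \<noteq> 0\<close> by (intro dg_mult) auto
    ultimately show False using bc bc1 by simp
  qed
qed

end

section \<open>A Laurent series model of the coordinate ring\<close>

unbundle fps_syntax

section \<open>Ring homomorphisms and nested polynomial evaluation\<close>

definition is_rhom :: "('a::comm_ring_1 \<Rightarrow> 'b::comm_ring_1) \<Rightarrow> bool" where
  "is_rhom f \<longleftrightarrow> f 1 = 1 \<and> (\<forall>a b. f (a + b) = f a + f b) \<and> (\<forall>a b. f (a * b) = f a * f b)"

lemma is_rhomD: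
  assumes "is_rhom f"
  shows "f 0 = 0" "f 1 = 1" "f (a + b) = f a + f b" "f (a * b) = f a * f b"
    "f (- a) = - f a" "f (a - b) = f a - f b" "f (a ^ n) = f a ^ n"
proof -
  show add: "f (a + b) = f a + f b" for a b using assms by (simp add: is_rhom_def)
  show mult: "f (a * b) = f a * f b" for a b using assms by (simp add: is_rhom_def)
  show 1: "f 1 = 1" using assms by (simp add: is_rhom_def)
  show 0: "f 0 = 0" using add[of 0 0] by simp
  show minus: "f (- a) = - f a" for a using add[of a "- a"] 0 by (simp add: eq_neg_iff_add_eq_0 add.commute)
  show "f (a - b) = f a - f b" using add[of a "- b"] minus by simp
  show "f (a ^ n) = f a ^ n" by (induction n) (simp_all add: mult 1)
qed

lemma is_rhom_comp: "is_rhom f \<Longrightarrow> is_rhom g \<Longrightarrow> is_rhom (\<lambda>x. g (f x))"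
  by (simp add: is_rhom_def)

definition peval :: "('a::comm_ring_1 \<Rightarrow> 'b::comm_ring_1) \<Rightarrow> 'b \<Rightarrow> 'a poly \<Rightarrow> 'b" where
  "peval f a p = poly (map_poly f p) a"

lemma peval_0 [simp]: "peval f a 0 = 0"
  by (simp add: peval_def)

lemma peval_pCons: "is_rhom f \<Longrightarrow> peval f a (pCons c p) = f c + a * peval f a p"
  by (simp add: peval_def map_poly_pCons is_rhomD)

lemma is_rhom_peval:
  assumes f: "is_rhom f"
  shows "is_rhom (peval f a)"
proof -
  note s = peval_pCons[OF f] is_rhomD[OF f]
  have add: "peval f a (p + q) = peval f a p + peval f a q" for p q
    by (induction p q rule: poly_induct2) (simp_all add: s algebra_simps)
  have smult: "peval f a (smult c p) = f c * peval f a p" for c p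
    by (induction p) (simp_all add: s algebra_simps)
  have "peval f a (p * q) = peval f a p * peval f a q" for p q
    by (induction p) (simp_all add: s add smult algebra_simps)
  then show ?thesis by (simp add: is_rhom_def add one_pCons s)
qed

lemma peval_X: "is_rhom f \<Longrightarrow> peval f a [:0, 1:] = a"
  by (simp add: peval_pCons is_rhomD)

lemma peval_const: "is_rhom f \<Longrightarrow> peval f a [:c:] = f c"
  by (simp add: peval_pCons is_rhomD)

lemma peval_monom: "is_rhom f \<Longrightarrow> peval f a (monom c n) = f c * a ^ n"
  by (induction n) (simp_all add: monom_0 monom_Suc peval_pCons is_rhomD algebra_simps)

lemma is_rhom_fls_const: "is_rhom fls_const"
  by (simp add: is_rhom_def fls_plus_const)

text \<open>A lower bound for the order in \<open>x\<close> instead of the order itself: zero is no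
  exception, and the bound persists when a derivation kills the lowest coefficient.\<close>

definition fls_low :: "int \<Rightarrow> 'a::zero fls \<Rightarrow> bool" where
  "fls_low m f \<longleftrightarrow> (\<forall>i<m. f $$ i = 0)"

lemma fls_lowD: "fls_low m f \<Longrightarrow> i < m \<Longrightarrow> f $$ i = 0"
  by (simp add: fls_low_def)

lemma fls_low_0 [simp]: "fls_low m 0"
  by (simp add: fls_low_def)

lemma fls_low_mono: "fls_low m f \<Longrightarrow> k \<le> m \<Longrightarrow> fls_low k f"
  by (simp add: fls_low_def)

lemma fls_low_add: "fls_low m f \<Longrightarrow> fls_low m g \<Longrightarrow> fls_low m (f + g)"
  for f :: "'a::monoid_add fls"
  by (simp add: fls_low_def)

lemma fls_low_uminus: "fls_low m f \<Longrightarrow> fls_low m (- f)"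
  for f :: "'a::group_add fls"
  by (simp add: fls_low_def)

lemma fls_low_const: "fls_low 0 (fls_const c)"
  by (simp add: fls_low_def)

lemma fls_low_subdegree: "fls_low (fls_subdegree f) f"
  by (simp add: fls_low_def)

lemma fls_low_shift_fps:
  assumes "fls_low m f"
  shows "f = fls_shift (- m) (fps_to_fls (fls_regpart (fls_shift m f)))"
  using assms by (auto intro!: fls_eqI simp: fls_low_def)

lemma
  fixes f g :: "'a::comm_semiring_1 fls"
  assumes "fls_low m f" "fls_low k g"
  shows fls_low_mult: "fls_low (m + k) (f * g)"
    and fls_nth_mult_low: "(f * g) $$ (m + k) = f $$ m * g $$ k"
proof -
  define F G where "F = fls_regpart (fls_shift m f)" "G = fls_regpart (fls_shift k g)"
  have FG: "F $ 0 = f $$ m" "G $ 0 = g $$ k" by (simp_all add: F_G_def)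
  have "f * g = fls_shift (- m + - k) (fps_to_fls F * fps_to_fls G)"
    unfolding F_G_def
    by (subst fls_low_shift_fps[OF assms(1)], subst fls_low_shift_fps[OF assms(2)])
       (simp only: fls_times_both_shifted_simp)
  then have *: "f * g = fls_shift (- m + - k) (fps_to_fls (F * G))"
    by (simp add: fls_times_fps_to_fls)
  show "fls_low (m + k) (f * g)" "(f * g) $$ (m + k) = f $$ m * g $$ k"
    unfolding * by (simp_all add: fls_low_def FG)
qed

lemma fls_low_power_nth:
  fixes f :: "'a::comm_semiring_1 fls"
  assumes "fls_low m f"
  shows "fls_low (int n * m) (f ^ n) \<and> (f ^ n) $$ (int n * m) = (f $$ m) ^ n"
proof (induction n)
  case (Suc n)
  then show ?case
    using fls_low_mult[OF assms, of "int n * m" "f ^ n"] fls_nth_mult_low[OF assms, of "int n * m" "f ^ n"]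
    by (simp add: algebra_simps)
qed (simp add: fls_low_def)

type_synonym zt_poly = "complex poly poly"
type_synonym laurent = "complex poly poly fls"

text \<open>
  Elements of \<open>\<complex>[z,t]\<close> are polynomials in \<open>z\<close> over \<open>\<complex>[t]\<close>, and \<open>fls_X\<close> plays the role of \<open>x\<close>. In nested
  polynomial types the outermost variable is \<open>y\<close>, then \<open>x\<close>.
\<close>

definition z_poly :: zt_poly where "z_poly = [:0, 1:]"
definition t_poly :: zt_poly where "t_poly = [:[:0, 1:]:]"
definition cusp :: zt_poly where "cusp = z_poly\<^sup>2 + t_poly ^ 3"

text \<open>The defining equation solved for \<open>y\<close>.\<close>

definition y_laurent :: laurent where "y_laurent = - (fls_X_inv\<^sup>2 * (fls_X + fls_const cusp))"

definition eval_xzt :: "zt_poly poly \<Rightarrow> laurent" where "eval_xzt = peval fls_const fls_X"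

definition eval_yxzt :: "zt_poly poly poly \<Rightarrow> laurent" where "eval_yxzt = peval eval_xzt y_laurent"

text \<open>The equation as \<open>(cusp + x) + x^2 y\<close>, linear in the outer variable. Its
  leading coefficient is \<open>x^2\<close>, so division by it removes only multiples of
  \<open>x^2\<close> from a leading coefficient in \<open>y\<close>.\<close>

definition russell_rel :: "zt_poly poly poly" where "russell_rel = [:[:cusp, 1:], [:0, 0, 1:]:]"

lemma cusp_nz [simp]: "cusp \<noteq> 0"
proof
  assume "cusp = 0"
  then have "coeff (cusp) 2 = 0" by simp
  then show False by (simp add: cusp_def z_poly_def t_poly_def power2_eq_square power3_eq_cube numeral_2_eq_2)
qed

lemma is_rhom_eval_xzt: "is_rhom eval_xzt"
  unfolding eval_xzt_def by (intro is_rhom_peval is_rhom_fls_const)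

lemma is_rhom_eval_yxzt: "is_rhom eval_yxzt"
  unfolding eval_yxzt_def by (intro is_rhom_peval is_rhom_eval_xzt)

lemma eval_xzt_pCons: "eval_xzt (pCons c p) = fls_const c + fls_X * eval_xzt p"
  unfolding eval_xzt_def by (rule peval_pCons[OF is_rhom_fls_const])

lemma eval_xzt_0 [simp]: "eval_xzt 0 = 0"
  by (simp add: eval_xzt_def)

lemma eval_xzt_nth: "eval_xzt p $$ i = (if i < 0 then 0 else coeff p (nat i))"
proof (induction p arbitrary: i)
  case (pCons c p)
  then show ?case
    by (auto simp: eval_xzt_pCons fls_X_times_conv_shift coeff_pCons nat_diff_distrib split: nat.splits)
qed simp

lemma eval_xzt_eq_iff [simp]: "eval_xzt p = eval_xzt q \<longleftrightarrow> p = q"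
proof
  assume "eval_xzt p = eval_xzt q"
  then have "eval_xzt p $$ int n = eval_xzt q $$ int n" for n by simp
  then show "p = q" by (simp add: eval_xzt_nth poly_eq_iff)
qed simp

lemma fls_low_eval_xzt: "fls_low 0 (eval_xzt p)"
  by (simp add: fls_low_def eval_xzt_nth)

lemma X_X_inv: "fls_X * fls_X_inv = (1 :: laurent)" "fls_X_inv * fls_X = (1 :: laurent)"
  by (simp_all add: fls_X_times_conv_shift fls_X_inv_times_conv_shift)

lemma X2_y_laurent: "fls_X\<^sup>2 * y_laurent = - (fls_X + fls_const cusp)"
proof -
  have "fls_X\<^sup>2 * y_laurent = - ((fls_X * fls_X_inv)\<^sup>2 * (fls_X + fls_const cusp))"
    by (simp add: y_laurent_def power_mult_distrib mult.assoc)
  then show ?thesis by (simp add: X_X_inv)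
qed

lemma eval_yxzt_pCons: "eval_yxzt (pCons c p) = eval_xzt c + y_laurent * eval_yxzt p"
  unfolding eval_yxzt_def by (rule peval_pCons[OF is_rhom_eval_xzt])

lemma eval_yxzt_0 [simp]: "eval_yxzt 0 = 0"
  by (simp add: eval_yxzt_def)

lemma eval_yxzt_russell_rel: "eval_yxzt russell_rel = 0"
proof -
  have "eval_yxzt russell_rel = (fls_X + fls_const cusp) + fls_X\<^sup>2 * y_laurent"
    by (simp add: russell_rel_def eval_yxzt_pCons eval_xzt_pCons algebra_simps power2_eq_square)
  then show ?thesis by (simp add: X2_y_laurent)
qed

lemma y_laurent_low: "fls_low (-2) y_laurent" and y_laurent_nth: "y_laurent $$ (-2) = - cusp"
proof -
  have 1: "fls_low (-2) (fls_X_inv\<^sup>2 :: laurent)" "(fls_X_inv\<^sup>2 :: laurent) $$ (-2) = 1"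
    by (simp_all add: fls_low_def)
  have 2: "fls_low 0 (fls_X + fls_const cusp)" "(fls_X + fls_const cusp) $$ 0 = cusp"
    by (simp_all add: fls_low_def)
  show "fls_low (-2) y_laurent" "y_laurent $$ (-2) = - cusp"
    using fls_low_mult[OF 1(1) 2(1)] fls_nth_mult_low[OF 1(1) 2(1)] 1(2) 2(2)
    unfolding y_laurent_def by (simp_all add: fls_low_uminus)
qed

lemma eval_yxzt_low: "fls_low (- 2 * int (degree P)) (eval_yxzt P)"
proof (induction P)
  case (pCons c P)
  show ?case
  proof (cases "P = 0")
    case False
    have "fls_low (- 2 * int (degree (pCons c P))) (y_laurent * eval_yxzt P)"
      using fls_low_mult[OF y_laurent_low pCons.IH] False by (simp add: algebra_simps)
    moreover have "fls_low (- 2 * int (degree (pCons c P))) (eval_xzt c)"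
      by (rule fls_low_mono[OF fls_low_eval_xzt]) simp
    ultimately show ?thesis unfolding eval_yxzt_pCons by (rule fls_low_add[rotated])
  qed (simp add: eval_yxzt_pCons fls_low_eval_xzt)
qed simp

text \<open>
  Modulo \<open>russell_rel\<close> the leading coefficient in \<open>y\<close> becomes \<open>g + x h\<close> with \<open>g\<close>, \<open>h\<close> free of \<open>x\<close>, and
  then no cancellation with lower powers of \<open>y\<close> is possible in the lowest order in \<open>x\<close>.
\<close>

lemma eval_yxzt_reduce:
  assumes "degree P \<le> Suc n"
  shows "(\<exists>Q P'. P = P' + russell_rel * Q \<and> degree P' \<le> n) \<or>
    (\<exists>m<0. \<exists>k. fls_low m (eval_yxzt P) \<and> eval_yxzt P $$ m \<noteq> 0 \<and> cusp ^ k dvd eval_yxzt P $$ m \<and> - m \<le> 2 * int k)"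
proof -
  define c where "c = coeff P (Suc n)"
  obtain g c' where c': "c = pCons g c'" by (cases c)
  obtain h r where r: "c' = pCons h r" by (cases c')
  define M where "M = (monom [:g, h:] (Suc n) :: zt_poly poly poly)"
  \<comment> \<open>In \<open>c = g + x h + x^2 r\<close> the last part is traded for terms of lower
    degree in \<open>y\<close>.\<close>
  define P' where "P' = P - M - russell_rel * monom r n"
  have P: "P = M + (P' + russell_rel * monom r n)" by (simp add: P'_def)
  have "coeff P' i = 0" if "i > n" for i
  proof (cases "i = Suc n")
    case True
    have rm: "russell_rel * monom r n = monom ([:cusp, 1:] * r) n + monom ([:0, 0, 1:] * r) (Suc n)"
      by (simp add: russell_rel_def smult_monom monom_Suc)
    show ?thesis
      unfolding P'_def rm using True c_def[symmetric] by (simp add: M_def c' r)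
  next
    case False
    then have "i > Suc n" using that by simp
    moreover have "degree (russell_rel * monom r n) \<le> Suc n"
      using degree_mult_le[of russell_rel "monom r n"] degree_monom_le[of r n]
      by (simp add: russell_rel_def)
    moreover have "degree M \<le> Suc n" unfolding M_def by (rule degree_monom_le)
    ultimately show ?thesis using assms by (simp add: P'_def coeff_eq_0)
  qed
  then have deg: "degree P' \<le> n" by (intro degree_le) auto
  have EVP: "eval_yxzt P = eval_yxzt M + eval_yxzt P'"
    by (subst P) (simp add: is_rhomD[OF is_rhom_eval_yxzt] eval_yxzt_russell_rel)
  have EVM: "eval_yxzt M = (fls_const g + fls_X * fls_const h) * y_laurent ^ Suc n"
    unfolding M_def eval_yxzt_def peval_monom[OF is_rhom_eval_xzt] by (simp add: eval_xzt_pCons)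
  have yp: "fls_low (- 2 * int (Suc n)) (y_laurent ^ Suc n)" "y_laurent ^ Suc n $$ (- 2 * int (Suc n)) = (- cusp) ^ Suc n"
    using fls_low_power_nth[OF y_laurent_low, of "Suc n"] y_laurent_nth by (simp_all add: algebra_simps)
  have P'_low: "fls_low (- 2 * int n) (eval_yxzt P')"
    by (rule fls_low_mono[OF eval_yxzt_low]) (use deg in simp)
  have dvd: "cusp ^ Suc n dvd a * (- cusp) ^ Suc n" for a
    by (metis dvd_mult dvd_refl minus_dvd_iff power_minus mult_dvd_mono dvd_mult_left mult_minus1 dvd_triv_right)
  \<comment> \<open>The term \<open>g y^(n+1)\<close> has order \<open>-2 n - 2\<close>, the term
    \<open>x h y^(n+1)\<close> order \<open>-2 n - 1\<close>; everything in \<open>P'\<close> has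
    order at least \<open>-2 n\<close>.\<close>
  consider "g \<noteq> 0" | "g = 0" "h \<noteq> 0" | "g = 0" "h = 0" by blast
  then show ?thesis
  proof cases
    case 1
    define m where "m = - 2 * int (Suc n)"
    have gl: "fls_low 0 (fls_const g + fls_X * fls_const h)" "(fls_const g + fls_X * fls_const h) $$ 0 = g"
      by (simp_all add: fls_low_def fls_X_times_conv_shift)
    have "fls_low m (eval_yxzt M)" "eval_yxzt M $$ m = g * (- cusp) ^ Suc n"
      using fls_low_mult[OF gl(1) yp(1)] fls_nth_mult_low[OF gl(1) yp(1)] gl(2) yp(2)
      unfolding EVM m_def by simp_all
    moreover have "fls_low m (eval_yxzt P')" "eval_yxzt P' $$ m = 0"
      using P'_low by (auto simp: m_def fls_low_def)
    ultimately have "fls_low m (eval_yxzt P)" "eval_yxzt P $$ m = g * (- cusp) ^ Suc n"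
      unfolding EVP by (auto intro: fls_low_add)
    moreover have "m < 0" "- m \<le> 2 * int (Suc n)" by (simp_all add: m_def)
    ultimately show ?thesis using 1 dvd[of g] by (metis mult_eq_0_iff neg_equal_0_iff_equal power_not_zero cusp_nz)
  next
    case 2
    define m where "m = - 2 * int (Suc n) + 1"
    have gl: "fls_low 1 (fls_X * fls_const h)" "(fls_X * fls_const h) $$ 1 = h"
      by (simp_all add: fls_low_def fls_X_times_conv_shift)
    have "fls_low m (eval_yxzt M)" "eval_yxzt M $$ m = h * (- cusp) ^ Suc n"
      using fls_low_mult[OF gl(1) yp(1)] fls_nth_mult_low[OF gl(1) yp(1)] gl(2) yp(2) 2
      unfolding EVM m_def by (simp_all add: add.commute)
    moreover have "fls_low m (eval_yxzt P')" "eval_yxzt P' $$ m = 0"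
      using P'_low by (auto simp: m_def fls_low_def)
    ultimately have "fls_low m (eval_yxzt P)" "eval_yxzt P $$ m = h * (- cusp) ^ Suc n"
      unfolding EVP by (auto intro: fls_low_add)
    moreover have "m < 0" "- m \<le> 2 * int (Suc n)" by (simp_all add: m_def)
    ultimately show ?thesis using 2 dvd[of h] by (metis mult_eq_0_iff neg_equal_0_iff_equal power_not_zero cusp_nz)
  next
    case 3
    then have "P = P' + russell_rel * monom r n" using P by (simp add: M_def)
    then show ?thesis using deg by blast
  qed
qed

text \<open>Reduction modulo the relation lowers the degree in \<open>y\<close> until
  \<open>eval_yxzt_reduce\<close> displays the lowest term; that term is unique, so it is the one at
  \<open>m\<close>. The bound on \<open>k\<close> lets the term be written as
  \<open>x^e y'^k g'\<close> with \<open>e = m + 2 k\<close> nonnegative, where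
  \<open>y' = cusp/x^2\<close>.\<close>

lemma eval_yxzt_lead:
  assumes "fls_low m (eval_yxzt P)" "m < 0" "eval_yxzt P $$ m \<noteq> 0"
  shows "\<exists>k. cusp ^ k dvd eval_yxzt P $$ m \<and> - m \<le> 2 * int k"
proof -
  have "\<exists>k. cusp ^ k dvd eval_yxzt P $$ m \<and> - m \<le> 2 * int k"
    if "degree P \<le> n" "fls_low m (eval_yxzt P)" "eval_yxzt P $$ m \<noteq> 0" for n P
    using that
  proof (induction n arbitrary: P)
    case 0
    then obtain c where "P = [:c:]" by (metis degree_eq_zeroE le_zero_eq)
    then show ?case using 0 assms(2) by (simp add: eval_yxzt_pCons eval_xzt_nth)
  next
    case (Suc n)
    from eval_yxzt_reduce[OF Suc.prems(1)] show ?case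
    proof (elim disjE exE conjE)
      fix Q P' assume P: "P = P' + russell_rel * Q" "degree P' \<le> n"
      then have "eval_yxzt P = eval_yxzt P'" by (simp add: is_rhomD[OF is_rhom_eval_yxzt] eval_yxzt_russell_rel)
      then show ?thesis using Suc P by simp
    next
      fix m' k assume m': "m' < 0" "fls_low m' (eval_yxzt P)" "eval_yxzt P $$ m' \<noteq> 0" "cusp ^ k dvd eval_yxzt P $$ m'" "- m' \<le> 2 * int k"
      have "m = m'" using m' Suc.prems fls_lowD by (metis linorder_neqE)
      then show ?thesis using m' by blast
    qed
  qed
  then show ?thesis using assms by blast
qed

text \<open>The second alternative of \<open>eval_yxzt_reduce\<close> exhibits a nonzero
  coefficient, so an element of the kernel can be reduced down to a polynomial free of
  \<open>y\<close>, where evaluation is injective.\<close>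

lemma eval_yxzt_kernel:
  assumes "eval_yxzt P = 0"
  shows "russell_rel dvd P"
proof -
  have "russell_rel dvd P" if "degree P \<le> n" "eval_yxzt P = 0" for n P
    using that
  proof (induction n arbitrary: P)
    case 0
    then obtain c where "P = [:c:]" by (metis degree_eq_zeroE le_zero_eq)
    moreover then have "c = 0" using 0 eval_xzt_eq_iff[of c 0] by (simp add: eval_yxzt_pCons)
    ultimately show ?case by simp
  next
    case (Suc n)
    from eval_yxzt_reduce[OF Suc.prems(1)] Suc.prems(2) obtain Q P' where P: "P = P' + russell_rel * Q" "degree P' \<le> n"
      by auto
    then have "eval_yxzt P = eval_yxzt P'" by (simp add: is_rhomD[OF is_rhom_eval_yxzt] eval_yxzt_russell_rel)
    then have "russell_rel dvd P'" using Suc P by simp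
    then show ?case using P by simp
  qed
  then show ?thesis using assms by blast
qed

section \<open>Kernels of locally nilpotent derivations\<close>

lemma derivation_pderiv: "derivation (pderiv :: 'a::{idom,ring_char_0} poly \<Rightarrow> 'a poly)"
  by unfold_locales (simp_all add: pderiv_add pderiv_mult algebra_simps)

lemma derivation_map_poly:
  assumes "derivation (d :: 'a::{idom,ring_char_0} \<Rightarrow> 'a)"
  shows "derivation (map_poly d)"
proof -
  interpret derivation d by fact
  show ?thesis
  proof
    show "map_poly d (p + q) = map_poly d p + map_poly d q" for p q
      by (simp add: poly_eq_iff coeff_map_poly D_add)
    show "map_poly d (p * q) = map_poly d p * q + p * map_poly d q" for p q
      by (simp add: poly_eq_iff coeff_map_poly coeff_mult D_sum D_mult sum.distrib)
  qed
qed

section \<open>Vector fields on Laurent series and their lowest parts\<close>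

lemma derivation_fls_deriv: "derivation (fls_deriv :: 'a::{idom,semiring_char_0} fls \<Rightarrow> 'a fls)"
  by unfold_locales (simp_all add: algebra_simps)

definition fls_map :: "('a::zero \<Rightarrow> 'a) \<Rightarrow> 'a fls \<Rightarrow> 'a fls" where
  "fls_map d f = Abs_fls (\<lambda>n. d (f $$ n))"

lemma fls_map_nth: "d 0 = 0 \<Longrightarrow> fls_map d f $$ n = d (f $$ n)"
  unfolding fls_map_def by (rule nth_Abs_fls_lower_bound[of "fls_subdegree f"]) auto

text \<open>A derivative may have larger subdegree than the series itself. Summation bounds that
  depend only on \<open>m\<close> and \<open>k\<close> give the three products in the Leibniz rule
  the same index range.\<close>

lemma fls_times_nth_low:
  fixes f g :: "'a::idom fls"
  assumes "fls_low m f" "fls_low k g"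
  shows "(f * g) $$ n = (\<Sum>i=m..n - k. f $$ i * g $$ (n - i))"
proof (cases "f = 0 \<or> g = 0")
  case False
  then have le: "m \<le> fls_subdegree f" "k \<le> fls_subdegree g"
    using assms by (auto intro!: fls_subdegree_geI simp: fls_low_def)
  have "(f * g) $$ n = (\<Sum>i=fls_subdegree f..n - fls_subdegree g. f $$ i * g $$ (n - i))"
    by (rule fls_times_nth(2))
  also have "\<dots> = (\<Sum>i=m..n - k. f $$ i * g $$ (n - i))"
  proof (rule sum.mono_neutral_left)
    show "\<forall>i\<in>{m..n - k} - {fls_subdegree f..n - fls_subdegree g}. f $$ i * g $$ (n - i) = 0"
    proof
      fix i assume "i \<in> {m..n - k} - {fls_subdegree f..n - fls_subdegree g}"
      then have "i < fls_subdegree f \<or> n - i < fls_subdegree g" by auto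
      then show "f $$ i * g $$ (n - i) = 0" by auto
    qed
  qed (use le in auto)
  finally show ?thesis .
qed auto

lemma derivation_fls_map:
  assumes "derivation (d :: 'a::{idom,semiring_char_0} \<Rightarrow> 'a)"
  shows "derivation (fls_map d)"
proof -
  interpret derivation d by fact
  show ?thesis
  proof
    show "fls_map d (p + q) = fls_map d p + fls_map d q" for p q
      by (simp add: fls_eq_iff fls_map_nth D_add)
    show "fls_map d (p * q) = fls_map d p * q + p * fls_map d q" for p q
    proof (rule fls_eqI)
      fix n
      note low = fls_low_subdegree[of p] fls_low_subdegree[of q]
      have low': "fls_low (fls_subdegree p) (fls_map d p)" "fls_low (fls_subdegree q) (fls_map d q)"
        by (simp_all add: fls_low_def fls_map_nth)
      show "fls_map d (p * q) $$ n = (fls_map d p * q + p * fls_map d q) $$ n"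
        by (simp add: fls_times_nth_low[OF low] fls_times_nth_low[OF low'(1) low(2)]
            fls_times_nth_low[OF low(1) low'(2)] fls_map_nth D_sum D_mult sum.distrib)
    qed
  qed
qed

lemma derivation_lincomb:
  assumes "derivation D" "derivation E"
  shows "derivation (\<lambda>f. a * D f + b * E f)"
proof -
  interpret D: derivation D by fact
  interpret E: derivation E by fact
  show ?thesis
    by unfold_locales (simp_all add: D.D_add E.D_add D.D_mult E.D_mult algebra_simps)
qed

definition dz :: "laurent \<Rightarrow> laurent" where "dz = fls_map pderiv"
definition dt :: "laurent \<Rightarrow> laurent" where "dt = fls_map (map_poly pderiv)"

interpretation dx: derivation "fls_deriv :: laurent \<Rightarrow> laurent"
  by (rule derivation_fls_deriv)
interpretation dz: derivation dz
  unfolding dz_def by (intro derivation_fls_map derivation_pderiv)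
interpretation dt: derivation dt
  unfolding dt_def by (intro derivation_fls_map derivation_map_poly derivation_pderiv)

lemma dz_nth: "dz f $$ n = pderiv (f $$ n)"
  unfolding dz_def by (rule fls_map_nth) simp

lemma dt_nth: "dt f $$ n = map_poly pderiv (f $$ n)"
  unfolding dt_def by (rule fls_map_nth) simp

definition vector_field :: "laurent \<Rightarrow> laurent \<Rightarrow> laurent \<Rightarrow> laurent \<Rightarrow> laurent" where
  "vector_field a b c f = a * fls_deriv f + b * dz f + c * dt f"

lemma derivation_vector_field: "derivation (vector_field a b c)"
proof -
  have "derivation (\<lambda>f. 1 * (a * fls_deriv f + b * dz f) + c * dt f)"
    by (intro derivation_lincomb dx.derivation_axioms dz.derivation_axioms dt.derivation_axioms)
  moreover have "(\<lambda>f. 1 * (a * fls_deriv f + b * dz f) + c * dt f) = vector_field a b c"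
    by (simp add: vector_field_def fun_eq_iff)
  ultimately show ?thesis by simp
qed

text \<open>\<open>fls_deriv\<close> lowers the order by one, hence the offset \<open>d + 1\<close>
  for \<open>a\<close>: all three summands then shift the order by \<open>d\<close>.\<close>

lemma vector_field_lead:
  assumes "fls_low (d + 1) a" "fls_low d b" "fls_low d c" "fls_low m f"
  shows "fls_low (m + d) (vector_field a b c f)"
    and "vector_field a b c f $$ (m + d) =
      a $$ (d + 1) * (of_int m * f $$ m) + b $$ d * pderiv (f $$ m) + c $$ d * map_poly pderiv (f $$ m)"
proof -
  have low: "fls_low (m - 1) (fls_deriv f)" "fls_low m (dz f)" "fls_low m (dt f)"
    using assms(4) by (simp_all add: fls_low_def dz_nth dt_nth)
  show "fls_low (m + d) (vector_field a b c f)"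
    using fls_low_mult[OF assms(1) low(1)] fls_low_mult[OF assms(2) low(2)] fls_low_mult[OF assms(3) low(3)]
    unfolding vector_field_def by (auto intro!: fls_low_add simp: algebra_simps)
  show "vector_field a b c f $$ (m + d) =
      a $$ (d + 1) * (of_int m * f $$ m) + b $$ d * pderiv (f $$ m) + c $$ d * map_poly pderiv (f $$ m)"
    using fls_nth_mult_low[OF assms(1) low(1)] fls_nth_mult_low[OF assms(2) low(2)] fls_nth_mult_low[OF assms(3) low(3)]
    unfolding vector_field_def by (simp add: algebra_simps dz_nth dt_nth)
qed

text \<open>The homogeneous element \<open>g x^i\<close> of the grading by powers of
  \<open>x\<close>.\<close>

definition homog :: "int \<Rightarrow> zt_poly \<Rightarrow> laurent" where
  "homog i g = fls_shift (- i) (fls_const g)"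

lemma homog_nth: "homog i g $$ n = (if n = i then g else 0)"
  by (simp add: homog_def)

lemma homog_0 [simp]: "homog i 0 = 0"
  by (simp add: homog_def)

lemma homog_eq_0_iff [simp]: "homog i g = 0 \<longleftrightarrow> g = 0"
  by (simp add: homog_def fls_shift_eq0_iff)

lemma homog_mult: "homog i g * homog j h = homog (i + j) (g * h)"
  by (simp add: homog_def fls_times_both_shifted_simp)

lemma homog_add: "homog i g + homog i h = homog i (g + h)"
  by (auto simp: fls_eq_iff homog_nth)

lemma homog_power: "homog i g ^ n = homog (int n * i) (g ^ n)"
  by (induction n) (simp_all add: homog_mult algebra_simps, simp add: homog_def)

lemma vector_field_hom:
  "vector_field (homog (d + 1) s) (homog d q) (homog d r) (homog m g) =
     homog (m + d) (s * (of_int m * g) + q * pderiv g + r * map_poly pderiv g)"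
proof -
  have "fls_deriv (homog m g) = homog (m - 1) (of_int m * g)"
    by (rule fls_eqI) (auto simp: homog_nth)
  moreover have "dz (homog m g) = homog m (pderiv g)"
    by (rule fls_eqI) (auto simp: homog_nth dz_nth)
  moreover have "dt (homog m g) = homog m (map_poly pderiv g)"
    by (rule fls_eqI) (auto simp: homog_nth dt_nth)
  ultimately show ?thesis
    by (simp add: vector_field_def homog_mult homog_add algebra_simps)
qed

lemma eval_yxzt_y: "eval_yxzt [:0, 1:] = y_laurent"
  unfolding eval_yxzt_def by (rule peval_X[OF is_rhom_eval_xzt])

lemma eval_yxzt_const: "eval_yxzt [:c:] = eval_xzt c"
  by (simp add: eval_yxzt_pCons)

text \<open>Supplies the degree \<open>d\<close> of the lowest part of a nonzero vector field. The
  subdegrees bound the candidates from below, so there is a least one.\<close>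

lemma first_nonzero_coefficient:
  fixes a b c :: laurent
  assumes "a \<noteq> 0 \<or> b \<noteq> 0 \<or> c \<noteq> 0"
  shows "\<exists>d. fls_low (d + 1) a \<and> fls_low d b \<and> fls_low d c \<and>
           (a $$ (d + 1) \<noteq> 0 \<or> b $$ d \<noteq> 0 \<or> c $$ d \<noteq> 0)"
proof -
  define S where "S i \<longleftrightarrow> a $$ (i + 1) \<noteq> 0 \<or> b $$ i \<noteq> 0 \<or> c $$ i \<noteq> 0" for i
  define N where "N = min (fls_subdegree a - 1) (min (fls_subdegree b) (fls_subdegree c))"
  have N: "\<not> S i" if "i < N" for i
    using that by (auto simp: S_def N_def)
  obtain i where i: "S i"
  proof -
    from assms consider j where "a $$ j \<noteq> 0" | j where "b $$ j \<noteq> 0" | j where "c $$ j \<noteq> 0"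
      by (auto simp: fls_nonzero_nth)
    then show ?thesis
    proof cases
      case (1 j)
      then show ?thesis by (intro that[of "j - 1"]) (simp add: S_def)
    qed (auto intro: that simp: S_def)
  qed
  define n where "n = (LEAST n. S (N + int n))"
  have "i = N + int (nat (i - N))" using N[of i] i by (cases "i < N") auto
  then have "S (N + int (nat (i - N)))" using i by simp
  then have n: "S (N + int n)" unfolding n_def by (rule LeastI)
  have "\<not> S j" if "j < N + int n" for j
  proof (cases "j < N")
    case False
    then have j: "j = N + int (nat (j - N))" by simp
    then have "nat (j - N) < n" using that by linarith
    then show ?thesis using not_less_Least[of "nat (j - N)" "\<lambda>n. S (N + int n)"] j by (simp add: n_def)
  qed (use N in simp)
  then have "a $$ (j + 1) = 0 \<and> b $$ j = 0 \<and> c $$ j = 0" if "j < N + int n" for j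
    using that by (auto simp: S_def)
  then have "fls_low (N + int n + 1) a" "fls_low (N + int n) b" "fls_low (N + int n) c"
    unfolding fls_low_def by (metis diff_add_cancel diff_less_eq, blast, blast)
  then show ?thesis using n unfolding S_def by blast
qed

text \<open>\<open>closed\<close> and \<open>ln\<close> say that the vector field restricts to a
  locally nilpotent derivation of the coordinate ring; its coefficients may be arbitrary Laurent
  series, because the lowest part is taken there.\<close>

theorem lnd_kernel_regular:
  assumes closed: "\<And>P. \<exists>Q. vector_field a b c (eval_yxzt P) = eval_yxzt Q"
    and ln: "\<And>P. \<exists>n. (vector_field a b c ^^ n) (eval_yxzt P) = 0"
    and nz: "a \<noteq> 0 \<or> b \<noteq> 0 \<or> c \<noteq> 0"
    and f: "vector_field a b c (eval_yxzt P) = 0" "fls_low m (eval_yxzt P)" "eval_yxzt P $$ m \<noteq> 0"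
  shows "m \<ge> 0"
proof (rule ccontr)
  assume "\<not> m \<ge> 0"
  then have m: "m < 0" by simp
  obtain d where d: "fls_low (d + 1) a" "fls_low d b" "fls_low d c"
    and nz': "a $$ (d + 1) \<noteq> 0 \<or> b $$ d \<noteq> 0 \<or> c $$ d \<noteq> 0"
    using first_nonzero_coefficient[OF nz] by blast
  define s q r where "s = a $$ (d + 1)" "q = b $$ d" "r = c $$ d"
  define D where "D = vector_field (homog (d + 1) s) (homog d q) (homog d r)"
  interpret D: derivation D unfolding D_def by (rule derivation_vector_field)
  \<comment> \<open>\<open>g x^i\<close> is the part of order \<open>i\<close> of a ring element of
    order at least \<open>i\<close>. Since \<open>g = 0\<close> is allowed, the notion is stable
    under \<open>D\<close>.\<close>
  define adm where "adm i g \<longleftrightarrow> (\<exists>P. fls_low i (eval_yxzt P) \<and> eval_yxzt P $$ i = g)" for i g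
  have lead: "D (homog i (f $$ i)) = homog (i + d) (vector_field a b c f $$ (i + d)) \<and> fls_low (i + d) (vector_field a b c f)"
    if "fls_low i f" for i f
    using vector_field_lead[OF d that] by (simp add: D_def vector_field_hom s_q_r_def)
  have leadn: "(D ^^ n) (homog i (f $$ i)) = homog (i + int n * d) ((vector_field a b c ^^ n) f $$ (i + int n * d)) \<and>
      fls_low (i + int n * d) ((vector_field a b c ^^ n) f)" if "fls_low i f" for i f n
  proof (induction n)
    case (Suc n)
    then show ?case using lead[of "i + int n * d" "(vector_field a b c ^^ n) f"]
      by (simp add: algebra_simps)
  qed (simp add: that)
  have closedn: "\<exists>Q. (vector_field a b c ^^ n) (eval_yxzt P) = eval_yxzt Q" for n P
  proof (induction n)
    case (Suc n)
    then show ?case using closed by auto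
  qed auto
  have adm_D: "\<exists>g'. (D ^^ n) (homog i g) = homog (i + int n * d) g' \<and> adm (i + int n * d) g'" if g: "adm i g" for i g n
  proof -
    obtain P where "fls_low i (eval_yxzt P)" "eval_yxzt P $$ i = g" using g by (auto simp: adm_def)
    moreover obtain Q where "(vector_field a b c ^^ n) (eval_yxzt P) = eval_yxzt Q" using closedn by blast
    ultimately show ?thesis using leadn[of i "eval_yxzt P" n] by (auto simp: adm_def)
  qed
  have adm_nil: "D.nil (homog i g)" if g: "adm i g" for i g
  proof -
    obtain P where P: "fls_low i (eval_yxzt P)" "eval_yxzt P $$ i = g" using g by (auto simp: adm_def)
    obtain n where "(vector_field a b c ^^ n) (eval_yxzt P) = 0" using ln by blast
    then show ?thesis using leadn[OF P(1), of n] P(2) by (intro D.nilI[of n]) simp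
  qed
  define x y z t w where "x = homog 1 1" "y = homog (- 2) cusp" "z = homog 0 z_poly" "t = homog 0 t_poly" "w = homog 0 cusp"
  note defs = x_y_z_t_w_def
  have adm0: "adm 0 g" for g
    unfolding adm_def by (rule exI[of _ "[:[:g:]:]"]) (simp add: eval_yxzt_const eval_xzt_pCons fls_low_const)
  have adm_x: "adm 1 1"
    unfolding adm_def by (rule exI[of _ "[:[:0, 1:]:]"]) (simp add: eval_yxzt_const eval_xzt_pCons fls_low_def)
  have "adm (- 2) (- cusp)"
    unfolding adm_def by (rule exI[of _ "[:0, 1:]"]) (use y_laurent_low y_laurent_nth in \<open>simp add: eval_yxzt_y\<close>)
  from adm_nil[OF this] have "D.nil (- y)"
    by (simp add: defs homog_def fls_shift_uminus)
  then have nil_y: "D.nil y" using D.nil_minus by fastforce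
  have nil_x: "D.nil x" using adm_nil[OF adm_x] by (simp add: defs)
  have nil0: "D.nil (homog 0 g)" for g using adm_nil[OF adm0] .
  have x_nz: "x \<noteq> 0" and y_nz: "y \<noteq> 0" and w_nz: "w \<noteq> 0" and z_nz: "z \<noteq> 0" and t_nz: "t \<noteq> 0"
    by (simp_all add: defs z_poly_def t_poly_def)
  have w_eq: "w = z\<^sup>2 + t ^ 3" by (simp add: defs homog_power homog_add cusp_def)
  have w_eq': "w = x\<^sup>2 * y" by (simp add: defs homog_power homog_mult)
  \<comment> \<open>\<open>y\<close> has degree -2, so \<open>e\<close> has the parity of
    \<open>i\<close>. For \<open>g = 0\<close> any natural exponents with this relation
    serve.\<close>
  have factor: "\<exists>e k g'. homog i g = x ^ e * y ^ k * homog 0 g' \<and> int e = i + 2 * int k" if "adm i g" for i g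
  proof (cases "i < 0 \<and> g \<noteq> 0")
    case True
    with that obtain k g' where k: "g = cusp ^ k * g'" "- i \<le> 2 * int k"
      unfolding adm_def using eval_yxzt_lead by (blast elim: dvdE)
    have "homog i g = x ^ nat (i + 2 * int k) * y ^ k * homog 0 g'"
      using k by (simp add: defs homog_power homog_mult)
    then show ?thesis using k by (intro exI[of _ "nat (i + 2 * int k)"] exI[of _ k] exI[of _ g']) simp
  next
    case False
    show ?thesis
    proof (cases "i < 0")
      case True
      then show ?thesis using False
        by (intro exI[of _ "nat (i + 2 * int (nat (- i)))"] exI[of _ "nat (- i)"] exI[of _ 0]) simp
    next
      case i: False
      then show ?thesis
        by (intro exI[of _ "nat i"] exI[of _ 0] exI[of _ g]) (simp add: defs homog_power homog_mult)
    qed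
  qed
  have odd_fact: "\<exists>n. D.nil n \<and> homog i g = x * n" if adm: "adm i g" and odd: "odd i" for i g
  proof -
    obtain e k g' where *: "homog i g = x ^ e * y ^ k * homog 0 g'" "int e = i + 2 * int k"
      using factor[OF adm] by blast
    then have "odd (int e)" using odd by simp
    then have "x ^ e = x * x ^ (e - 1)" by (cases e) auto
    then have "homog i g = x * (x ^ (e - 1) * y ^ k * homog 0 g')" using * by (simp add: mult.assoc)
    moreover have "D.nil (x ^ (e - 1) * y ^ k * homog 0 g')"
      using nil_x nil_y nil0 by (intro D.nil_mult D.nil_power)
    ultimately show ?thesis by blast
  qed
  have "D y = 0"
  proof -
    define g where "g = eval_yxzt P $$ m"
    have "adm m g" using f(2) by (auto simp: adm_def g_def)
    then obtain e k g' where *: "homog m g = x ^ e * y ^ k * homog 0 g'" "int e = m + 2 * int k"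
      using factor by blast
    \<comment> \<open>\<open>m < 0\<close> forces \<open>k > 0\<close>, because
      \<open>m + 2 k\<close> equals the natural number \<open>e\<close>.\<close>
    then have "y ^ k = y * y ^ (k - 1)" using m by (cases k) auto
    then have eq: "homog m g = y * (x ^ e * y ^ (k - 1) * homog 0 g')" using * by (simp add: algebra_simps)
    have "D (homog m g) = 0" using lead[OF f(2)] f(1) by (simp add: g_def)
    moreover have "homog m g \<noteq> 0" using f(3) by (simp add: g_def)
    moreover have "D.nil (x ^ e * y ^ (k - 1) * homog 0 g')"
      using nil_x nil_y nil0 by (intro D.nil_mult D.nil_power)
    ultimately show ?thesis using D.ker_factorial(1)[OF nil_y, of "x ^ e * y ^ (k - 1) * homog 0 g'"] eq by simp
  qed
  \<comment> \<open>If \<open>D\<close> killed \<open>x\<close> as well as \<open>y\<close>, it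
    would kill \<open>w = x^2 y\<close>, then \<open>z\<close> and \<open>t\<close> by
    \<open>cusp_ker\<close>, and the three leading coefficients \<open>s\<close>, \<open>q\<close>,
    \<open>r\<close> would all vanish.\<close>
  have Dx: "D x \<noteq> 0"
  proof
    assume Dx: "D x = 0"
    then have "D w = 0" using \<open>D y = 0\<close> by (simp add: w_eq' power2_eq_square D.D_mult)
    then have "D z = 0 \<and> D t = 0"
      using D.cusp_ker[of z t] nil0 w_nz by (simp add: w_eq[symmetric]) (simp add: defs)
    moreover have "D z = homog d q" "D t = homog d r"
    proof -
      have c: "pderiv z_poly = 1" "map_poly pderiv z_poly = 0" "pderiv t_poly = 0" "map_poly pderiv t_poly = 1"
        by (simp_all add: z_poly_def t_poly_def map_poly_pCons pderiv_pCons one_pCons)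
      show "D z = homog d q" "D t = homog d r"
        unfolding D_def defs vector_field_hom c by simp_all
    qed
    moreover have "D x = homog (1 + d) s"
    proof -
      have c: "pderiv (1 :: zt_poly) = 0" "map_poly pderiv (1 :: zt_poly) = 0"
        by (simp_all add: one_pCons map_poly_pCons)
      show ?thesis unfolding D_def defs vector_field_hom c by simp
    qed
    ultimately have "s = 0" "q = 0" "r = 0" using Dx by simp_all
    then show False using nz' by (simp add: s_q_r_def)
  qed
  have ker_x: "D u \<noteq> 0" if "u = x * n" "D.nil n" "u \<noteq> 0" for u n
    using D.ker_factorial(1)[OF nil_x that(2)] that Dx by auto
  \<comment> \<open>For even \<open>d\<close>, the element \<open>D x\<close> has odd degree
    \<open>1 + d\<close> and is a multiple of \<open>x\<close>, which forces
    \<open>D x = 0\<close>.\<close>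
  have "odd d"
  proof (rule ccontr)
    assume "\<not> odd d"
    moreover obtain g' where g': "D x = homog (1 + d) g'" "adm (1 + d) g'"
      using adm_D[OF adm_x, of 1] by (auto simp: defs)
    ultimately obtain n where "D.nil n" "D x = x * n" using odd_fact[of "1 + d" g'] by auto
    then show False using D.dvd_D_imp_ker[OF nil_x] Dx by blast
  qed
  \<comment> \<open>Were the degree \<open>k\<close> odd, the last nonzero iterate would have odd
    degree \<open>k d\<close> in \<open>x\<close>, so \<open>x\<close> would divide a nonzero kernel
    element and lie in the kernel itself.\<close>
  have even_dg: "even (D.dg (homog 0 g))" if "g \<noteq> 0" for g
  proof (rule ccontr)
    define k where "k = D.dg (homog 0 g)"
    assume "\<not> even (D.dg (homog 0 g))"
    then have "odd (0 + int k * d)" using \<open>odd d\<close> by (simp add: k_def)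
    then obtain n where n: "D.nil n" "(D ^^ k) (homog 0 g) = x * n"
      using adm_D[OF adm0[of g], of k] odd_fact by metis
    have "(D ^^ k) (homog 0 g) \<noteq> 0" unfolding k_def using that nil0 by (intro D.Dn_dg) auto
    then have "D ((D ^^ k) (homog 0 g)) \<noteq> 0" using ker_x n by blast
    then show False using D.Dn_Suc_dg[OF nil0[of g]] by (simp add: k_def)
  qed
  have "D.dg x = 1"
  proof -
    define k where "k = D.dg x"
    have k: "(D ^^ k) x \<noteq> 0" "D ((D ^^ k) x) = 0"
      using D.Dn_dg[OF nil_x x_nz] D.Dn_Suc_dg[OF nil_x] by (simp_all add: k_def)
    have "odd k"
    proof (rule ccontr)
      assume "\<not> odd k"
      then have "odd (1 + int k * d)" by simp
      then obtain n where n: "D.nil n" "(D ^^ k) x = x * n"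
        using adm_D[OF adm_x, of k] odd_fact unfolding defs by metis
      then show False using ker_x k by blast
    qed
    \<comment> \<open>The iterate before the last nonzero one also has odd degree in
      \<open>x\<close>, so it equals \<open>x n\<close>. Its \<open>dg\<close> is 1, and
      \<open>dg x\<close> cannot exceed that.\<close>
    then obtain l where l: "k = Suc l" "even l" by (cases k) auto
    then have "odd (1 + int l * d)" by simp
    then obtain n where n: "D.nil n" "(D ^^ l) x = x * n"
      using adm_D[OF adm_x, of l] odd_fact unfolding defs by metis
    have "D.dg (x * n) = 1" using n(2) k l by (intro D.dg_eqI) (simp_all add: n(2)[symmetric])
    moreover have "n \<noteq> 0" using k l n by auto
    ultimately have "k \<le> 1" using D.dg_mult[OF nil_x n(1) x_nz] by (simp add: k_def)
    then show ?thesis using l by (simp add: k_def)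
  qed
  moreover have "D.dg y = 0" using \<open>D y = 0\<close> nil_y by (simp add: D.dg_0_iff)
  ultimately have "D.dg w = 2"
    unfolding w_eq' using nil_x nil_y x_nz y_nz by (simp add: D.dg_mult D.dg_power D.nil_power)
  then show False
    using D.no_even_cusp_of_degree_2[of z t] nil0 even_dg[of z_poly] even_dg[of t_poly] z_nz t_nz
    unfolding w_eq by (simp add: defs)
qed

section \<open>The coordinate ring is not generated by three elements\<close>

definition cst :: "complex \<Rightarrow> laurent" where
  "cst c = fls_const [:[:c:]:]"

lemma is_rhom_cst: "is_rhom cst"
  by (simp add: is_rhom_def cst_def fls_plus_const flip: one_pCons)

lemma cst_eq_iff [simp]: "cst c = cst d \<longleftrightarrow> c = d"
  unfolding cst_def by (metis fls_const_nth pCons_eq_iff)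

lemma cst_eq_0_iff [simp]: "cst c = 0 \<longleftrightarrow> c = 0"
  by (simp add: cst_def)

section \<open>Subalgebras and generating sets\<close>

definition subalg :: "laurent set \<Rightarrow> bool" where
  "subalg S \<longleftrightarrow> range cst \<subseteq> S \<and> (\<forall>a\<in>S. \<forall>b\<in>S. a + b \<in> S \<and> a * b \<in> S)"

inductive_set alg :: "laurent set \<Rightarrow> laurent set" for S where
  alg_cst: "cst c \<in> alg S"
| alg_gen: "s \<in> S \<Longrightarrow> s \<in> alg S"
| alg_add: "a \<in> alg S \<Longrightarrow> b \<in> alg S \<Longrightarrow> a + b \<in> alg S"
| alg_mult: "a \<in> alg S \<Longrightarrow> b \<in> alg S \<Longrightarrow> a * b \<in> alg S"

lemma subalg_alg: "subalg (alg S)"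
  by (auto simp: subalg_def intro: alg_cst alg_add alg_mult)

lemma alg_least:
  assumes "subalg T" "S \<subseteq> T"
  shows "alg S \<subseteq> T"
proof
  fix a assume "a \<in> alg S"
  then show "a \<in> T"
    by induction (use assms in \<open>auto simp: subalg_def\<close>)
qed

lemma peval_in_subalg:
  assumes "subalg S" "is_rhom f" "range f \<subseteq> S" "a \<in> S"
  shows "peval f a p \<in> S"
proof (induction p)
  case 0
  then show ?case using assms(1) by (auto simp: subalg_def)
next
  case (pCons c p)
  have "f c \<in> S" using assms(3) by auto
  then show ?case using assms(1,4) pCons.IH by (auto simp: subalg_def peval_pCons[OF assms(2)])
qed

text \<open>The isomorphic copy of the coordinate ring inside the Laurent series.\<close>

definition russell_alg :: "laurent set" where "russell_alg = range eval_yxzt"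

lemma eval_xzt_cst: "eval_xzt [:[:[:c:]:]:] = cst c"
  by (simp add: eval_xzt_pCons cst_def)

lemma eval_yxzt_cst: "eval_yxzt [:[:[:[:c:]:]:]:] = cst c"
  by (simp add: eval_yxzt_pCons eval_xzt_cst)

lemma subalg_russell_alg: "subalg russell_alg"
  unfolding russell_alg_def subalg_def
  by (auto simp flip: eval_yxzt_cst is_rhomD(3)[OF is_rhom_eval_yxzt] is_rhomD(4)[OF is_rhom_eval_yxzt])

lemma russell_alg_eval_xzt: "eval_xzt p \<in> russell_alg"
  unfolding russell_alg_def using eval_yxzt_const by (metis rangeI)

lemma russell_alg_const: "fls_const g \<in> russell_alg"
  using russell_alg_eval_xzt[of "[:g:]"] by (simp add: eval_xzt_pCons)

lemma russell_alg_X: "fls_X \<in> russell_alg"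
  using russell_alg_eval_xzt[of "[:0, 1:]"] by (simp add: eval_xzt_pCons)

lemma russell_alg_y: "y_laurent \<in> russell_alg"
  unfolding russell_alg_def using eval_yxzt_y by (metis rangeI)

lemma fls_const_eq_peval: "fls_const g = peval (peval cst (fls_const t_poly)) (fls_const z_poly) g"
proof -
  note r = is_rhom_cst is_rhom_peval[OF is_rhom_cst]
  have 1: "fls_const [:p:] = peval cst (fls_const t_poly) p" for p
  proof (induction p)
    case (pCons c p)
    have "[:pCons c p:] = [:[:c:]:] + t_poly * [:p:]" by (simp add: t_poly_def)
    then have "fls_const [:pCons c p:] = cst c + fls_const t_poly * fls_const [:p:]"
      by (simp only: cst_def is_rhomD[OF is_rhom_fls_const])
    then show ?case using pCons by (simp add: peval_pCons[OF is_rhom_cst])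
  qed simp
  show ?thesis
  proof (induction g)
    case (pCons c p)
    have "pCons c p = [:c:] + z_poly * p" by (simp add: z_poly_def)
    then have "fls_const (pCons c p) = fls_const [:c:] + fls_const z_poly * fls_const p"
      by (simp only: is_rhomD[OF is_rhom_fls_const])
    then show ?case using pCons by (simp add: peval_pCons[OF r(2)] 1)
  qed simp
qed

lemma eval_xzt_in_alg: "eval_xzt p \<in> alg {fls_X, fls_const z_poly, fls_const t_poly}" (is "_ \<in> alg ?S")
proof -
  note sa = subalg_alg[of ?S]
  have gen: "fls_X \<in> alg ?S" "fls_const z_poly \<in> alg ?S" "fls_const t_poly \<in> alg ?S"
    by (auto intro: alg_gen)
  have "peval cst (fls_const t_poly) p \<in> alg ?S" for p
    by (rule peval_in_subalg[OF sa is_rhom_cst _ gen(3)]) (auto intro: alg_cst)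
  then have pg: "peval (peval cst (fls_const t_poly)) (fls_const z_poly) g \<in> alg ?S" for g
    by (intro peval_in_subalg[OF sa is_rhom_peval[OF is_rhom_cst] _ gen(2)]) auto
  have "fls_const g \<in> alg ?S" for g
    using pg[of g] by (simp only: fls_const_eq_peval[of g, symmetric])
  then show ?thesis
    unfolding eval_xzt_def by (intro peval_in_subalg[OF sa is_rhom_fls_const _ gen(1)]) auto
qed

lemma russell_alg_eq: "russell_alg = alg {fls_X, fls_const z_poly, fls_const t_poly, y_laurent}" (is "_ = alg ?S")
proof
  show "alg ?S \<subseteq> russell_alg"
    using subalg_russell_alg russell_alg_X russell_alg_const russell_alg_y by (intro alg_least) auto
  have "alg {fls_X, fls_const z_poly, fls_const t_poly} \<subseteq> alg ?S"
    by (intro alg_least subalg_alg) (auto intro: alg_gen)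
  then have "eval_xzt p \<in> alg ?S" for p using eval_xzt_in_alg by blast
  moreover have "y_laurent \<in> alg ?S" by (auto intro: alg_gen)
  ultimately have "eval_yxzt P \<in> alg ?S" for P
    unfolding eval_yxzt_def by (intro peval_in_subalg[OF subalg_alg is_rhom_eval_xzt]) auto
  then show "russell_alg \<subseteq> alg ?S"
    unfolding russell_alg_def by auto
qed

text \<open>Variables are adjoined one at a time. The terms with \<open>e1\<close> and
  \<open>e2\<close> carry the contributions of up to two variables already present in the
  coefficients.\<close>

lemma peval_chain_rule:
  assumes "derivation E" "is_rhom f" "d1 0 = 0" "d2 0 = 0"
    and f: "\<And>c. E (f c) = f (d1 c) * e1 + f (d2 c) * e2"
  shows "E (peval f a p) = peval f a (map_poly d1 p) * e1 + peval f a (map_poly d2 p) * e2 + peval f a (pderiv p) * E a"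
proof -
  interpret derivation E by fact
  note s = peval_pCons[OF assms(2)] is_rhomD[OF assms(2)] is_rhomD[OF is_rhom_peval[OF assms(2)]]
  show ?thesis
  proof (induction p)
    case (pCons c p)
    have "E (peval f a (pCons c p)) = f (d1 c) * e1 + f (d2 c) * e2 + (E a * peval f a p + a * E (peval f a p))"
      by (simp only: s D_add D_mult f)
    then show ?case
      unfolding pCons.IH by (simp add: s map_poly_pCons assms(3,4) pderiv_pCons distrib_left distrib_right ac_simps)
  qed simp
qed

definition eval_gens :: "laurent \<Rightarrow> laurent \<Rightarrow> laurent \<Rightarrow> complex poly poly poly \<Rightarrow> laurent" where
  "eval_gens u1 u2 u3 = peval (peval (peval cst u1) u2) u3"

lemma is_rhom_eval_gens: "is_rhom (eval_gens u1 u2 u3)"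
  unfolding eval_gens_def by (intro is_rhom_peval is_rhom_cst)

lemma eval_gens_chain_rule:
  assumes E: "derivation E" "\<And>c. E (cst c) = 0"
  shows "E (eval_gens u1 u2 u3 F) = eval_gens u1 u2 u3 (map_poly (map_poly pderiv) F) * E u1 +
     eval_gens u1 u2 u3 (map_poly pderiv F) * E u2 + eval_gens u1 u2 u3 (pderiv F) * E u3"
proof -
  have 1: "E (peval cst u1 p) = peval cst u1 (pderiv p) * E u1" for p
    using peval_chain_rule[OF E(1) is_rhom_cst, of "\<lambda>_. 0" "\<lambda>_. 0" 0 0] by (simp add: E(2))
  have 2: "E (peval (peval cst u1) u2 p) = peval (peval cst u1) u2 (map_poly pderiv p) * E u1 +
      peval (peval cst u1) u2 (pderiv p) * E u2" for p
    using peval_chain_rule[OF E(1) is_rhom_peval[OF is_rhom_cst], of pderiv "\<lambda>_. 0" _ "E u1" 0] 1 by simp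
  show ?thesis
    unfolding eval_gens_def
    by (intro peval_chain_rule[OF E(1) is_rhom_peval[OF is_rhom_peval[OF is_rhom_cst]]] 2) auto
qed

lemma eval_gens_in_subalg:
  assumes "subalg S" "u1 \<in> S" "u2 \<in> S" "u3 \<in> S"
  shows "eval_gens u1 u2 u3 F \<in> S"
  unfolding eval_gens_def using assms
  by (intro peval_in_subalg is_rhom_peval is_rhom_cst image_subsetI) (auto simp: subalg_def)

lemma subalg_range:
  assumes f: "is_rhom f" and cst: "range cst \<subseteq> range f"
  shows "subalg (range f)"
  unfolding subalg_def
proof (intro conjI ballI cst)
  fix a b assume "a \<in> range f" "b \<in> range f"
  then obtain p q where "a = f p" "b = f q" by auto
  then have "a + b = f (p + q)" "a * b = f (p * q)" by (simp_all add: is_rhomD[OF f])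
  then show "a + b \<in> range f" "a * b \<in> range f" by simp_all
qed

lemma alg_3_subset_range_eval_gens: "alg {u1, u2, u3} \<subseteq> range (eval_gens u1 u2 u3)"
proof (rule alg_least)
  note r = is_rhom_cst is_rhom_peval[OF is_rhom_cst] is_rhom_peval[OF is_rhom_peval[OF is_rhom_cst]]
  have c: "cst c = eval_gens u1 u2 u3 [:[:[:c:]:]:]" for c
    by (simp add: eval_gens_def r peval_const)
  show "subalg (range (eval_gens u1 u2 u3))"
    by (rule subalg_range[OF is_rhom_eval_gens]) (use c in auto)
  have "eval_gens u1 u2 u3 [:[:[:0, 1:]:]:] = u1" "eval_gens u1 u2 u3 [:[:0, 1:]:] = u2" "eval_gens u1 u2 u3 [:0, 1:] = u3"
    by (simp_all add: eval_gens_def r peval_const peval_X)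
  then have "u1 \<in> range (eval_gens u1 u2 u3)" "u2 \<in> range (eval_gens u1 u2 u3)" "u3 \<in> range (eval_gens u1 u2 u3)"
    by (metis rangeI)+
  then show "{u1, u2, u3} \<subseteq> range (eval_gens u1 u2 u3)" by blast
qed

section \<open>Invertibility of three by three Jacobian matrices\<close>

definition det3 :: "'a::idom \<Rightarrow> 'a \<Rightarrow> 'a \<Rightarrow> 'a \<Rightarrow> 'a \<Rightarrow> 'a \<Rightarrow> 'a \<Rightarrow> 'a \<Rightarrow> 'a \<Rightarrow> 'a"
    where "det3 x1 x2 x3 y1 y2 y3 z1 z2 z3 =
      x1 * (y2 * z3 - y3 * z2) - x2 * (y1 * z3 - y3 * z1) + x3 * (y1 * z2 - y2 * z1)" for x1 x2 x3 y1 y2 y3 z1 z2 z3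

lemma det3_lin1: "det3 (p * x1 + q * y1 + r * z1) (p * x2 + q * y2 + r * z2) (p * x3 + q * y3 + r * z3) v1 v2 v3 w1 w2 w3
      = p * det3 x1 x2 x3 v1 v2 v3 w1 w2 w3 + q * det3 y1 y2 y3 v1 v2 v3 w1 w2 w3 + r * det3 z1 z2 z3 v1 v2 v3 w1 w2 w3"
    for p q r x1 x2 x3 y1 y2 y3 z1 z2 z3 v1 v2 v3 w1 w2 w3
    unfolding det3_def by (simp add: algebra_simps)

lemma det3_swap: "det3 x1 x2 x3 y1 y2 y3 z1 z2 z3 = - det3 y1 y2 y3 x1 x2 x3 z1 z2 z3"
    "det3 x1 x2 x3 y1 y2 y3 z1 z2 z3 = - det3 z1 z2 z3 y1 y2 y3 x1 x2 x3"
    "det3 x1 x2 x3 y1 y2 y3 z1 z2 z3 = - det3 x1 x2 x3 z1 z2 z3 y1 y2 y3" for x1 x2 x3 y1 y2 y3 z1 z2 z3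
    unfolding det3_def by (simp_all add: algebra_simps)

lemma det3_lin2: "det3 v1 v2 v3 (p * x1 + q * y1 + r * z1) (p * x2 + q * y2 + r * z2) (p * x3 + q * y3 + r * z3) w1 w2 w3
      = p * det3 v1 v2 v3 x1 x2 x3 w1 w2 w3 + q * det3 v1 v2 v3 y1 y2 y3 w1 w2 w3 + r * det3 v1 v2 v3 z1 z2 z3 w1 w2 w3"
    for p q r x1 x2 x3 y1 y2 y3 z1 z2 z3 v1 v2 v3 w1 w2 w3
    by (subst (1 2 3 4) det3_swap(1)) (simp add: det3_lin1)

lemma det3_lin3: "det3 v1 v2 v3 w1 w2 w3 (p * x1 + q * y1 + r * z1) (p * x2 + q * y2 + r * z2) (p * x3 + q * y3 + r * z3)
      = p * det3 v1 v2 v3 w1 w2 w3 x1 x2 x3 + q * det3 v1 v2 v3 w1 w2 w3 y1 y2 y3 + r * det3 v1 v2 v3 w1 w2 w3 z1 z2 z3"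
    for p q r x1 x2 x3 y1 y2 y3 z1 z2 z3 v1 v2 v3 w1 w2 w3
    by (subst (1 2 3 4) det3_swap(2)) (simp add: det3_lin1)

lemma det3_repeat: "det3 x1 x2 x3 x1 x2 x3 z1 z2 z3 = 0" "det3 x1 x2 x3 z1 z2 z3 x1 x2 x3 = 0" "det3 z1 z2 z3 x1 x2 x3 x1 x2 x3 = 0"
    for x1 x2 x3 z1 z2 z3
    unfolding det3_def by (simp_all add: algebra_simps)

text \<open>Linearity in the rows expands the right side into determinants of rows of the second
  matrix; those with a repeated row vanish and the six others are \<open>d\<close> up to
  sign.\<close>

lemma det3_mult: "det3 A11 A12 A13 A21 A22 A23 A31 A32 A33 * det3 a1 b1 c1 a2 b2 c2 a3 b3 c3 =
     det3 (A11 * a1 + A12 * a2 + A13 * a3) (A11 * b1 + A12 * b2 + A13 * b3) (A11 * c1 + A12 * c2 + A13 * c3)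
       (A21 * a1 + A22 * a2 + A23 * a3) (A21 * b1 + A22 * b2 + A23 * b3) (A21 * c1 + A22 * c2 + A23 * c3)
       (A31 * a1 + A32 * a2 + A33 * a3) (A31 * b1 + A32 * b2 + A33 * b3) (A31 * c1 + A32 * c2 + A33 * c3)"
proof -
  define d where "d = det3 a1 b1 c1 a2 b2 c2 a3 b3 c3"
  have perm: "det3 a1 b1 c1 a2 b2 c2 a3 b3 c3 = d" "det3 a2 b2 c2 a1 b1 c1 a3 b3 c3 = - d"
    "det3 a3 b3 c3 a2 b2 c2 a1 b1 c1 = - d" "det3 a1 b1 c1 a3 b3 c3 a2 b2 c2 = - d"
    "det3 a2 b2 c2 a3 b3 c3 a1 b1 c1 = d" "det3 a3 b3 c3 a1 b1 c1 a2 b2 c2 = d"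
    unfolding d_def det3_def by (simp_all add: algebra_simps)
  show ?thesis
    unfolding det3_lin1 det3_lin2 det3_lin3 det3_repeat perm unfolding det3_def[of A11] by (simp add: algebra_simps)
qed

text \<open>The left inverse makes the determinant nonzero, and Cramer's rule solves the homogeneous
  system: the three displayed identities are multiplication by the adjugate.\<close>

lemma left_inverse_3_imp_injective:
  fixes a1 :: "'a::idom"
  assumes A: "A11 * a1 + A12 * a2 + A13 * a3 = 1" "A11 * b1 + A12 * b2 + A13 * b3 = 0" "A11 * c1 + A12 * c2 + A13 * c3 = 0"
    "A21 * a1 + A22 * a2 + A23 * a3 = 0" "A21 * b1 + A22 * b2 + A23 * b3 = 1" "A21 * c1 + A22 * c2 + A23 * c3 = 0"
    "A31 * a1 + A32 * a2 + A33 * a3 = 0" "A31 * b1 + A32 * b2 + A33 * b3 = 0" "A31 * c1 + A32 * c2 + A33 * c3 = 1"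
  and f: "f1 * a1 + f2 * a2 + f3 * a3 = 0" "f1 * b1 + f2 * b2 + f3 * b3 = 0" "f1 * c1 + f2 * c2 + f3 * c3 = 0"
  shows "f1 = 0 \<and> f2 = 0 \<and> f3 = 0"
proof -
  have nz: "det3 a1 b1 c1 a2 b2 c2 a3 b3 c3 \<noteq> 0"
    using det3_mult[of A11 A12 A13 A21 A22 A23 A31 A32 A33 a1 b1 c1 a2 b2 c2 a3 b3 c3] unfolding A by (auto simp: det3_def)
  have "f1 * det3 a1 b1 c1 a2 b2 c2 a3 b3 c3 =
      (f1 * a1 + f2 * a2 + f3 * a3) * (b2 * c3 - c2 * b3)
    + (f1 * b1 + f2 * b2 + f3 * b3) * (c2 * a3 - a2 * c3)
    + (f1 * c1 + f2 * c2 + f3 * c3) * (a2 * b3 - b2 * a3)"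
    unfolding det3_def by (simp add: algebra_simps)
  moreover have "f2 * det3 a1 b1 c1 a2 b2 c2 a3 b3 c3 =
      (f1 * a1 + f2 * a2 + f3 * a3) * (b3 * c1 - c3 * b1)
    + (f1 * b1 + f2 * b2 + f3 * b3) * (c3 * a1 - a3 * c1)
    + (f1 * c1 + f2 * c2 + f3 * c3) * (a3 * b1 - b3 * a1)"
    unfolding det3_def by (simp add: algebra_simps)
  moreover have "f3 * det3 a1 b1 c1 a2 b2 c2 a3 b3 c3 =
      (f1 * a1 + f2 * a2 + f3 * a3) * (b1 * c2 - c1 * b2)
    + (f1 * b1 + f2 * b2 + f3 * b3) * (c1 * a2 - a1 * c2)
    + (f1 * c1 + f2 * c2 + f3 * c3) * (a1 * b2 - b1 * a2)"
    unfolding det3_def by (simp add: algebra_simps)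
  ultimately show ?thesis unfolding f using nz by simp
qed

text \<open>In characteristic zero a nonconstant polynomial has a nonzero derivative of smaller
  degree, so differentiation ends at a nonzero constant.\<close>

lemma pderiv_closed_contains_constant:
  fixes F :: "'a::{idom,ring_char_0} poly"
  assumes "\<And>G. G \<in> I \<Longrightarrow> pderiv G \<in> I" "F \<in> I" "F \<noteq> 0"
  shows "\<exists>c. c \<noteq> 0 \<and> [:c:] \<in> I"
  using assms(2,3)
proof (induction "degree F" arbitrary: F rule: less_induct)
  case less
  show ?case
  proof (cases "degree F = 0")
    case True
    then obtain c where "F = [:c:]" by (metis degree_eq_zeroE)
    then show ?thesis using less.prems by auto
  next
    case False
    then have "pderiv F \<noteq> 0" "degree (pderiv F) < degree F"
      by (simp_all add: pderiv_eq_0_iff degree_pderiv)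
    then show ?thesis using less assms(1) by blast
  qed
qed

lemma pderiv_nilpotent:
  fixes F :: "'a::{idom,ring_char_0} poly"
  shows "\<exists>n. (pderiv ^^ n) F = 0"
proof (induction "degree F" arbitrary: F rule: less_induct)
  case less
  show ?case
  proof (cases "degree F = 0")
    case True
    then have "(pderiv ^^ 1) F = 0" by (simp add: pderiv_eq_0_iff)
    then show ?thesis by blast
  next
    case False
    then have "degree (pderiv F) < degree F" by (simp add: degree_pderiv)
    then obtain n where "(pderiv ^^ n) (pderiv F) = 0" using less by blast
    then have "(pderiv ^^ Suc n) F = 0" by (simp add: funpow_swap1)
    then show ?thesis by blast
  qed
qed

text \<open>The derivation used is the partial derivative with respect to \<open>u3\<close>, which
  kills \<open>u1\<close>. Written in the coordinates \<open>x\<close>, \<open>z\<close>,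
  \<open>t\<close> it is a vector field to which \<open>lnd_kernel_regular\<close> applies;
  permuting the generators covers \<open>u2\<close> and \<open>u3\<close>.\<close>

theorem generator_regular:
  assumes u: "u1 \<in> russell_alg" "u2 \<in> russell_alg" "u3 \<in> russell_alg" and gen: "russell_alg \<subseteq> alg {u1, u2, u3}"
  shows "fls_low 0 u1"
proof -
  define ph where "ph = eval_gens u1 u2 u3"
  note h = is_rhomD[OF is_rhom_eval_gens[of u1 u2 u3], folded ph_def]
  have surj: "\<exists>F. f = ph F" if "f \<in> russell_alg" for f
    using that gen alg_3_subset_range_eval_gens[of u1 u2 u3] unfolding ph_def by blast
  obtain FX FZ FT where XZT: "fls_X = ph FX" "fls_const z_poly = ph FZ" "fls_const t_poly = ph FT"
    using surj russell_alg_X russell_alg_const by metis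
  have chain: "E (ph F) = ph (map_poly (map_poly pderiv) F) * E u1 + ph (map_poly pderiv F) * E u2 + ph (pderiv F) * E u3"
    if "derivation E" "\<And>c. E (cst c) = 0" for E F
    unfolding ph_def using that by (rule eval_gens_chain_rule)
  have cst0: "fls_deriv (cst c) = 0" "dz (cst c) = 0" "dt (cst c) = 0" for c
    by (simp_all add: cst_def, simp_all add: fls_eq_iff dz_nth dt_nth map_poly_pCons)
  note chains = chain[OF dx.derivation_axioms cst0(1)] chain[OF dz.derivation_axioms cst0(2)]
    chain[OF dt.derivation_axioms cst0(3)]
  have coords: "fls_deriv (ph FX) = 1" "dz (ph FX) = 0" "dt (ph FX) = 0"
    "fls_deriv (ph FZ) = 0" "dz (ph FZ) = 1" "dt (ph FZ) = 0"
    "fls_deriv (ph FT) = 0" "dz (ph FT) = 0" "dt (ph FT) = 1"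
    unfolding XZT[symmetric]
    by (auto simp: fls_eq_iff dz_nth dt_nth z_poly_def t_poly_def map_poly_pCons pderiv_pCons one_pCons)
  \<comment> \<open>With \<open>x\<close>, \<open>z\<close>, \<open>t\<close> written as polynomials
    in the generators, the chain rule says that the matrix of their partial derivatives is a left
    inverse of the Jacobian matrix of \<open>u1\<close>, \<open>u2\<close>,
    \<open>u3\<close>.\<close>
  note inj3 = left_inverse_3_imp_injective[OF
      coords(1,2,3)[unfolded chains] coords(4,5,6)[unfolded chains] coords(7,8,9)[unfolded chains]]
  have ker: "ph (map_poly (map_poly pderiv) F) = 0 \<and> ph (map_poly pderiv F) = 0 \<and> ph (pderiv F) = 0"
    if "ph F = 0" for F
    using chains[of F] that by (intro inj3) simp_all
  \<comment> \<open>The kernel of \<open>ph\<close> is closed under all three partial derivatives.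
    Descending one variable at a time would place a nonzero complex number in it.\<close>
  have inj: "F = 0" if "ph F = 0" for F
  proof (rule ccontr)
    assume "F \<noteq> 0"
    then obtain F1 where F1: "F1 \<noteq> 0" "ph [:F1:] = 0"
      using pderiv_closed_contains_constant[of "{F. ph F = 0}" F] ker \<open>ph F = 0\<close> by auto
    have "ph [:pderiv G:] = 0" if "ph [:G:] = 0" for G
      using ker[OF that] by (simp add: map_poly_pCons)
    then obtain F2 where F2: "F2 \<noteq> 0" "ph [:[:F2:]:] = 0"
      using pderiv_closed_contains_constant[of "{G. ph [:G:] = 0}" F1] F1 by auto
    have "ph [:[:pderiv G:]:] = 0" if "ph [:[:G:]:] = 0" for G
      using ker[OF that] by (simp add: map_poly_pCons)
    then obtain k where "k \<noteq> 0" "ph [:[:[:k:]:]:] = 0"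
      using pderiv_closed_contains_constant[of "{G. ph [:[:G:]:] = 0}" F2] F2 by auto
    then show False
      by (simp add: ph_def eval_gens_def peval_const is_rhom_peval is_rhom_cst)
  qed
  \<comment> \<open>A derivation is determined here by its values on \<open>x\<close>,
    \<open>z\<close>, \<open>t\<close>, and those of the partial derivative with respect to
    \<open>u3\<close> are the derivatives of \<open>FX\<close>, \<open>FZ\<close>,
    \<open>FT\<close>.\<close>
  define a b c where "a = ph (pderiv FX)" "b = ph (pderiv FZ)" "c = ph (pderiv FT)"
  define D where "D = vector_field a b c"
  have Dcst: "D (cst k) = 0" for k
    by (simp add: D_def vector_field_def cst0)
  have DD: "derivation D" unfolding D_def by (rule derivation_vector_field)
  define M where "M u F = fls_deriv u * ph (F FX) + dz u * ph (F FZ) + dt u * ph (F FT)" for u F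
  \<comment> \<open>The left inverse is also a right inverse: the row \<open>M u - e\<close> is
    annihilated by the Jacobian matrix, so it vanishes by \<open>inj3\<close>.\<close>
  have rinv: "M u (map_poly (map_poly pderiv)) = e1 \<and> M u (map_poly pderiv) = e2 \<and> M u pderiv = e3"
    if "fls_deriv u = e1 * fls_deriv u1 + e2 * fls_deriv u2 + e3 * fls_deriv u3"
      "dz u = e1 * dz u1 + e2 * dz u2 + e3 * dz u3"
      "dt u = e1 * dt u1 + e2 * dt u2 + e3 * dt u3" for u e1 e2 e3
  proof -
    have aux: "(M u (map_poly (map_poly pderiv)) - e1) * E u1 + (M u (map_poly pderiv) - e2) * E u2 + (M u pderiv - e3) * E u3
      = fls_deriv u * E (ph FX) + dz u * E (ph FZ) + dt u * E (ph FT) - (e1 * E u1 + e2 * E u2 + e3 * E u3)"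
      if "derivation E" "\<And>c. E (cst c) = 0" for E
      unfolding chain[OF that] M_def by (simp add: algebra_simps)
    have "M u (map_poly (map_poly pderiv)) - e1 = 0 \<and> M u (map_poly pderiv) - e2 = 0 \<and> M u pderiv - e3 = 0"
    proof (rule inj3)
    qed (simp_all add: aux dx.derivation_axioms dz.derivation_axioms dt.derivation_axioms cst0 coords that[symmetric])
    then show ?thesis by simp
  qed
  have DM: "D u = M u pderiv" for u
    by (simp add: D_def vector_field_def M_def a_b_c_def mult.commute)
  have Du: "D u1 = 0" "D u2 = 0" "D u3 = 1"
    unfolding DM using rinv[of u1 1 0 0] rinv[of u2 0 1 0] rinv[of u3 0 0 1] by simp_all
  have Dph: "D (ph F) = ph (pderiv F)" for F
    using chain[OF DD Dcst, of F] Du by simp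
  have Dphn: "(D ^^ n) (ph F) = ph ((pderiv ^^ n) F)" for n F
    by (induction n) (simp_all add: Dph)
  have BLph: "ph F \<in> russell_alg" for F
    unfolding ph_def by (rule eval_gens_in_subalg[OF subalg_russell_alg u])
  obtain P where P: "u1 = eval_yxzt P" using u by (auto simp: russell_alg_def)
  have "fls_subdegree u1 \<ge> 0"
  proof (cases "u1 = 0")
    case False
    show ?thesis
    proof (rule lnd_kernel_regular[of a b c P, folded D_def])
      show "\<exists>Q. D (eval_yxzt P) = eval_yxzt Q" for P
      proof -
        obtain F where "eval_yxzt P = ph F" using surj[of "eval_yxzt P"] by (auto simp: russell_alg_def)
        then show ?thesis using BLph[of "pderiv F"] by (auto simp: russell_alg_def Dph)
      qed
      show "\<exists>n. (D ^^ n) (eval_yxzt P) = 0" for P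
      proof -
        obtain F where F: "eval_yxzt P = ph F" using surj[of "eval_yxzt P"] by (auto simp: russell_alg_def)
        obtain n where "(pderiv ^^ n) F = 0" using pderiv_nilpotent by blast
        then show ?thesis by (intro exI[of _ n]) (simp add: F Dphn h)
      qed
      show "a \<noteq> 0 \<or> b \<noteq> 0 \<or> c \<noteq> 0"
        using Du(3) by (auto simp: D_def vector_field_def)
      show "D (eval_yxzt P) = 0" using Du P by simp
      show "fls_low (fls_subdegree u1) (eval_yxzt P)" "eval_yxzt P $$ fls_subdegree u1 \<noteq> 0"
        unfolding P[symmetric] using False by (simp_all add: fls_low_subdegree)
    qed
  qed simp
  then show ?thesis by (simp add: fls_low_def)
qed

theorem not_three_generated:
  assumes u: "u1 \<in> russell_alg" "u2 \<in> russell_alg" "u3 \<in> russell_alg"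
  shows "\<not> russell_alg \<subseteq> alg {u1, u2, u3}"
proof
  assume gen: "russell_alg \<subseteq> alg {u1, u2, u3}"
  have low: "fls_low 0 u1" "fls_low 0 u2" "fls_low 0 u3"
    using generator_regular[of u1 u2 u3] generator_regular[of u2 u1 u3] generator_regular[of u3 u1 u2] u gen
    by (simp_all add: insert_commute)
  have "subalg {f. fls_low 0 f}"
    using fls_low_mult[of 0 _ 0] by (auto simp: subalg_def cst_def fls_low_const intro: fls_low_add)
  then have "alg {u1, u2, u3} \<subseteq> {f. fls_low 0 f}" using low by (intro alg_least) auto
  then have "fls_low 0 y_laurent" using gen russell_alg_y by blast
  then show False using y_laurent_nth by (simp add: fls_low_def)
qed

section \<open>Positive gradings\<close>

text \<open>Steinitz exchange modulo \<open>W\<close>: a basis of \<open>W\<close> is extended by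
  elements of \<open>H\<close>, and the added elements number at most \<open>card V\<close> because
  \<open>V\<close> spans \<open>H\<close> modulo \<open>W\<close>. It serves to replace a basis of
  the cotangent space by homogeneous elements.\<close>

lemma (in vector_space) relative_exchange:
  assumes V: "finite V" and VH: "V \<subseteq> span (H \<union> W)" and HV: "H \<subseteq> span (V \<union> W)"
  shows "\<exists>S\<subseteq>H. finite S \<and> card S \<le> card V \<and> V \<subseteq> span (S \<union> W)"
proof -
  obtain BW where BW: "BW \<subseteq> W" "independent BW" "W \<subseteq> span BW"
    by (rule maximal_independent_subset[of W])
  obtain B where B: "BW \<subseteq> B" "B \<subseteq> BW \<union> H" "independent B" "BW \<union> H \<subseteq> span B"
    by (rule maximal_independent_subset_extend[of BW "BW \<union> H"]) (use BW in auto)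
  define S where "S = B - BW"
  have "span (BW \<union> A) = span (W \<union> A)" for A
  proof (rule antisym)
    show "span (BW \<union> A) \<subseteq> span (W \<union> A)" using BW by (intro span_mono) auto
    have "W \<subseteq> span (BW \<union> A)"
      by (rule order_trans[OF BW(3)]) (intro span_mono Un_upper1)
    then have "W \<union> A \<subseteq> span (BW \<union> A)"
      using span_superset[of "BW \<union> A"] by simp
    then show "span (W \<union> A) \<subseteq> span (BW \<union> A)" by (intro span_minimal) auto
  qed
  note span_BW = this
  \<comment> \<open>The dimension bound needs a finite spanning set, so only the finitely many
    elements of \<open>BW\<close> occurring in expressions for members of \<open>F\<close> are
    kept.\<close>
  have fin: "card F \<le> card V" if F: "finite F" "F \<subseteq> S" for F
  proof -
    have finsub: "\<exists>W0. finite W0 \<and> W0 \<subseteq> BW \<and> x \<in> span (V \<union> W0)" if x: "x \<in> span (V \<union> BW)" for x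
    proof -
      obtain t r where t: "finite t" "t \<subseteq> V \<union> BW" "x = (\<Sum>a\<in>t. scale (r a) a)"
        using x by (auto simp: span_explicit)
      have "x \<in> span t" unfolding t(3) by (intro span_sum span_scale span_base)
      moreover have "t \<subseteq> V \<union> (t \<inter> BW)" using t by auto
      ultimately have "x \<in> span (V \<union> (t \<inter> BW))" using span_mono[of t] by (meson subsetD)
      then show ?thesis using t(1) by (intro exI[of _ "t \<inter> BW"]) auto
    qed
    have "\<forall>x\<in>F. \<exists>W0. finite W0 \<and> W0 \<subseteq> BW \<and> x \<in> span (V \<union> W0)"
    proof
      fix x assume "x \<in> F"
      then have "x \<in> H" using F B by (auto simp: S_def)
      then have "x \<in> span (V \<union> BW)" using HV span_BW[of V] by (auto simp: Un_commute)
      then show "\<exists>W0. finite W0 \<and> W0 \<subseteq> BW \<and> x \<in> span (V \<union> W0)" by (rule finsub)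
    qed
    from bchoice[OF this] obtain W0
      where W0: "\<forall>x\<in>F. finite (W0 x) \<and> W0 x \<subseteq> BW \<and> x \<in> span (V \<union> W0 x)" ..
    define W1 where "W1 = (\<Union>x\<in>F. W0 x)"
    have W1: "finite W1" "W1 \<subseteq> BW" using W0 F by (auto simp: W1_def)
    have "F \<subseteq> span (V \<union> W1)"
    proof
      fix x assume "x \<in> F"
      moreover then have "span (V \<union> W0 x) \<subseteq> span (V \<union> W1)" by (intro span_mono) (auto simp: W1_def)
      ultimately show "x \<in> span (V \<union> W1)" using W0 by blast
    qed
    then have "F \<union> W1 \<subseteq> span (V \<union> W1)" using span_superset[of "V \<union> W1"] by auto
    moreover have "independent (F \<union> W1)"
      using B F W1 by (intro independent_mono[OF B(3)]) (auto simp: S_def)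
    ultimately have "card (F \<union> W1) \<le> card (V \<union> W1)"
      using independent_span_bound[of "V \<union> W1"] V W1 by auto
    moreover have "card (F \<union> W1) = card F + card W1"
      using F W1 by (intro card_Un_disjoint) (auto simp: S_def)
    moreover have "card (V \<union> W1) \<le> card V + card W1" by (rule card_Un_le)
    ultimately show ?thesis by simp
  qed
  have "finite S"
  proof (rule ccontr)
    assume "infinite S"
    then obtain F where "F \<subseteq> S" "finite F" "card F = Suc (card V)"
      using infinite_arbitrarily_large by blast
    then show False using fin[of F] by simp
  qed
  moreover have "V \<subseteq> span (S \<union> W)"
  proof -
    have "BW \<union> S = B" using B by (auto simp: S_def)
    then have "span (S \<union> W) = span B" using span_BW[of S] by (simp add: Un_commute)
    moreover have "W \<subseteq> span B"
      by (rule order_trans[OF BW(3)]) (intro span_mono B(1))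
    then have "H \<union> W \<subseteq> span B" using B(4) by simp
    then have "span (H \<union> W) \<subseteq> span B" by (intro span_minimal) auto
    ultimately show ?thesis using VH by auto
  qed
  moreover have "S \<subseteq> H" using B by (auto simp: S_def)
  ultimately show ?thesis using fin[of S] by blast
qed

interpretation cvs: vector_space "\<lambda>c f. cst c * f"
  by unfold_locales (simp_all add: algebra_simps is_rhomD[OF is_rhom_cst])

lemma subalg_zero: "subalg S \<Longrightarrow> 0 \<in> S"
  by (auto simp: subalg_def)

lemma subalg_subspace: "subalg S \<Longrightarrow> cvs.subspace S"
  by (rule cvs.subspaceI) (auto simp: subalg_def subalg_zero)

lemma subalg_lincomb: "subalg S \<Longrightarrow> x \<in> S \<Longrightarrow> y \<in> S \<Longrightarrow> cst c * x + y \<in> S"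
  unfolding subalg_def by (metis UNIV_I image_subset_iff)

lemma coordinate_relation: "fls_X + fls_X\<^sup>2 * y_laurent + (fls_const z_poly)\<^sup>2 + (fls_const t_poly) ^ 3 = 0"
proof -
  have "fls_const cusp = (fls_const z_poly)\<^sup>2 + (fls_const t_poly) ^ 3"
    by (simp add: cusp_def is_rhomD[OF is_rhom_fls_const])
  then show ?thesis by (simp add: X2_y_laurent)
qed

section \<open>Graded components, the irrelevant ideal and its cotangent space\<close>

locale positive_grading =
  fixes G :: "int \<Rightarrow> laurent set"
  assumes G_0_mem: "0 \<in> G i"
    and G_add: "a \<in> G i \<Longrightarrow> b \<in> G i \<Longrightarrow> a + b \<in> G i"
    and G_russell_alg: "G i \<subseteq> russell_alg"
    and G_mult: "a \<in> G i \<Longrightarrow> b \<in> G j \<Longrightarrow> a * b \<in> G (i + j)"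
    and G_decomp: "b \<in> russell_alg \<Longrightarrow> \<exists>!f. (\<forall>i. f i \<in> G i) \<and> finite {i. f i \<noteq> 0} \<and> b = (\<Sum>i | f i \<noteq> 0. f i)"
    and G_neg: "i < 0 \<Longrightarrow> G i = {0}"
    and G_zero: "G 0 = range cst"
begin

definition comp :: "laurent \<Rightarrow> int \<Rightarrow> laurent" where
  "comp b = (THE f. (\<forall>i. f i \<in> G i) \<and> finite {i. f i \<noteq> 0} \<and> b = (\<Sum>i | f i \<noteq> 0. f i))"

lemma
  assumes "b \<in> russell_alg"
  shows comp_in: "comp b i \<in> G i" and finite_comp: "finite {i. comp b i \<noteq> 0}"
    and sum_comp: "b = (\<Sum>i | comp b i \<noteq> 0. comp b i)"
  using theI'[OF G_decomp[OF assms]] unfolding comp_def[symmetric] by auto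

lemma compI:
  assumes "\<And>i. f i \<in> G i" "finite I" "\<And>i. i \<notin> I \<Longrightarrow> f i = 0"
  shows "comp (\<Sum>i\<in>I. f i) = f"
proof -
  have sub: "{i. f i \<noteq> 0} \<subseteq> I" using assms(3) by auto
  have "(\<Sum>i\<in>I. f i) \<in> russell_alg"
    using assms(1) G_russell_alg cvs.subspace_sum[OF subalg_subspace[OF subalg_russell_alg], of I f] by blast
  moreover have "(\<Sum>i\<in>I. f i) = (\<Sum>i | f i \<noteq> 0. f i)"
    using assms(2) sub by (intro sum.mono_neutral_right) auto
  moreover have "finite {i. f i \<noteq> 0}" using sub assms(2) by (rule finite_subset)
  ultimately show ?thesis
    unfolding comp_def using assms(1) by (intro the1_equality G_decomp) auto
qed

lemma cst_G: "a \<in> G i \<Longrightarrow> cst c * a \<in> G i"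
  using G_mult[of "cst c" 0 a i] G_zero by auto

lemma comp_add:
  assumes "a \<in> russell_alg" "b \<in> russell_alg"
  shows "comp (a + b) i = comp a i + comp b i"
proof -
  define I where "I = {i. comp a i \<noteq> 0} \<union> {i. comp b i \<noteq> 0}"
  have fin: "finite I" using finite_comp assms by (simp add: I_def)
  have "a = (\<Sum>i\<in>I. comp a i)" "b = (\<Sum>i\<in>I. comp b i)"
    using fin sum_comp[OF assms(1)] sum_comp[OF assms(2)]
    by (metis (mono_tags, lifting) I_def Un_upper1 mem_Collect_eq DiffD2 sum.mono_neutral_left,
        metis (mono_tags, lifting) I_def Un_upper2 mem_Collect_eq DiffD2 sum.mono_neutral_left)
  then have "a + b = (\<Sum>i\<in>I. comp a i + comp b i)" by (metis sum.distrib)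
  then have "comp (a + b) = (\<lambda>i. comp a i + comp b i)"
    using fin assms comp_in by (simp only:) (intro compI G_add, auto simp: I_def)
  then show ?thesis by simp
qed

lemma comp_scale:
  assumes "a \<in> russell_alg"
  shows "comp (cst c * a) i = cst c * comp a i"
proof -
  have "cst c * a = (\<Sum>i | comp a i \<noteq> 0. cst c * comp a i)"
    using sum_comp[OF assms] by (metis (no_types) sum_distrib_left)
  then have "comp (cst c * a) = (\<lambda>i. cst c * comp a i)"
    using finite_comp[OF assms] comp_in[OF assms] by (simp only:) (intro compI cst_G, auto)
  then show ?thesis by simp
qed

lemma comp_homogeneous:
  assumes "a \<in> G n"
  shows "comp a i = (if i = n then a else 0)"
proof -
  have "comp (\<Sum>i\<in>{n}. if i = n then a else 0) = (\<lambda>i. if i = n then a else 0)"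
    using assms G_0_mem by (intro compI) auto
  then show ?thesis by simp
qed

text \<open>\<open>pos\<close> contains only homogeneous elements; its span is the irrelevant
  maximal ideal. The ideal and its square are introduced as complex spans so that span induction and
  the exchange lemma apply to them directly.\<close>

definition pos :: "laurent set" where "pos = (\<Union>i\<in>{0<..}. G i)"
definition max_ideal :: "laurent set" where "max_ideal = cvs.span pos"
definition max_ideal_sq :: "laurent set" where "max_ideal_sq = cvs.span {a * b | a b. a \<in> pos \<and> b \<in> pos}"

lemma pos_russell_alg: "pos \<subseteq> russell_alg" using G_russell_alg by (auto simp: pos_def)

lemma pos_mult: "a \<in> pos \<Longrightarrow> b \<in> pos \<Longrightarrow> a * b \<in> pos"
proof -
  assume "a \<in> pos" "b \<in> pos"
  then obtain i j where "i > 0" "j > 0" "a \<in> G i" "b \<in> G j" by (auto simp: pos_def)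
  then have "a * b \<in> G (i + j)" "i + j > 0" using G_mult by auto
  then show ?thesis unfolding pos_def by blast
qed

lemma max_ideal_russell_alg: "max_ideal \<subseteq> russell_alg"
  unfolding max_ideal_def by (intro cvs.span_minimal subalg_subspace subalg_russell_alg pos_russell_alg)

lemma max_ideal_sq_max_ideal: "max_ideal_sq \<subseteq> max_ideal"
  unfolding max_ideal_sq_def max_ideal_def using pos_mult by (intro cvs.span_mono) auto

lemma max_ideal_add: "a \<in> max_ideal \<Longrightarrow> b \<in> max_ideal \<Longrightarrow> a + b \<in> max_ideal"
  and max_ideal_scale: "a \<in> max_ideal \<Longrightarrow> cst c * a \<in> max_ideal"
  and max_ideal_sq_add: "a \<in> max_ideal_sq \<Longrightarrow> b \<in> max_ideal_sq \<Longrightarrow> a + b \<in> max_ideal_sq"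
  and max_ideal_sq_scale: "a \<in> max_ideal_sq \<Longrightarrow> cst c * a \<in> max_ideal_sq"
  and max_ideal_sq_0: "0 \<in> max_ideal_sq"
  unfolding max_ideal_def max_ideal_sq_def by (auto intro: cvs.span_add cvs.span_scale cvs.span_zero)

lemma max_ideal_mult: "a \<in> max_ideal \<Longrightarrow> b \<in> max_ideal \<Longrightarrow> a * b \<in> max_ideal_sq"
proof -
  have 1: "a * b \<in> max_ideal_sq" if "a \<in> pos" "b \<in> max_ideal" for a b
    using that(2) unfolding max_ideal_def
  proof (induction rule: cvs.span_induct_alt)
    case (step c x y)
    have "a * x \<in> max_ideal_sq" unfolding max_ideal_sq_def using that(1) step(1) by (intro cvs.span_base) auto
    then have "cst c * (a * x) + a * y \<in> max_ideal_sq" by (intro max_ideal_sq_add max_ideal_sq_scale step)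
    then show ?case by (simp add: algebra_simps)
  qed (simp add: max_ideal_sq_0)
  assume a: "a \<in> max_ideal" and b: "b \<in> max_ideal"
  show ?thesis using a unfolding max_ideal_def
  proof (induction rule: cvs.span_induct_alt)
    case (step c x y)
    have "cst c * (x * b) + y * b \<in> max_ideal_sq" using 1[OF step(1) b] by (intro max_ideal_sq_add max_ideal_sq_scale step)
    then show ?case by (simp add: algebra_simps)
  qed (simp add: max_ideal_sq_0)
qed

text \<open>Positivity enters here: negative components vanish and the component of degree 0 is a
  constant.\<close>

lemma russell_alg_split:
  assumes "b \<in> russell_alg"
  obtains c where "b - cst c \<in> max_ideal"
proof -
  obtain c where c: "comp b 0 = cst c" using comp_in[OF assms, of 0] G_zero by auto
  have "(\<Sum>i\<in>I - {0}. comp b i) \<in> max_ideal" for I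
    unfolding max_ideal_def
  proof (intro cvs.span_sum)
    fix i assume "i \<in> I - {0}"
    then show "comp b i \<in> cvs.span pos"
    proof (cases "i < 0")
      case True
      then show ?thesis using comp_in[OF assms, of i] G_neg[of i] by (simp add: cvs.span_zero)
    next
      case False
      then have "i > 0" using \<open>i \<in> I - {0}\<close> by auto
      then have "comp b i \<in> pos" using comp_in[OF assms, of i] unfolding pos_def by blast
      then show ?thesis by (rule cvs.span_base)
    qed
  qed
  moreover have "b = comp b 0 + (\<Sum>i\<in>{i. comp b i \<noteq> 0} - {0}. comp b i)"
    using sum_comp[OF assms] finite_comp[OF assms]
    by (cases "comp b 0 = 0") (simp_all add: sum.remove[of "{i. comp b i \<noteq> 0}" 0])
  ultimately have "b - cst c \<in> max_ideal" using c by (metis add_diff_cancel_left')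
  then show ?thesis by (rule that)
qed

lemma comp_0 [simp]: "comp 0 i = 0"
  using comp_homogeneous[OF G_0_mem[of i], of i] by simp

lemma comp_max_ideal_0: "b \<in> max_ideal \<Longrightarrow> comp b 0 = 0"
proof -
  assume "b \<in> max_ideal"
  then have "b \<in> russell_alg \<and> comp b 0 = 0"
    unfolding max_ideal_def
  proof (induction rule: cvs.span_induct_alt)
    case base
    then show ?case using subalg_zero[OF subalg_russell_alg] by simp
  next
    case (step c x y)
    obtain i where i: "i > 0" "x \<in> G i" using step by (auto simp: pos_def)
    have russell_alg: "cst c * x \<in> russell_alg" "x \<in> russell_alg" "y \<in> russell_alg"
      using step pos_russell_alg subalg_russell_alg by (auto simp: subalg_def)
    then have "comp (cst c * x + y) 0 = cst c * comp x 0 + comp y 0"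
      by (simp add: comp_add comp_scale)
    then show ?case using step comp_homogeneous[OF i(2), of 0] i(1) russell_alg subalg_russell_alg by (simp add: subalg_def)
  qed
  then show ?thesis ..
qed

lemma cst_max_ideal: "cst c \<in> max_ideal \<Longrightarrow> c = 0"
  using comp_max_ideal_0[of "cst c"] comp_homogeneous[of "cst c" 0 0] G_zero by simp

text \<open>
  The gradient of the defining equation vanishes nowhere on the threefold, so the cotangent space
  \<open>max_ideal/max_ideal_sq\<close> at the homogeneous maximal ideal is spanned by three elements.
\<close>

lemma cotangent_space_3:
  "\<exists>V. finite V \<and> card V \<le> 3 \<and> V \<subseteq> max_ideal \<and> max_ideal \<subseteq> cvs.span (V \<union> max_ideal_sq)"
proof -
  define FX FY FZ FT where "FX = (fls_X :: laurent)" "FY = y_laurent" "FZ = fls_const z_poly" "FT = fls_const t_poly"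
  note defs = FX_FY_FZ_FT_def
  have in_russell_alg: "FX \<in> russell_alg" "FY \<in> russell_alg" "FZ \<in> russell_alg" "FT \<in> russell_alg"
    by (simp_all add: defs russell_alg_X russell_alg_y russell_alg_const)
  obtain x0 y0 z1 t1 where "FX - cst x0 \<in> max_ideal" "FY - cst y0 \<in> max_ideal" "FZ - cst z1 \<in> max_ideal" "FT - cst t1 \<in> max_ideal"
    using russell_alg_split in_russell_alg by metis
  define x y z t where "x = FX - cst x0" "y = FY - cst y0" "z = FZ - cst z1" "t = FT - cst t1"
  have max_ideal: "x \<in> max_ideal" "y \<in> max_ideal" "z \<in> max_ideal" "t \<in> max_ideal" by (simp_all add: x_y_z_t_def) fact+
  have eqs: "FX = cst x0 + x" "FY = cst y0 + y" "FZ = cst z1 + z" "FT = cst t1 + t"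
    by (simp_all add: x_y_z_t_def)
  \<comment> \<open>Taylor expansion of the defining polynomial at the point
    \<open>(x0, y0, z1, t1)\<close>: \<open>k\<close> is the value, \<open>lam\<close> the
    differential and \<open>rest\<close> the terms of order at least two.\<close>
  define k where "k = x0 + x0\<^sup>2 * y0 + z1\<^sup>2 + t1 ^ 3"
  define lam where "lam = cst (1 + 2 * x0 * y0) * x + cst (x0\<^sup>2) * y + cst (2 * z1) * z + cst (3 * t1\<^sup>2) * t"
  define rest where "rest = cst y0 * (x * x) + cst (2 * x0) * (x * y) + y * (x * x) + z * z + cst (3 * t1) * (t * t) + t * (t * t)"
  have num: "cst 1 = 1" "cst 2 = 2" "cst 3 = 3"
  proof -
    show 1: "cst 1 = 1" by (rule is_rhomD[OF is_rhom_cst])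
    show 2: "cst 2 = 2" using is_rhomD(3)[OF is_rhom_cst, of 1 1] 1 by simp
    show "cst 3 = 3" using is_rhomD(3)[OF is_rhom_cst, of 2 1] 1 2 by simp
  qed
  have "(a0 + a0\<^sup>2 * b0 + c0\<^sup>2 + d0 ^ 3) + ((1 + 2 * a0 * b0) * x + a0\<^sup>2 * y + 2 * c0 * z + 3 * d0\<^sup>2 * t) +
      (b0 * (x * x) + 2 * a0 * (x * y) + y * (x * x) + z * z + 3 * d0 * (t * t) + t * (t * t)) =
      (a0 + x) + (a0 + x)\<^sup>2 * (b0 + y) + (c0 + z)\<^sup>2 + (d0 + t) ^ 3" for a0 b0 c0 d0 :: laurent
    by (simp add: power2_eq_square power3_eq_cube algebra_simps)
  from this[of "cst x0" "cst y0" "cst z1" "cst t1"]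
  have "cst k + lam + rest = FX + FX\<^sup>2 * FY + FZ\<^sup>2 + FT ^ 3"
    unfolding eqs k_def lam_def rest_def by (simp only: is_rhomD[OF is_rhom_cst] num)
  also have "\<dots> = 0" unfolding defs by (rule coordinate_relation)
  finally have sum0: "cst k + lam + rest = 0" .
  have restW: "rest \<in> max_ideal_sq"
    unfolding rest_def using max_ideal max_ideal_sq_max_ideal by (intro max_ideal_sq_add max_ideal_sq_scale max_ideal_mult) (auto intro: max_ideal_mult)
  have lam_max_ideal: "lam \<in> max_ideal" unfolding lam_def using max_ideal by (intro max_ideal_add max_ideal_scale)
  have "cst k = cst (- 1) * (lam + rest)" using sum0
    by (simp add: is_rhomD[OF is_rhom_cst] num) (metis add.assoc add_eq_0_iff2 minus_add_distrib diff_conv_add_uminus)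
  moreover have "lam + rest \<in> max_ideal" using lam_max_ideal restW max_ideal_sq_max_ideal by (intro max_ideal_add) auto
  ultimately have "cst k \<in> max_ideal" using max_ideal_scale by metis
  then have "k = 0" by (rule cst_max_ideal)
  then have "lam = cst (- 1) * rest" using sum0 by (simp add: is_rhomD[OF is_rhom_cst] num eq_neg_iff_add_eq_0)
  then have lamW: "lam \<in> max_ideal_sq" using restW max_ideal_sq_scale by metis
  \<comment> \<open>Constants, linear part and \<open>max_ideal_sq\<close> together form a
    subalgebra that contains the generators, hence the whole ring.\<close>
  define A where "A = {b. \<exists>c l w. b = cst c + l + w \<and> l \<in> cvs.span {x, y, z, t} \<and> w \<in> max_ideal_sq}"
  have span_max_ideal: "cvs.span {x, y, z, t} \<subseteq> max_ideal"
    using max_ideal unfolding max_ideal_def by (intro cvs.span_minimal) auto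
  have "subalg A"
    unfolding subalg_def
  proof (intro conjI ballI)
    show "range cst \<subseteq> A"
    proof
      fix b assume "b \<in> range cst"
      then obtain c where "b = cst c" by auto
      then show "b \<in> A" unfolding A_def
        by (intro CollectI exI[of _ c] exI[of _ 0]) (simp add: max_ideal_sq_0 cvs.span_zero)
    qed
    fix a b assume "a \<in> A" "b \<in> A"
    then obtain c l w c' l' w' where
      a: "a = cst c + l + w" "l \<in> cvs.span {x, y, z, t}" "w \<in> max_ideal_sq" and
      b: "b = cst c' + l' + w'" "l' \<in> cvs.span {x, y, z, t}" "w' \<in> max_ideal_sq"
      unfolding A_def by blast
    have "a + b = cst (c + c') + (l + l') + (w + w')" by (simp add: a b is_rhomD[OF is_rhom_cst])
    moreover have "l + l' \<in> cvs.span {x, y, z, t}" "w + w' \<in> max_ideal_sq" using a b by (auto intro: cvs.span_add max_ideal_sq_add)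
    ultimately show "a + b \<in> A" unfolding A_def by blast
    have "a * b = cst (c * c') + (cst c * l' + cst c' * l) + (cst c * w' + cst c' * w + (l + w) * (l' + w'))"
      by (simp add: a b is_rhomD[OF is_rhom_cst] algebra_simps)
    moreover have "cst c * l' + cst c' * l \<in> cvs.span {x, y, z, t}"
      using a b by (intro cvs.span_add cvs.span_scale)
    moreover have "cst c * w' + cst c' * w + (l + w) * (l' + w') \<in> max_ideal_sq"
      using a b span_max_ideal max_ideal_sq_max_ideal by (intro max_ideal_sq_add max_ideal_sq_scale max_ideal_mult max_ideal_add) auto
    ultimately show "a * b \<in> A" unfolding A_def by blast
  qed
  moreover have "cst c + v \<in> A" if "v \<in> {x, y, z, t}" for c v
  proof -
    have "cst c + v = cst c + v + 0" "v \<in> cvs.span {x, y, z, t}" using that by (auto intro: cvs.span_base)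
    then show ?thesis unfolding A_def using max_ideal_sq_0 by blast
  qed
  then have "{fls_X, fls_const z_poly, fls_const t_poly, y_laurent} \<subseteq> A"
    unfolding defs[symmetric] eqs by auto
  ultimately have "russell_alg \<subseteq> A" unfolding russell_alg_eq by (rule alg_least)
  have max_ideal_span: "max_ideal \<subseteq> cvs.span ({x, y, z, t} \<union> max_ideal_sq)"
  proof
    fix b assume b: "b \<in> max_ideal"
    then have "b \<in> A" using max_ideal_russell_alg \<open>russell_alg \<subseteq> A\<close> by blast
    then obtain c l w where clw: "b = cst c + l + w" "l \<in> cvs.span {x, y, z, t}" "w \<in> max_ideal_sq"
      unfolding A_def by blast
    have "cst c = b + cst (- 1) * (l + w)" by (simp add: clw is_rhomD[OF is_rhom_cst] num)
    moreover have "b + cst (- 1) * (l + w) \<in> max_ideal"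
      using b clw span_max_ideal max_ideal_sq_max_ideal by (intro max_ideal_add max_ideal_scale) auto
    ultimately have "cst c \<in> max_ideal" by simp
    then have "c = 0" by (rule cst_max_ideal)
    then have "b = l + w" by (simp add: clw)
    moreover have "l \<in> cvs.span ({x, y, z, t} \<union> max_ideal_sq)" using clw cvs.span_mono by blast
    moreover have "w \<in> cvs.span ({x, y, z, t} \<union> max_ideal_sq)" using clw by (intro cvs.span_base) auto
    ultimately show "b \<in> cvs.span ({x, y, z, t} \<union> max_ideal_sq)" by (simp add: cvs.span_add)
  qed
  have card3: "finite {a, b, c :: laurent}" "card {a, b, c :: laurent} \<le> 3" for a b c
    by (simp_all add: card_insert_if)
  \<comment> \<open>The partial derivatives \<open>1 + 2 x0 y0\<close> and \<open>x0^2\<close> never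
    vanish together. For \<open>x0 = 0\<close> the relation \<open>lam\<close> is solved for
    \<open>x\<close>, otherwise for \<open>y\<close>.\<close>
  have "\<exists>V. finite V \<and> card V \<le> 3 \<and> V \<subseteq> {x, y, z, t} \<and> {x, y, z, t} \<subseteq> cvs.span (V \<union> max_ideal_sq)"
  proof (cases "x0 = 0")
    case True
    let ?S = "cvs.span ({y, z, t} \<union> max_ideal_sq)"
    have b: "y \<in> ?S" "z \<in> ?S" "t \<in> ?S" "lam \<in> ?S" using lamW by (auto intro: cvs.span_base)
    have "x = lam + cst (- (2 * z1)) * z + cst (- (3 * t1\<^sup>2)) * t"
      unfolding lam_def is_rhomD(5)[OF is_rhom_cst] True by (simp add: num is_rhomD(1)[OF is_rhom_cst])
    also have "\<dots> \<in> ?S" using b by (intro cvs.span_add cvs.span_scale)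
    finally show ?thesis using b card3[of y z t] by (intro exI[of _ "{y, z, t}"]) auto
  next
    case False
    let ?S = "cvs.span ({x, z, t} \<union> max_ideal_sq)"
    have b: "x \<in> ?S" "z \<in> ?S" "t \<in> ?S" "lam \<in> ?S" using lamW by (auto intro: cvs.span_base)
    have "y = cst (inverse (x0\<^sup>2) * x0\<^sup>2) * y" using False by (simp add: num)
    also have "\<dots> = cst (inverse (x0\<^sup>2)) * (cst (x0\<^sup>2) * y)" by (simp add: is_rhomD[OF is_rhom_cst] mult.assoc)
    also have "cst (x0\<^sup>2) * y = lam + cst (- (1 + 2 * x0 * y0)) * x + cst (- (2 * z1)) * z + cst (- (3 * t1\<^sup>2)) * t"
      unfolding lam_def is_rhomD(5)[OF is_rhom_cst] by simp
    also have "cst (inverse (x0\<^sup>2)) * \<dots> \<in> ?S" using b by (intro cvs.span_add cvs.span_scale)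
    finally show ?thesis using b card3[of x z t] by (intro exI[of _ "{x, z, t}"]) auto
  qed
  then obtain V where V: "finite V" "card V \<le> 3" "V \<subseteq> {x, y, z, t}" "{x, y, z, t} \<subseteq> cvs.span (V \<union> max_ideal_sq)" by blast
  have "{x, y, z, t} \<union> max_ideal_sq \<subseteq> cvs.span (V \<union> max_ideal_sq)"
    using V cvs.span_superset[of "V \<union> max_ideal_sq"] by auto
  then have "cvs.span ({x, y, z, t} \<union> max_ideal_sq) \<subseteq> cvs.span (V \<union> max_ideal_sq)" by (intro cvs.span_minimal) auto
  with max_ideal_span have "max_ideal \<subseteq> cvs.span (V \<union> max_ideal_sq)" by (rule order_trans)
  moreover have "V \<subseteq> max_ideal" using V(3) max_ideal by auto
  ultimately show ?thesis using V(1,2) by blast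
qed

text \<open>Induction on the degree. Elements of \<open>S\<close> are homogeneous, so taking
  components of degree \<open>n\<close> keeps or kills them; in a product of positive-degree
  elements landing in degree \<open>n\<close>, both factors have smaller degree and are already
  generated by \<open>S\<close>.\<close>

lemma graded_Nakayama:
  assumes S: "S \<subseteq> pos" and span: "max_ideal \<subseteq> cvs.span (S \<union> max_ideal_sq)"
  shows "russell_alg \<subseteq> alg S"
proof -
  have sub: "cvs.subspace (alg S)" by (intro subalg_subspace subalg_alg)
  have G: "G (int n) \<subseteq> alg S" for n
  proof (induction n rule: less_induct)
    case (less n)
    show ?case
    proof
      fix g assume g: "g \<in> G (int n)"
      show "g \<in> alg S"
      proof (cases "n = 0")
        case True
        then show ?thesis using g G_zero by (auto intro: alg_cst)
      next
        case False
        have comp_lin: "comp (cst c * x + y) n = cst c * comp x n + comp y n" if "x \<in> russell_alg" "y \<in> russell_alg" for c x y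
          using that subalg_russell_alg by (subst comp_add) (auto simp: comp_scale subalg_def)
        have SW_russell_alg: "S \<union> max_ideal_sq \<subseteq> russell_alg" using S pos_russell_alg max_ideal_sq_max_ideal max_ideal_russell_alg by auto
        have compW: "comp w n \<in> alg S" if "w \<in> max_ideal_sq" for w
        proof -
          have "w \<in> russell_alg \<and> comp w n \<in> alg S" using that unfolding max_ideal_sq_def
          proof (induction rule: cvs.span_induct_alt)
            case base
            then show ?case using cvs.subspace_0[OF sub] subalg_zero[OF subalg_russell_alg] by auto
          next
            case (step c x y)
            then obtain a b i j where ab: "x = a * b" "i > 0" "j > 0" "a \<in> G i" "b \<in> G j"
              by (auto simp: pos_def)
            have xG: "x \<in> G (i + j)" using ab G_mult by simp
            have "comp x n \<in> alg S"
            proof (cases "i + j = int n")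
              case True
              then have "nat i < n" "nat j < n" "int (nat i) = i" "int (nat j) = j" using ab by auto
              then have "a \<in> alg S" "b \<in> alg S" using less ab by (metis subsetD)+
              then show ?thesis using comp_homogeneous[OF xG, of n] True ab by (auto intro: alg_mult)
            next
              case False
              then show ?thesis using comp_homogeneous[OF xG, of n] cvs.subspace_0[OF sub] by auto
            qed
            moreover have "x \<in> russell_alg" using xG G_russell_alg by auto
            ultimately show ?case
              using step comp_lin[of x y c] by (simp add: subalg_lincomb subalg_russell_alg subalg_alg)
          qed
          then show ?thesis ..
        qed
        have "comp s n \<in> alg S" if s: "s \<in> S" for s
        proof -
          obtain i where "s \<in> G i" using s S by (auto simp: pos_def)
          then show ?thesis using comp_homogeneous[of s i n] s cvs.subspace_0[OF sub] by (auto intro: alg_gen)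
        qed
        then have compSW: "comp s n \<in> alg S" if "s \<in> S \<union> max_ideal_sq" for s using that compW by auto
        have "g \<in> pos" using g False by (auto simp: pos_def intro!: bexI[of _ "int n"])
        then have "g \<in> cvs.span (S \<union> max_ideal_sq)" using span cvs.span_base[of g pos] unfolding max_ideal_def by blast
        then have "g \<in> russell_alg \<and> comp g n \<in> alg S"
        proof (induction rule: cvs.span_induct_alt)
          case base
          then show ?case using cvs.subspace_0[OF sub] subalg_zero[OF subalg_russell_alg] by auto
        next
          case (step c x y)
          then have "x \<in> russell_alg" "comp x n \<in> alg S" using SW_russell_alg compSW by auto
          then show ?case
            using step comp_lin[of x y c] by (simp add: subalg_lincomb subalg_russell_alg subalg_alg)
        qed
        then show ?thesis using comp_homogeneous[OF g, of n] by simp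
      qed
    qed
  qed
  have G': "G i \<subseteq> alg S" for i
    using G[of "nat i"] G_neg[of i] cvs.subspace_0[OF sub] by (cases "i < 0") auto
  show ?thesis
  proof
    fix b assume b: "b \<in> russell_alg"
    have "(\<Sum>i | comp b i \<noteq> 0. comp b i) \<in> alg S"
      using comp_in[OF b] G' by (intro cvs.subspace_sum[OF sub]) blast
    then show "b \<in> alg S" using sum_comp[OF b] by simp
  qed
qed

theorem contradiction: False
proof -
  obtain V where V: "finite V" "card V \<le> 3" "V \<subseteq> max_ideal" "max_ideal \<subseteq> cvs.span (V \<union> max_ideal_sq)"
    using cotangent_space_3 by blast
  have "V \<subseteq> cvs.span (pos \<union> max_ideal_sq)" using V(3) cvs.span_mono[of pos "pos \<union> max_ideal_sq"] by (auto simp: max_ideal_def)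
  moreover have "pos \<subseteq> cvs.span (V \<union> max_ideal_sq)" using V(4) cvs.span_superset[of pos] by (auto simp: max_ideal_def)
  \<comment> \<open>The exchange makes the spanning set homogeneous without enlarging it, as
    required for \<open>graded_Nakayama\<close>.\<close>
  ultimately obtain S where S: "S \<subseteq> pos" "finite S" "card S \<le> card V" "V \<subseteq> cvs.span (S \<union> max_ideal_sq)"
    using cvs.relative_exchange[OF V(1), of pos max_ideal_sq] by blast
  have "V \<union> max_ideal_sq \<subseteq> cvs.span (S \<union> max_ideal_sq)" using S cvs.span_superset[of "S \<union> max_ideal_sq"] by auto
  then have "cvs.span (V \<union> max_ideal_sq) \<subseteq> cvs.span (S \<union> max_ideal_sq)" by (intro cvs.span_minimal) auto
  then have gen: "russell_alg \<subseteq> alg S" using S V by (intro graded_Nakayama) auto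
  \<comment> \<open>Padding by repetition, or by 0 if \<open>S\<close> is empty.\<close>
  obtain u1 u2 u3 where u: "S \<subseteq> {u1, u2, u3}" "{u1, u2, u3} \<subseteq> insert 0 S"
  proof -
    have "card S \<le> 3" using S V by simp
    then consider "card S = 0" | "card S = 1" | "card S = 2" | "card S = 3" by linarith
    then show ?thesis
    proof cases
      case 1
      then show ?thesis using S that[of 0 0 0] by auto
    next
      case 2
      then obtain a where "S = {a}" by (auto simp: card_1_singleton_iff)
      then show ?thesis using that[of a a a] by auto
    next
      case 3
      then obtain a b where "S = {a, b}" by (auto simp: card_2_iff)
      then show ?thesis using that[of a b b] by auto
    next
      case 4
      then obtain a b c where "S = {a, b, c}" by (auto simp: card_3_iff)
      then show ?thesis using that[of a b c] by auto
    qed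
  qed
  have "alg S \<subseteq> alg {u1, u2, u3}" using u by (intro alg_least subalg_alg) (auto intro: alg_gen)
  moreover have "u1 \<in> russell_alg" "u2 \<in> russell_alg" "u3 \<in> russell_alg"
    using u S pos_russell_alg subalg_zero[OF subalg_russell_alg] by auto
  ultimately show False using not_three_generated gen by blast
qed

end

section \<open>Unique factorization\<close>

definition cusp_param :: "zt_poly \<Rightarrow> complex poly" where
  "cusp_param = peval (\<lambda>p. pcompose p [:0, 0, - 1:]) [:0, 0, 0, 1:]"

lemma is_rhom_pcompose: "is_rhom (\<lambda>p. pcompose p q)"
  by (simp add: is_rhom_def pcompose_add pcompose_mult pcompose_1)

lemma is_rhom_cusp_param: "is_rhom cusp_param"
  unfolding cusp_param_def by (intro is_rhom_peval is_rhom_pcompose)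

lemma cusp_eq: "cusp = [:[:0, 0, 0, 1:], 0, 1:]"
  by (simp add: cusp_def z_poly_def t_poly_def power2_eq_square power3_eq_cube)

lemma cusp_param_cusp: "cusp_param cusp = 0"
  by (simp add: cusp_eq cusp_param_def peval_pCons is_rhom_pcompose pcompose_pCons pcompose_1)

lemma mod_cusp: "\<exists>q a b. g = cusp * q + [:a, b:]"
proof (induction g)
  case 0
  show ?case by (intro exI[of _ 0]) simp
next
  case (pCons c g)
  then obtain q a b where g: "g = cusp * q + [:a, b:]" by blast
  have "pCons c g = [:c:] + z_poly * g" by (simp add: z_poly_def)
  also have "\<dots> = cusp * (z_poly * q + [:b:]) + [:c - b * [:0, 0, 0, 1:], a:]"
    unfolding g by (simp add: cusp_eq z_poly_def algebra_simps)
  finally show ?case by blast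
qed

text \<open>\<open>cusp_param\<close> is the parametrization \<open>z = s^3\<close>,
  \<open>t = - s^2\<close> of the cuspidal curve. Division by \<open>cusp\<close>, monic of degree 2
  in \<open>z\<close>, leaves \<open>a + b z\<close>, which is sent to
  \<open>a(-s^2) + s^3 b(-s^2)\<close>; the two summands have degrees of opposite parity and cannot
  cancel.\<close>

lemma cusp_param_kernel:
  assumes "cusp_param g = 0"
  shows "cusp dvd g"
proof -
  obtain q a b where g: "g = cusp * q + [:a, b:]" using mod_cusp by blast
  define a' b' where "a' = pcompose a [:0, 0, - 1:]" "b' = pcompose b [:0, 0, - 1:]"
  have deg: "degree a' = 2 * degree a" "degree b' = 2 * degree b"
    by (simp_all add: a'_b'_def degree_pcompose)
  have "0 = cusp_param [:a, b:]"
    using assms unfolding g by (simp add: is_rhomD[OF is_rhom_cusp_param] cusp_param_cusp)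
  then have 0: "a' + monom 1 3 * b' = 0"
    by (simp add: cusp_param_def peval_pCons is_rhom_pcompose a'_b'_def monom_Suc numeral_3_eq_3 monom_0)
  have "b' = 0"
  proof (rule ccontr)
    assume b': "b' \<noteq> 0"
    have "degree a' = degree (monom 1 3 * b')"
      using 0 by (metis add.inverse_unique degree_minus neg_equal_iff_equal minus_unique)
    also have "\<dots> = 3 + degree b'"
      using b' by (subst degree_mult_eq) (auto simp: degree_monom_eq)
    finally show False using deg by presburger
  qed
  then have "a' = 0" using 0 by simp
  then have "a = 0" "b = 0" using \<open>b' = 0\<close> by (simp_all add: a'_b'_def pcompose_eq_0_iff)
  then show ?thesis using g by simp
qed

lemma prime_elem_cusp: "prime_elem cusp"
proof (rule prime_elemI)
  show "\<not> cusp dvd 1"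
  proof
    assume "cusp dvd 1"
    then obtain c where "1 = cusp * c" by (elim dvdE)
    then have "cusp_param 1 = cusp_param cusp * cusp_param c"
      using is_rhomD(4)[OF is_rhom_cusp_param, of cusp c] by simp
    then show False by (simp add: cusp_param_cusp is_rhomD[OF is_rhom_cusp_param])
  qed
  fix a b assume "cusp dvd a * b"
  then obtain c where "a * b = cusp * c" by (elim dvdE)
  then have "cusp_param (a * b) = cusp_param (cusp * c)" by simp
  then have "cusp_param a * cusp_param b = 0" by (simp add: is_rhomD[OF is_rhom_cusp_param] cusp_param_cusp)
  then show "cusp dvd a \<or> cusp dvd b" using cusp_param_kernel by auto
qed simp

section \<open>Primality of \<open>x\<close> in the coordinate ring\<close>

lemma russell_alg_add: "a \<in> russell_alg \<Longrightarrow> b \<in> russell_alg \<Longrightarrow> a + b \<in> russell_alg"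
  and russell_alg_mult: "a \<in> russell_alg \<Longrightarrow> b \<in> russell_alg \<Longrightarrow> a * b \<in> russell_alg"
  using subalg_russell_alg by (auto simp: subalg_def)

lemma russell_alg_0: "0 \<in> russell_alg" and russell_alg_1: "1 \<in> russell_alg"
  using russell_alg_const[of 0] russell_alg_const[of 1] by simp_all

lemma russell_alg_uminus: "a \<in> russell_alg \<Longrightarrow> - a \<in> russell_alg"
  using russell_alg_mult[OF russell_alg_const[of "- 1"]] by simp

lemma russell_alg_diff: "a \<in> russell_alg \<Longrightarrow> b \<in> russell_alg \<Longrightarrow> a - b \<in> russell_alg"
  using russell_alg_add[of a "- b"] russell_alg_uminus by simp

lemma russell_alg_power: "a \<in> russell_alg \<Longrightarrow> a ^ n \<in> russell_alg"
  by (induction n) (auto intro: russell_alg_mult russell_alg_1)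

lemma russell_alg_lead:
  assumes "f \<in> russell_alg" "fls_low m f" "m < 0" "f $$ m \<noteq> 0"
  shows "\<exists>k. cusp ^ k dvd f $$ m \<and> - m \<le> 2 * int k"
  using assms eval_yxzt_lead by (auto simp: russell_alg_def)

text \<open>Polynomials in \<open>y\<close>, \<open>z\<close>, \<open>t\<close> represent all
  classes modulo \<open>x\<close>: the quotient is a polynomial ring in \<open>y\<close> over the
  coordinate ring of the cusp.\<close>

definition eval_yzt :: "zt_poly poly \<Rightarrow> laurent" where "eval_yzt = peval fls_const y_laurent"

lemma is_rhom_eval_yzt: "is_rhom eval_yzt"
  unfolding eval_yzt_def by (intro is_rhom_peval is_rhom_fls_const)

lemma eval_yzt_pCons: "eval_yzt (pCons g P) = fls_const g + y_laurent * eval_yzt P"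
  unfolding eval_yzt_def by (rule peval_pCons[OF is_rhom_fls_const])

lemma eval_yzt_russell_alg: "eval_yzt P \<in> russell_alg"
  unfolding eval_yzt_def by (intro peval_in_subalg subalg_russell_alg is_rhom_fls_const russell_alg_y image_subsetI russell_alg_const)

lemma eval_yzt_low: "fls_low (- 2 * int (degree P)) (eval_yzt P)"
  and eval_yzt_nth: "eval_yzt P $$ (- 2 * int (degree P)) = (- cusp) ^ degree P * lead_coeff P"
proof -
  have "fls_low (- 2 * int (degree P)) (eval_yzt P) \<and> eval_yzt P $$ (- 2 * int (degree P)) = (- cusp) ^ degree P * lead_coeff P"
  proof (induction P)
    case 0
    then show ?case by (simp add: eval_yzt_def)
  next
    case (pCons g P)
    show ?case
    proof (cases "P = 0")
      case True
      then show ?thesis by (simp add: eval_yzt_pCons fls_low_const) (simp add: eval_yzt_def fls_low_const)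
    next
      case False
      have *: "fls_low (- 2 * int (degree (pCons g P))) (y_laurent * eval_yzt P)"
        "(y_laurent * eval_yzt P) $$ (- 2 * int (degree (pCons g P))) = (- cusp) ^ Suc (degree P) * lead_coeff P"
        using fls_low_mult[OF y_laurent_low conjunct1[OF pCons.IH]] fls_nth_mult_low[OF y_laurent_low conjunct1[OF pCons.IH]]
          pCons.IH False y_laurent_nth
        by (simp_all add: algebra_simps)
      have "fls_low (- 2 * int (degree (pCons g P))) (fls_const g)"
        by (rule fls_low_mono[OF fls_low_const]) simp
      then show ?thesis using * False by (simp add: eval_yzt_pCons fls_low_add)
    qed
  qed
  then show "fls_low (- 2 * int (degree P)) (eval_yzt P)"
    "eval_yzt P $$ (- 2 * int (degree P)) = (- cusp) ^ degree P * lead_coeff P" by simp_all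
qed

lemma mult_X_power_low:
  fixes f g :: laurent
  assumes f: "f = fls_X ^ n * g" and low: "fls_low m f"
  shows "fls_low (m - int n) g" "g $$ (m - int n) = f $$ m"
proof -
  have nth: "f $$ i = g $$ (i - int n)" for i
    unfolding f by (simp add: fls_X_power_times_conv_shift)
  show "g $$ (m - int n) = f $$ m" by (simp add: nth)
  have "g $$ i = 0" if "i < m - int n" for i
    using low that nth[of "i + int n"] by (simp add: fls_low_def)
  then show "fls_low (m - int n) g" by (simp add: fls_low_def)
qed

lemma mult_X_low:
  fixes f g :: laurent
  assumes "f = fls_X * g" "fls_low m f"
  shows "fls_low (m - 1) g" "g $$ (m - 1) = f $$ m"
  using mult_X_power_low[of f 1 g m] assms by simp_all

text \<open>For \<open>n = degree P\<close>, division by \<open>x\<close> deepens the pole to order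
  \<open>2 n + 1\<close>, which requires a factor \<open>cusp^(n+1)\<close> in the lowest
  coefficient. Only \<open>cusp^n\<close> comes from \<open>y^n\<close>, so the leading coefficient
  contributes another.\<close>

lemma eval_yzt_in_X_ideal:
  assumes "P \<noteq> 0" "eval_yzt P = fls_X * c" "c \<in> russell_alg"
  shows "cusp dvd lead_coeff P"
proof -
  let ?n = "degree P"
  let ?m = "- 2 * int ?n"
  note c = mult_X_low[OF assms(2) eval_yzt_low]
  have "c $$ (?m - 1) \<noteq> 0" using c(2) assms(1) eval_yzt_nth[of P] by simp
  then obtain k where k: "cusp ^ k dvd c $$ (?m - 1)" "- (?m - 1) \<le> 2 * int k"
    using russell_alg_lead[OF assms(3) c(1)] by auto
  then have "cusp ^ Suc ?n dvd cusp ^ k" by (intro le_imp_power_dvd) linarith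
  also have "\<dots> dvd (- cusp) ^ ?n * lead_coeff P" using k(1) unfolding c(2) eval_yzt_nth .
  also have "\<dots> = cusp ^ ?n * ((- 1) ^ ?n * lead_coeff P)"
    by (subst power_minus) (simp add: algebra_simps)
  finally have "cusp dvd (- 1) ^ ?n * lead_coeff P"
    by (simp add: mult.commute[of cusp])
  then show ?thesis by (cases "even ?n") simp_all
qed

text \<open>In the coordinate ring \<open>cusp = - x (1 + x y)\<close>, so a leading term divisible
  by \<open>cusp\<close> can be absorbed into the multiple of \<open>x\<close>, lowering the degree
  in \<open>y\<close>.\<close>

lemma mod_X_reduced:
  assumes "a \<in> russell_alg"
  shows "\<exists>P a'. a = eval_yzt P + fls_X * a' \<and> a' \<in> russell_alg \<and> (P = 0 \<or> \<not> cusp dvd lead_coeff P)"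
proof -
  obtain A where A: "a = eval_yxzt A" using assms by (auto simp: russell_alg_def)
  have "\<exists>P a'. eval_yxzt A = eval_yzt P + fls_X * a' \<and> a' \<in> russell_alg"
  proof (induction A)
    case 0
    show ?case by (intro exI[of _ 0]) (simp add: russell_alg_0 eval_yzt_def)
  next
    case (pCons c A)
    then obtain P a' where IH: "eval_yxzt A = eval_yzt P + fls_X * a'" "a' \<in> russell_alg" by blast
    obtain g c' where c: "c = pCons g c'" by (cases c)
    have "eval_yxzt (pCons c A) = eval_yzt (pCons g P) + fls_X * (eval_xzt c' + y_laurent * a')"
      by (simp add: eval_yxzt_pCons IH c eval_xzt_pCons eval_yzt_pCons algebra_simps)
    moreover have "eval_xzt c' + y_laurent * a' \<in> russell_alg" using IH russell_alg_y russell_alg_eval_xzt by (intro russell_alg_add russell_alg_mult)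
    ultimately show ?case by blast
  qed
  then obtain P a' where "a = eval_yzt P + fls_X * a'" "a' \<in> russell_alg" using A by blast
  then show ?thesis
  proof (induction "degree P" arbitrary: P a' rule: less_induct)
    case less
    show ?case
    proof (cases "P = 0 \<or> \<not> cusp dvd lead_coeff P")
      case False
      then have "cusp dvd lead_coeff P" by blast
      then obtain l where l: "lead_coeff P = cusp * l" by (elim dvdE)
      define P' where "P' = P - monom (lead_coeff P) (degree P)"
      have P: "P = P' + monom (lead_coeff P) (degree P)" by (simp add: P'_def)
      have cusp: "fls_const cusp = fls_X * (- (1 + fls_X * y_laurent))"
        using X2_y_laurent by (simp add: algebra_simps power2_eq_square)
      have "eval_yzt P = eval_yzt P' + fls_const (cusp * l) * y_laurent ^ degree P"
        by (subst P) (simp add: is_rhomD[OF is_rhom_eval_yzt] l, simp add: eval_yzt_def peval_monom is_rhom_fls_const)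
      also have "\<dots> = eval_yzt P' + fls_X * (- (1 + fls_X * y_laurent) * fls_const l * y_laurent ^ degree P)"
        by (simp only: is_rhomD[OF is_rhom_fls_const] cusp mult.assoc)
      finally have a: "a = eval_yzt P' + fls_X * (- (1 + fls_X * y_laurent) * fls_const l * y_laurent ^ degree P + a')"
        using less.prems by (simp add: algebra_simps)
      have russell_alg: "- (1 + fls_X * y_laurent) * fls_const l * y_laurent ^ degree P + a' \<in> russell_alg"
        using less.prems by (intro russell_alg_add russell_alg_mult russell_alg_uminus russell_alg_power russell_alg_1 russell_alg_X russell_alg_y russell_alg_const)
      show ?thesis
      proof (cases "P' = 0")
        case True
        then show ?thesis using a russell_alg by blast
      next
        case P'0: False
        have "degree P' \<le> degree P"
          unfolding P'_def by (intro degree_diff_le degree_monom_le) auto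
        moreover have "coeff P' (degree P) = 0" by (simp add: P'_def)
        ultimately have "degree P' < degree P"
          using P'0 by (metis le_neq_implies_less leading_coeff_0_iff)
        then show ?thesis using less.hyps a russell_alg by blast
      qed
    qed (use less.prems in blast)
  qed
qed

definition dvd_alg :: "laurent \<Rightarrow> laurent \<Rightarrow> bool" where
  "dvd_alg a b \<longleftrightarrow> (\<exists>c\<in>russell_alg. b = a * c)"

definition prime_alg :: "laurent \<Rightarrow> bool" where
  "prime_alg p \<longleftrightarrow> p \<in> russell_alg \<and> p \<noteq> 0 \<and> \<not> dvd_alg p 1 \<and> (\<forall>a\<in>russell_alg. \<forall>b\<in>russell_alg. dvd_alg p (a * b) \<longrightarrow> dvd_alg p a \<or> dvd_alg p b)"

text \<open>Leading coefficients multiply: if the prime \<open>cusp\<close> divides neither leading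
  coefficient of two reduced representatives, it does not divide that of their product, which is
  then no multiple of \<open>x\<close>.\<close>

lemma prime_alg_X: "prime_alg fls_X"
  unfolding prime_alg_def
proof (intro conjI ballI impI russell_alg_X)
  show "\<not> dvd_alg fls_X 1"
  proof
    assume "dvd_alg fls_X 1"
    then obtain c where c: "c \<in> russell_alg" "1 = fls_X * c" by (auto simp: dvd_alg_def)
    have "eval_yzt 1 = fls_X * c" using c(2) by (simp add: is_rhomD[OF is_rhom_eval_yzt])
    from eval_yzt_in_X_ideal[OF _ this c(1)] show False using prime_elem_cusp by (simp add: prime_elem_def)
  qed
  fix a b assume ab: "a \<in> russell_alg" "b \<in> russell_alg" "dvd_alg fls_X (a * b)"
  obtain P a' where a: "a = eval_yzt P + fls_X * a'" "a' \<in> russell_alg" "P = 0 \<or> \<not> cusp dvd lead_coeff P"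
    using mod_X_reduced[OF ab(1)] by blast
  obtain Q b' where b: "b = eval_yzt Q + fls_X * b'" "b' \<in> russell_alg" "Q = 0 \<or> \<not> cusp dvd lead_coeff Q"
    using mod_X_reduced[OF ab(2)] by blast
  show "dvd_alg fls_X a \<or> dvd_alg fls_X b"
  proof (cases "P = 0 \<or> Q = 0")
    case True
    then show ?thesis using a b by (auto simp: dvd_alg_def is_rhomD[OF is_rhom_eval_yzt])
  next
    case False
    obtain c where c: "c \<in> russell_alg" "a * b = fls_X * c" using ab by (auto simp: dvd_alg_def)
    have "a * b = eval_yzt (P * Q) + fls_X * (a' * eval_yzt Q + b' * eval_yzt P + fls_X * a' * b')"
      by (simp add: a b is_rhomD[OF is_rhom_eval_yzt] algebra_simps)
    then have "eval_yzt (P * Q) = fls_X * (c - (a' * eval_yzt Q + b' * eval_yzt P + fls_X * a' * b'))"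
      using c by (simp add: algebra_simps)
    moreover have "c - (a' * eval_yzt Q + b' * eval_yzt P + fls_X * a' * b') \<in> russell_alg"
      using a b c by (intro russell_alg_diff russell_alg_add russell_alg_mult eval_yzt_russell_alg russell_alg_X)
    ultimately have "cusp dvd lead_coeff (P * Q)" using False by (intro eval_yzt_in_X_ideal) auto
    then show ?thesis using a b False prime_elem_dvd_mult_iff[OF prime_elem_cusp] by (auto simp: lead_coeff_mult)
  qed
qed simp

text \<open>If \<open>x^n\<close> divides \<open>f\<close> for large \<open>n\<close>, the quotient
  has a deep pole with the same lowest coefficient as \<open>f\<close>, which must be divisible by a
  high power of \<open>cusp\<close>. Its degree in \<open>z\<close> bounds that power and hence
  \<open>n\<close>.\<close>

lemma X_multiplicity:
  assumes f: "f \<in> russell_alg" "f \<noteq> 0"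
  obtains m q where "f = fls_X ^ m * q" "q \<in> russell_alg" "\<not> dvd_alg fls_X q"
proof -
  define i where "i = fls_subdegree f"
  define g where "g = f $$ i"
  have g: "g \<noteq> 0" using f by (simp add: g_def i_def)
  define S where "S = {n. \<exists>q\<in>russell_alg. f = fls_X ^ n * q}"
  have "n \<le> nat (\<bar>i\<bar> + int (degree g))" if "n \<in> S" for n
  proof (rule ccontr)
    assume n: "\<not> n \<le> nat (\<bar>i\<bar> + int (degree g))"
    obtain q where q: "q \<in> russell_alg" "f = fls_X ^ n * q" using \<open>n \<in> S\<close> by (auto simp: S_def)
    have low: "fls_low (i - int n) q" "q $$ (i - int n) = g"
      using mult_X_power_low[OF q(2), of i] fls_low_subdegree[of f] by (simp_all add: i_def g_def)
    moreover have "i - int n < 0" using n by linarith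
    ultimately obtain k where k: "cusp ^ k dvd g" "- (i - int n) \<le> 2 * int k"
      using russell_alg_lead[OF q(1) low(1)] g by auto
    have "degree (cusp ^ k) = 2 * k" by (subst degree_power_eq) (simp_all add: cusp_eq)
    then have "2 * k \<le> degree g" using dvd_imp_degree_le[OF k(1) g] by simp
    then show False using k(2) n by linarith
  qed
  then have fin: "finite S" by (intro finite_subset[of S "{..nat (\<bar>i\<bar> + int (degree g))}"]) auto
  have "0 \<in> S" using f by (auto simp: S_def)
  then have "Max S \<in> S" using fin by (intro Max_in) auto
  then obtain q where q: "q \<in> russell_alg" "f = fls_X ^ Max S * q" by (auto simp: S_def)
  have "\<not> dvd_alg fls_X q"
  proof
    assume "dvd_alg fls_X q"
    then obtain c where c: "c \<in> russell_alg" "q = fls_X * c" by (auto simp: dvd_alg_def)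
    then have "f = fls_X ^ Suc (Max S) * c" by (subst q(2)) (simp add: algebra_simps)
    then have "Suc (Max S) \<in> S" using c by (auto simp: S_def)
    then show False using Max_ge[OF fin] by fastforce
  qed
  then show ?thesis using that q by blast
qed

lemma cancel_X_power:
  assumes "\<not> dvd_alg fls_X q" "q \<in> russell_alg" "a \<in> russell_alg"
  shows "dvd_alg q (fls_X ^ N * a) \<Longrightarrow> dvd_alg q a"
proof (induction N)
  case (Suc N)
  then obtain s where s: "s \<in> russell_alg" "fls_X ^ Suc N * a = q * s" by (auto simp: dvd_alg_def)
  have "q * s = fls_X * (fls_X ^ N * a)" using s(2) by (simp add: mult.assoc)
  moreover have "fls_X ^ N * a \<in> russell_alg" using assms by (intro russell_alg_mult russell_alg_power russell_alg_X)
  ultimately have "dvd_alg fls_X (q * s)" unfolding dvd_alg_def by blast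
  then have "dvd_alg fls_X s" using prime_alg_X assms s unfolding prime_alg_def by blast
  then obtain s' where s': "s' \<in> russell_alg" "s = fls_X * s'" by (auto simp: dvd_alg_def)
  have "fls_X * (fls_X ^ N * a) = fls_X * (q * s')" using s s' by (simp add: algebra_simps)
  then have "fls_X ^ N * a = q * s'" by (subst (asm) mult_cancel_left) simp
  then show ?case using Suc.IH s' unfolding dvd_alg_def by blast
qed simp

section \<open>Nagata's criterion: primes from the localization at \<open>x\<close>\<close>

lemma clear_denominator:
  assumes "a \<in> russell_alg"
  obtains N r where "fls_X ^ N * a = eval_xzt r"
proof -
  obtain A where A: "a = eval_yxzt A" using assms by (auto simp: russell_alg_def)
  have eval_xzt_X: "eval_xzt [:0, 1:] = fls_X" by (simp add: eval_xzt_pCons)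
  have eval_xzt_w: "eval_xzt [:cusp, 1:] = fls_const cusp + fls_X" by (simp add: eval_xzt_pCons)
  have "\<exists>N r. fls_X ^ N * eval_yxzt A = eval_xzt r"
  proof (induction A)
    case 0
    show ?case by (intro exI[of _ 0]) simp
  next
    case (pCons c A)
    then obtain N r where "fls_X ^ N * eval_yxzt A = eval_xzt r" by blast
    then have "fls_X ^ (N + 2) * eval_yxzt (pCons c A) = fls_X ^ (N + 2) * eval_xzt c + (fls_X\<^sup>2 * y_laurent) * eval_xzt r"
      by (simp add: eval_yxzt_pCons algebra_simps power_add power2_eq_square)
    also have "\<dots> = eval_xzt ([:0, 1:] ^ (N + 2) * c - [:cusp, 1:] * r)"
      unfolding X2_y_laurent is_rhomD[OF is_rhom_eval_xzt] eval_xzt_X eval_xzt_w by (simp add: algebra_simps)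
    finally show ?case by blast
  qed
  then show ?thesis using that A by blast
qed

text \<open>A polynomial prime to \<open>x\<close> may become a multiple of \<open>x\<close> in the
  coordinate ring: \<open>x + cusp = - x^2 y\<close>. The prime element is therefore the part
  \<open>q\<close> that remains after all factors \<open>x\<close> are removed. Questions of
  divisibility are moved to polynomials by clearing denominators, which is harmless since
  \<open>p\<close> divides no power of \<open>x\<close>.\<close>

lemma prime_alg_eval_xzt:
  assumes p: "prime_elem p" "\<not> p dvd [:0, 1:]" and q: "q \<in> russell_alg" "\<not> dvd_alg fls_X q" "eval_xzt p = fls_X ^ m * q"
  shows "prime_alg q"
proof -
  have X: "fls_X = eval_xzt [:0, 1:]" by (simp add: eval_xzt_pCons)
  have pX: "\<not> p dvd [:0, 1:] ^ k" for k
    using p prime_elem_dvd_power by blast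
  have eval_xzt_dvd: "p dvd r" if fr: "eval_xzt p * f = eval_xzt r" "f \<in> russell_alg" for f r
  proof -
    obtain N s where s: "fls_X ^ N * f = eval_xzt s" using clear_denominator[OF fr(2)] by blast
    have "eval_xzt (p * s) = eval_xzt p * (fls_X ^ N * f)" by (simp add: s is_rhomD[OF is_rhom_eval_xzt])
    also have "\<dots> = eval_xzt ([:0, 1:] ^ N * r)" by (simp add: is_rhomD[OF is_rhom_eval_xzt] X fr(1)[symmetric] algebra_simps)
    finally have "p dvd [:0, 1:] ^ N * r" by (metis dvd_triv_left eval_xzt_eq_iff)
    then show ?thesis using pX p(1) prime_elem_dvd_mult_iff by blast
  qed
  show ?thesis
    unfolding prime_alg_def
  proof (intro conjI ballI impI q(1))
    show "q \<noteq> 0" using q(3) p(1) eval_xzt_eq_iff[of p 0] by (auto simp: prime_elem_def)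
    show "\<not> dvd_alg q 1"
    proof
      assume "dvd_alg q 1"
      then obtain c where "c \<in> russell_alg" "1 = q * c" by (auto simp: dvd_alg_def)
      then have "eval_xzt p * c = eval_xzt ([:0, 1:] ^ m)" by (simp add: q(3) is_rhomD[OF is_rhom_eval_xzt] X mult.assoc)
      then show False using eval_xzt_dvd pX \<open>c \<in> russell_alg\<close> by blast
    qed
    fix a b assume ab: "a \<in> russell_alg" "b \<in> russell_alg" "dvd_alg q (a * b)"
    then obtain c where c: "c \<in> russell_alg" "a * b = q * c" by (auto simp: dvd_alg_def)
    obtain N a' where a': "fls_X ^ N * a = eval_xzt a'" using clear_denominator[OF ab(1)] by blast
    obtain M b' where b': "fls_X ^ M * b = eval_xzt b'" using clear_denominator[OF ab(2)] by blast
    have "eval_xzt p * (fls_X ^ N * fls_X ^ M * c) = fls_X ^ m * ((fls_X ^ N * a) * (fls_X ^ M * b))"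
      using c(2) by (simp add: q(3) algebra_simps)
    also have "\<dots> = eval_xzt ([:0, 1:] ^ m * (a' * b'))"
      unfolding a' b' by (simp add: is_rhomD[OF is_rhom_eval_xzt] X)
    finally have "p dvd [:0, 1:] ^ m * (a' * b')"
      by (rule eval_xzt_dvd) (intro russell_alg_mult russell_alg_power russell_alg_X c)
    then have "p dvd a' \<or> p dvd b'" using pX p(1) prime_elem_dvd_mult_iff by blast
    moreover have "dvd_alg q d" if d: "p dvd d'" "fls_X ^ K * d = eval_xzt d'" "d \<in> russell_alg" for d d' K
    proof -
      obtain r where "d' = p * r" using d(1) by (elim dvdE)
      then have "fls_X ^ K * d = q * (fls_X ^ m * eval_xzt r)"
        using d(2) by (simp add: is_rhomD[OF is_rhom_eval_xzt] q(3) algebra_simps)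
      moreover have "fls_X ^ m * eval_xzt r \<in> russell_alg" by (intro russell_alg_mult russell_alg_power russell_alg_X russell_alg_eval_xzt)
      ultimately have "dvd_alg q (fls_X ^ K * d)" unfolding dvd_alg_def by blast
      then show ?thesis using cancel_X_power q d by blast
    qed
    ultimately show "dvd_alg q a \<or> dvd_alg q b" using a' b' ab by blast
  qed
qed

definition factorable :: "laurent \<Rightarrow> bool" where
  "factorable b \<longleftrightarrow> (\<exists>u ps. u \<in> russell_alg \<and> dvd_alg u 1 \<and> (\<forall>p\<in>set ps. prime_alg p) \<and> b = u * prod_list ps)"

lemma factorable_mult_prime: "factorable b \<Longrightarrow> prime_alg p \<Longrightarrow> factorable (p * b)"
proof -
  assume "factorable b" "prime_alg p"
  then obtain u ps where "u \<in> russell_alg" "dvd_alg u 1" "\<forall>p\<in>set ps. prime_alg p" "b = u * prod_list ps"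
    unfolding factorable_def by blast
  then show "factorable (p * b)"
    unfolding factorable_def using \<open>prime_alg p\<close>
    by (intro exI[of _ u] exI[of _ "p # ps"]) (simp add: algebra_simps)
qed

lemma factorable_mult_X_power: "factorable b \<Longrightarrow> factorable (fls_X ^ n * b)"
  by (induction n) (auto simp: mult.assoc intro: factorable_mult_prime prime_alg_X)

lemma dvd_alg_eval_xzt_unit: "is_unit v \<Longrightarrow> dvd_alg (eval_xzt v) 1"
  unfolding dvd_alg_def by (metis dvdE is_rhomD(2,4)[OF is_rhom_eval_xzt] russell_alg_eval_xzt)

text \<open>Induction over the prime factors of the numerator \<open>r\<close>. The unit
  \<open>v\<close> absorbs the discrepancy between \<open>x\<close> and an associated prime, and
  \<open>N\<close> varies because stripping a prime can change the power of \<open>x\<close> in the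
  denominator.\<close>

lemma factorable_if_eval_xzt:
  assumes "r \<noteq> 0"
  shows "b \<in> russell_alg \<Longrightarrow> is_unit v \<Longrightarrow> fls_X ^ N * b = eval_xzt (v * r) \<Longrightarrow> factorable b"
  using assms
proof (induction r arbitrary: b v N rule: prime_divisors_induct)
  case (unit r)
  then have u: "dvd_alg (eval_xzt (v * r)) 1" by (intro dvd_alg_eval_xzt_unit) auto
  then obtain c where c: "c \<in> russell_alg" "1 = fls_X ^ N * b * c" unfolding unit(4)[symmetric] dvd_alg_def by blast
  have "N = 0"
  proof (rule ccontr)
    assume "N \<noteq> 0"
    then have "1 = fls_X * (fls_X ^ (N - 1) * b * c)" using c by (cases N) (simp_all add: algebra_simps)
    moreover have "fls_X ^ (N - 1) * b * c \<in> russell_alg" using c unit by (intro russell_alg_mult russell_alg_power russell_alg_X)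
    ultimately have "dvd_alg fls_X 1" unfolding dvd_alg_def by blast
    then show False using prime_alg_X by (simp add: prime_alg_def)
  qed
  then have "dvd_alg b 1" using u unit(4) by simp
  then show ?case unfolding factorable_def using unit(2) by (intro exI[of _ b] exI[of _ "[]"]) simp
next
  case (factor p r)
  have r: "r \<noteq> 0" using factor.prems by auto
  have p: "prime_elem p" using factor.hyps by (rule prime_imp_prime_elem)
  have BLvr: "eval_xzt (v * r) \<in> russell_alg" by (rule russell_alg_eval_xzt)
  show ?case
  proof (cases "p dvd [:0, 1:]")
    \<comment> \<open>Degrees in the outer variable \<open>x\<close> add up to 1, and
      \<open>p\<close> cannot have degree 0 without being a unit; so \<open>p\<close> is
      \<open>x\<close> up to a unit.\<close>
    case True
    then obtain c where c: "[:0, 1:] = p * c" by (elim dvdE)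
    have "p \<noteq> 0" "c \<noteq> 0" using c by auto
    then have deg: "degree p + degree c = 1"
      using degree_mult_eq[of p c] by (simp flip: c)
    have "degree p \<noteq> 0"
    proof
      assume "degree p = 0"
      then obtain p1 where p1: "p = [:p1:]" by (metis degree_eq_zeroE)
      then have "p1 * coeff c 1 = 1" using arg_cong[OF c, of "\<lambda>q. coeff q 1"] by simp
      then have "p * [:coeff c 1:] = 1" by (simp add: p1 one_pCons mult.commute)
      then show False using p by (metis dvd_triv_left prime_elem_def)
    qed
    then have "degree c = 0" using deg by simp
    then obtain c1 where c1: "c = [:c1:]" by (metis degree_eq_zeroE)
    then have "coeff p 1 * c1 = 1" using arg_cong[OF c, of "\<lambda>q. coeff q 1"] by (simp add: mult.commute)
    moreover have "c * [:coeff p 1:] = [:coeff p 1 * c1:]" unfolding c1 by (simp add: mult.commute)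
    ultimately have cc: "c * [:coeff p 1:] = 1" by (simp only: one_pCons)
    define v' where "v' = v * [:coeff p 1:]"
    have v': "is_unit v'" unfolding v'_def using factor.prems(2) cc by (metis dvd_triv_right is_unit_mult_iff)
    have "p = [:0, 1:] * [:coeff p 1:]" unfolding c using cc by (simp only: mult.assoc mult_1_right)
    then have "v * (p * r) = [:0, 1:] * (v' * r)" unfolding v'_def by (metis mult.assoc mult.left_commute)
    then have eq: "fls_X ^ N * b = fls_X * eval_xzt (v' * r)"
      using factor.prems by (simp only: is_rhomD[OF is_rhom_eval_xzt]) (simp add: eval_xzt_pCons)
    show ?thesis
    proof (cases N)
      case 0
      have "factorable (eval_xzt (v' * r))" using factor.IH[OF russell_alg_eval_xzt v' _ r, of 0 "v' * r"] by simp
      then show ?thesis using eq 0 factorable_mult_prime[OF _ prime_alg_X] by simp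
    next
      case (Suc N')
      then have "fls_X * (fls_X ^ N' * b) = fls_X * eval_xzt (v' * r)" using eq by (simp add: mult.assoc)
      then have "fls_X ^ N' * b = eval_xzt (v' * r)" by (simp add: mult_cancel_left)
      then show ?thesis using factor.IH[OF factor.prems(1) v' _ r] by blast
    qed
  next
    case False
    have p0: "eval_xzt p \<noteq> 0" using p eval_xzt_eq_iff[of p 0] by (auto simp: prime_elem_def)
    obtain m q where q: "eval_xzt p = fls_X ^ m * q" "q \<in> russell_alg" "\<not> dvd_alg fls_X q"
      using X_multiplicity[OF russell_alg_eval_xzt p0] by blast
    have prime: "prime_alg q" using prime_alg_eval_xzt[OF p False q(2,3,1)] .
    have eq: "fls_X ^ N * b = q * (fls_X ^ m * eval_xzt (v * r))"
      using factor.prems by (simp add: is_rhomD[OF is_rhom_eval_xzt] q(1) algebra_simps)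
    then have "dvd_alg q (fls_X ^ N * b)"
      unfolding dvd_alg_def using BLvr by (intro bexI[of _ "fls_X ^ m * eval_xzt (v * r)"] russell_alg_mult russell_alg_power russell_alg_X)
    then obtain b' where b': "b' \<in> russell_alg" "b = q * b'"
      using cancel_X_power[OF q(3,2) factor.prems(1)] unfolding dvd_alg_def by blast
    have "q \<noteq> 0" using prime by (simp add: prime_alg_def)
    have "q * (fls_X ^ N * b') = q * (fls_X ^ m * eval_xzt (v * r))"
      using eq unfolding b' by (simp add: algebra_simps)
    then have eq': "fls_X ^ N * b' = fls_X ^ m * eval_xzt (v * r)" using \<open>q \<noteq> 0\<close> by simp
    have "factorable b'"
    proof (cases "m \<le> N")
      case True
      then have "fls_X ^ m * (fls_X ^ (N - m) * b') = fls_X ^ m * eval_xzt (v * r)"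
        using eq' by (simp flip: power_add mult.assoc)
      then have "fls_X ^ (N - m) * b' = eval_xzt (v * r)" by (simp add: mult_cancel_left)
      then show ?thesis using factor.IH[OF b'(1) factor.prems(2) _ r] by blast
    next
      case False
      then have "fls_X ^ N * b' = fls_X ^ N * (fls_X ^ (m - N) * eval_xzt (v * r))"
        using eq' by (simp flip: power_add mult.assoc)
      then have "b' = fls_X ^ (m - N) * eval_xzt (v * r)" by (simp add: mult_cancel_left)
      moreover have "factorable (eval_xzt (v * r))"
        using factor.IH[OF BLvr factor.prems(2) _ r, of 0] by simp
      ultimately show ?thesis by (simp add: factorable_mult_X_power)
    qed
    then show ?thesis unfolding b'(2) using prime by (rule factorable_mult_prime)
  qed
qed simp

theorem factorable_russell_alg:
  assumes "b \<in> russell_alg" "b \<noteq> 0"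
  shows "factorable b"
proof -
  obtain N r where r: "fls_X ^ N * b = eval_xzt r" using clear_denominator[OF assms(1)] by blast
  moreover have "r \<noteq> 0"
  proof
    assume "r = 0"
    then have "fls_X ^ N * b = 0" using r by simp
    then show False using assms(2) by simp
  qed
  ultimately show ?thesis using factorable_if_eval_xzt[of r b 1 N] assms(1) by simp
qed

section \<open>Evaluation of finitely supported polynomials\<close>

lemma single_sum_induct [case_names zero single add]:
  fixes p :: "'a \<Rightarrow>\<^sub>0 'b::comm_monoid_add"
  assumes "P 0" "\<And>m c. P (Poly_Mapping.single m c)" "\<And>p q. P p \<Longrightarrow> P q \<Longrightarrow> P (p + q)"
  shows "P p"
proof -
  have "p = (\<Sum>m\<in>Poly_Mapping.keys p. Poly_Mapping.single m (Poly_Mapping.lookup p m))"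
    by (rule poly_mapping_eqI)
       (simp add: lookup_sum lookup_single when_def sum.If_cases in_keys_iff Int_def)
  moreover have "P (\<Sum>m\<in>A. Poly_Mapping.single m (f m))" for A :: "'a set" and f :: "'a \<Rightarrow> 'b"
    by (induction A rule: infinite_finite_induct) (auto intro: assms)
  ultimately show ?thesis by metis
qed

definition eval_mon :: "('v \<Rightarrow> laurent) \<Rightarrow> ('v \<Rightarrow>\<^sub>0 nat) \<Rightarrow> laurent" where
  "eval_mon v m = (\<Prod>s\<in>Poly_Mapping.keys m. v s ^ Poly_Mapping.lookup m s)"

text \<open>The type of indeterminates is left open: it is instantiated by the four coordinates and
  by the elements of a ring, as in \<open>eval_at\<close>.\<close>

definition eval_laurent :: "('v \<Rightarrow> laurent) \<Rightarrow> (('v \<Rightarrow>\<^sub>0 nat) \<Rightarrow>\<^sub>0 complex) \<Rightarrow> laurent" where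
  "eval_laurent v p = (\<Sum>m\<in>Poly_Mapping.keys p. cst (Poly_Mapping.lookup p m) * eval_mon v m)"

lemma eval_mon_superset:
  assumes "finite A" "Poly_Mapping.keys m \<subseteq> A"
  shows "eval_mon v m = (\<Prod>s\<in>A. v s ^ Poly_Mapping.lookup m s)"
  unfolding eval_mon_def using assms by (intro prod.mono_neutral_left) (auto simp: in_keys_iff)

lemma eval_mon_add: "eval_mon v (m + n) = eval_mon v m * eval_mon v n"
proof -
  define A where "A = Poly_Mapping.keys m \<union> Poly_Mapping.keys n"
  have A: "finite A" "Poly_Mapping.keys m \<subseteq> A" "Poly_Mapping.keys n \<subseteq> A" "Poly_Mapping.keys (m + n) \<subseteq> A"
    using Poly_Mapping.keys_add[of m n] by (auto simp: A_def)
  show ?thesis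
    by (simp add: eval_mon_superset[OF A(1,2)] eval_mon_superset[OF A(1,3)] eval_mon_superset[OF A(1,4)]
        lookup_add power_add prod.distrib)
qed

lemma eval_mon_0 [simp]: "eval_mon v 0 = 1"
  by (simp add: eval_mon_def)

lemma eval_mon_single [simp]: "eval_mon v (Poly_Mapping.single s n) = v s ^ n"
  by (simp add: eval_mon_def)

lemma eval_laurent_superset:
  assumes "finite A" "Poly_Mapping.keys p \<subseteq> A"
  shows "eval_laurent v p = (\<Sum>m\<in>A. cst (Poly_Mapping.lookup p m) * eval_mon v m)"
  unfolding eval_laurent_def using assms by (intro sum.mono_neutral_left) (auto simp: in_keys_iff)

lemma eval_laurent_add: "eval_laurent v (p + q) = eval_laurent v p + eval_laurent v q"
proof -
  define A where "A = Poly_Mapping.keys p \<union> Poly_Mapping.keys q"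
  have A: "finite A" "Poly_Mapping.keys p \<subseteq> A" "Poly_Mapping.keys q \<subseteq> A" "Poly_Mapping.keys (p + q) \<subseteq> A"
    using Poly_Mapping.keys_add[of p q] by (auto simp: A_def)
  show ?thesis
    by (simp add: eval_laurent_superset[OF A(1,2)] eval_laurent_superset[OF A(1,3)] eval_laurent_superset[OF A(1,4)]
        lookup_add is_rhomD[OF is_rhom_cst] distrib_right sum.distrib)
qed

lemma eval_laurent_0 [simp]: "eval_laurent v 0 = 0"
  by (simp add: eval_laurent_def)

lemma eval_laurent_single [simp]: "eval_laurent v (Poly_Mapping.single m c) = cst c * eval_mon v m"
  by (simp add: eval_laurent_def)

lemma eval_laurent_mult: "eval_laurent v (p * q) = eval_laurent v p * eval_laurent v q"
proof (induction p rule: single_sum_induct)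
  case (single m c)
  show ?case
  proof (induction q rule: single_sum_induct)
    case (single n d)
    show ?case
      by (simp add: mult_single eval_mon_add is_rhomD(4)[OF is_rhom_cst])
  next
    case (add q r)
    then show ?case by (simp only: distrib_left eval_laurent_add)
  qed simp
next
  case (add p r)
  then show ?case by (simp only: distrib_right eval_laurent_add)
qed simp

lemma is_rhom_eval_laurent: "is_rhom (eval_laurent v)"
  by (simp add: is_rhom_def eval_laurent_mult eval_laurent_add is_rhomD[OF is_rhom_cst] flip: single_one)

section \<open>Algebraic properties of rings isomorphic to the Laurent model\<close>

definition russell_alg_ring :: "laurent ring" where
  "russell_alg_ring = \<lparr>carrier = russell_alg, monoid.mult = (*), one = 1, ring.zero = 0, add = (+)\<rparr>"

lemma russell_alg_ring_simps [simp]: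
  "carrier russell_alg_ring = russell_alg" "a \<otimes>\<^bsub>russell_alg_ring\<^esub> b = a * b" "\<one>\<^bsub>russell_alg_ring\<^esub> = 1" "\<zero>\<^bsub>russell_alg_ring\<^esub> = 0" "a \<oplus>\<^bsub>russell_alg_ring\<^esub> b = a + b"
  by (simp_all add: russell_alg_ring_def)

lemma cring_russell_alg_ring: "cring russell_alg_ring"
proof (rule cringI)
  show "abelian_group russell_alg_ring"
    by (rule abelian_groupI) (auto simp: russell_alg_add russell_alg_0 algebra_simps intro!: bexI[of _ "- x" for x] russell_alg_uminus)
  show "comm_monoid russell_alg_ring"
    by (rule comm_monoidI) (auto simp: russell_alg_mult russell_alg_1 algebra_simps)
qed (simp add: algebra_simps)

text \<open>An irreducible element associated to a product of primes is divisible by one of them,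
  hence associated to it and prime itself. Uniqueness of factorizations follows from the primeness
  of irreducibles.\<close>

lemma (in comm_monoid_cancel) factorial_monoid_if_prime_products:
  assumes "\<And>a. a \<in> carrier G \<Longrightarrow>
     \<exists>fs. set fs \<subseteq> carrier G \<and> (\<forall>p\<in>set fs. Divisibility.prime G p) \<and> foldr (\<otimes>) fs \<one> \<sim> a"
  shows "factorial_monoid G"
proof -
  have "primeness_condition_monoid G"
  proof
    fix a assume a: "a \<in> carrier G" "Divisibility.irreducible G a"
    obtain fs where fs: "set fs \<subseteq> carrier G" "\<forall>p\<in>set fs. Divisibility.prime G p" "foldr (\<otimes>) fs \<one> \<sim> a"
      using assms[OF a(1)] by blast
    show "Divisibility.prime G a"
    proof (cases fs)
      case Nil
      then have "\<one> \<sim> a" using fs by simp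
      then have "a \<in> Units G" using a assoc_unit_r[of \<one> a] Units_one_closed by blast
      then show ?thesis using a by (simp add: Divisibility.irreducible_def)
    next
      case (Cons p ps)
      have p: "p \<in> carrier G" "Divisibility.prime G p" using fs Cons by auto
      have ps: "foldr (\<otimes>) ps \<one> \<in> carrier G"
        using fs(1) Cons by (intro multlist_closed) auto
      have "p divides p \<otimes> foldr (\<otimes>) ps \<one>" using ps by (auto simp: factor_def)
      then have dvd: "p divides a"
        using divides_cong_r[of p "p \<otimes> foldr (\<otimes>) ps \<one>" a] fs(3) p a ps Cons by simp
      have "p \<notin> Units G" using p by (simp add: Divisibility.prime_def)
      then have "\<not> properfactor G p a" using a p by (auto simp: Divisibility.irreducible_def)
      then have "p \<sim> a" using dvd by (auto simp: properfactor_def associated_def)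
      then show ?thesis using prime_cong p a by blast
    qed
  qed
  then interpret pc: primeness_condition_monoid G .
  show ?thesis
  proof (rule factorial_monoidI)
    fix a assume a: "a \<in> carrier G"
    obtain fs where fs: "set fs \<subseteq> carrier G" "\<forall>p\<in>set fs. Divisibility.prime G p" "foldr (\<otimes>) fs \<one> \<sim> a"
      using assms[OF a] by blast
    then have "wfactors G fs a" by (intro wfactorsI) (auto intro: prime_irreducible)
    then show "\<exists>fs. set fs \<subseteq> carrier G \<and> wfactors G fs a" using fs by blast
  qed (rule pc.wfactors_unique)
qed

text \<open>Formulated for an arbitrary ring because it is applied twice: to the quotient ring
  itself, and to any representative of its isomorphism class that might carry a grading.\<close>

locale russell_model =
  fixes R :: "'a ring" (structure) and \<phi> :: "complex \<Rightarrow> 'a" and h :: "'a \<Rightarrow> laurent"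
  assumes cringR: "cring R"
    and h: "h \<in> ring_iso R russell_alg_ring"
    and h_const: "h (\<phi> c) = cst c" and const_carrier: "\<phi> c \<in> carrier R"
begin

sublocale cring R by (rule cringR)

lemma h_russell_alg: "a \<in> carrier R \<Longrightarrow> h a \<in> russell_alg"
  and h_mult: "a \<in> carrier R \<Longrightarrow> b \<in> carrier R \<Longrightarrow> h (a \<otimes> b) = h a * h b"
  and h_add: "a \<in> carrier R \<Longrightarrow> b \<in> carrier R \<Longrightarrow> h (a \<oplus> b) = h a + h b"
  and h_one: "h \<one> = 1"
  and h_bij: "bij_betw h (carrier R) russell_alg"
  using ring_iso_memE[OF h] by auto

lemma h_zero: "h \<zero> = 0"
  using h_add[of \<zero> \<zero>] by simp

lemma h_eq_iff: "a \<in> carrier R \<Longrightarrow> b \<in> carrier R \<Longrightarrow> h a = h b \<longleftrightarrow> a = b"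
  using h_bij by (auto simp: bij_betw_def inj_on_def)

lemma h_eq_0_iff: "a \<in> carrier R \<Longrightarrow> h a = 0 \<longleftrightarrow> a = \<zero>"
  using h_eq_iff[of a \<zero>] h_zero by simp

lemma h_surj: "b \<in> russell_alg \<Longrightarrow> \<exists>a\<in>carrier R. h a = b"
  using h_bij by (metis bij_betw_imp_surj_on imageE)

lemma h_pow: "a \<in> carrier R \<Longrightarrow> h (a [^] (n::nat)) = h a ^ n"
  by (induction n) (simp_all add: h_one h_mult mult.commute)

lemma h_finsum: "(\<And>i. i \<in> A \<Longrightarrow> f i \<in> carrier R) \<Longrightarrow> h (\<Oplus>i\<in>A. f i) = (\<Sum>i\<in>A. h (f i))"
  by (induction A rule: infinite_finite_induct) (simp_all add: h_zero h_add finsum_infinite Pi_def)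

lemma h_finprod: "(\<And>i. i \<in> A \<Longrightarrow> f i \<in> carrier R) \<Longrightarrow> h (\<Otimes>i\<in>A. f i) = (\<Prod>i\<in>A. h (f i))"
  by (induction A rule: infinite_finite_induct) (simp_all add: h_one h_mult finprod_infinite Pi_def)

lemma domainR: "domain R"
proof
  show "\<one> \<noteq> \<zero>" using h_one h_zero by auto
  fix a b assume "a \<otimes> b = \<zero>" "a \<in> carrier R" "b \<in> carrier R"
  then have "h a * h b = 0" using h_mult h_zero by metis
  then show "a = \<zero> \<or> b = \<zero>" using h_eq_0_iff \<open>a \<in> carrier R\<close> \<open>b \<in> carrier R\<close> by auto
qed

lemma contains_CR: "contains_C R \<phi>"
proof -
  have "\<phi> \<in> ring_hom complex_ring R"
  proof (rule ring_hom_memI)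
    fix c d :: complex
    show "\<phi> c \<in> carrier R" by (rule const_carrier)
    have "h (\<phi> (c * d)) = h (\<phi> c \<otimes> \<phi> d)" "h (\<phi> (c + d)) = h (\<phi> c \<oplus> \<phi> d)"
      by (simp_all add: h_mult h_add h_const const_carrier is_rhomD[OF is_rhom_cst])
    then show "\<phi> (c \<otimes>\<^bsub>complex_ring\<^esub> d) = \<phi> c \<otimes> \<phi> d" "\<phi> (c \<oplus>\<^bsub>complex_ring\<^esub> d) = \<phi> c \<oplus> \<phi> d"
      by (simp_all add: h_eq_iff const_carrier ring_of_type_algebra_def)
    have "h (\<phi> 1) = h \<one>" by (simp add: h_const h_one is_rhomD[OF is_rhom_cst])
    then show "\<phi> \<one>\<^bsub>complex_ring\<^esub> = \<one>"
      by (simp add: h_eq_iff const_carrier ring_of_type_algebra_def)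
  qed
  moreover have "inj \<phi>" using h_const by (metis cst_eq_iff injI)
  ultimately show ?thesis by (simp add: contains_C_def C_algebra_def cringR)
qed

lemma divides_iff:
  assumes "a \<in> carrier (mult_of R)" "b \<in> carrier (mult_of R)"
  shows "a divides\<^bsub>mult_of R\<^esub> b \<longleftrightarrow> dvd_alg (h a) (h b)"
proof
  assume "a divides\<^bsub>mult_of R\<^esub> b"
  then obtain c where "c \<in> carrier R" "b = a \<otimes> c" by (auto simp: factor_def)
  then show "dvd_alg (h a) (h b)" using assms by (auto simp: dvd_alg_def h_mult h_russell_alg)
next
  assume "dvd_alg (h a) (h b)"
  then obtain c' where c': "c' \<in> russell_alg" "h b = h a * c'" by (auto simp: dvd_alg_def)
  then obtain c where c: "c \<in> carrier R" "h c = c'" using h_surj by blast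
  then have "b = a \<otimes> c" using c' assms by (simp add: h_mult flip: h_eq_iff)
  moreover then have "c \<noteq> \<zero>" using assms by auto
  ultimately show "a divides\<^bsub>mult_of R\<^esub> b" using c by (auto simp: factor_def)
qed

lemma prime_if_prime_alg:
  assumes "a \<in> carrier (mult_of R)" "prime_alg (h a)"
  shows "Divisibility.prime (mult_of R) a"
  unfolding Divisibility.prime_def
proof (intro conjI ballI impI)
  interpret domain R by (rule domainR)
  show "a \<notin> Units (mult_of R)"
  proof
    assume "a \<in> Units (mult_of R)"
    then obtain b where "b \<in> carrier R" "a \<otimes> b = \<one>" by (auto simp: Units_def)
    then have "1 = h a * h b" using assms(1) h_mult[of a b] h_one by auto
    then have "dvd_alg (h a) 1" using \<open>b \<in> carrier R\<close> h_russell_alg by (auto simp: dvd_alg_def)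
    then show False using assms(2) by (simp add: prime_alg_def)
  qed
  fix b c assume bc: "b \<in> carrier (mult_of R)" "c \<in> carrier (mult_of R)" "a divides\<^bsub>mult_of R\<^esub> (b \<otimes>\<^bsub>mult_of R\<^esub> c)"
  then have "b \<otimes> c \<in> carrier (mult_of R)" by (auto simp: integral_iff)
  then have "dvd_alg (h a) (h b * h c)" using bc divides_iff[OF assms(1), of "b \<otimes> c"] h_mult by auto
  then have "dvd_alg (h a) (h b) \<or> dvd_alg (h a) (h c)" using assms(2) bc h_russell_alg by (auto simp: prime_alg_def)
  then show "a divides\<^bsub>mult_of R\<^esub> b \<or> a divides\<^bsub>mult_of R\<^esub> c" using divides_iff assms bc by auto
qed

theorem factorial_domainR: "factorial_domain R"
proof -
  interpret domain R by (rule domainR)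
  have "factorial_monoid (mult_of R)"
  proof (rule comm_monoid_cancel.factorial_monoid_if_prime_products[OF mult_of.comm_monoid_cancel_axioms])
    fix a assume "a \<in> carrier (mult_of R)"
    then have a: "a \<in> carrier R - {\<zero>}" by simp
    then have "factorable (h a)" using h_russell_alg h_eq_0_iff by (intro factorable_russell_alg) auto
    then obtain u ps where u: "u \<in> russell_alg" "dvd_alg u 1" "\<forall>p\<in>set ps. prime_alg p" "h a = u * prod_list ps"
      unfolding factorable_def by blast
    define g where "g = inv_into (carrier R) h"
    have g: "g b \<in> carrier R" "h (g b) = b" if "b \<in> russell_alg" for b
      using that h_bij unfolding g_def bij_betw_def by (auto intro: inv_into_into f_inv_into_f)
    define fs where "fs = map g ps"
    have ps: "p \<in> russell_alg" "p \<noteq> 0" if "p \<in> set ps" for p using u(3) that by (auto simp: prime_alg_def)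
    have g0: "g b \<in> carrier (mult_of R)" if "b \<in> russell_alg" "b \<noteq> 0" for b
      using g that h_zero by force
    have fs: "set fs \<subseteq> carrier (mult_of R)" using ps g0 by (auto simp: fs_def)
    have prime: "\<forall>p\<in>set fs. Divisibility.prime (mult_of R) p"
      unfolding fs_def using ps g0 u(3) g by (auto intro!: prime_if_prime_alg)
    define P where "P = foldr (\<otimes>\<^bsub>mult_of R\<^esub>) fs \<one>\<^bsub>mult_of R\<^esub>"
    have P: "P \<in> carrier (mult_of R)"
      unfolding P_def by (rule monoid.multlist_closed[OF mult_of.monoid_axioms fs])
    have hP: "h P = prod_list ps"
    proof -
      have "h (foldr (\<otimes>) (map g qs) \<one>) = prod_list qs \<and> foldr (\<otimes>) (map g qs) \<one> \<in> carrier R"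
        if "set qs \<subseteq> set ps" for qs
        using that ps g by (induction qs) (auto simp: h_one h_mult)
      then show ?thesis unfolding P_def fs_def by simp
    qed
    obtain v where v: "v \<in> russell_alg" "1 = u * v" using u(2) by (auto simp: dvd_alg_def)
    have "dvd_alg (h P) (h a)" unfolding hP u(4) dvd_alg_def using u(1) by (intro bexI[of _ u]) (simp_all add: mult.commute)
    moreover have "h P = h a * v" unfolding hP u(4) using v(2) by (metis mult.assoc mult.commute mult_1_left)
    then have "dvd_alg (h a) (h P)" using v(1) by (auto simp: dvd_alg_def)
    ultimately have "P \<sim>\<^bsub>mult_of R\<^esub> a"
      using divides_iff P a by (auto simp: associated_def)
    then show "\<exists>fs. set fs \<subseteq> carrier (mult_of R) \<and> (\<forall>p\<in>set fs. Divisibility.prime (mult_of R) p) \<and>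
           foldr (\<otimes>\<^bsub>mult_of R\<^esub>) fs \<one>\<^bsub>mult_of R\<^esub> \<sim>\<^bsub>mult_of R\<^esub> a"
      using fs prime unfolding P_def by blast
  qed
  then show ?thesis by (intro factorial_domain.intro domainR)
qed

lemma h_eval_at:
  assumes "\<forall>m\<in>Poly_Mapping.keys p. Poly_Mapping.keys m \<subseteq> carrier R"
  shows "h (eval_at R \<phi> p) = eval_laurent h p"
proof -
  have mon: "(\<Otimes>s\<in>Poly_Mapping.keys m. s [^] Poly_Mapping.lookup m s) \<in> carrier R \<and>
      h (\<Otimes>s\<in>Poly_Mapping.keys m. s [^] Poly_Mapping.lookup m s) = eval_mon h m"
    if "Poly_Mapping.keys m \<subseteq> carrier R" for m
    using that by (auto intro!: finprod_closed simp: h_finprod h_pow eval_mon_def subset_iff intro!: prod.cong)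
  show ?thesis
    unfolding eval_at_def eval_laurent_def using assms mon
    by (subst h_finsum) (auto simp: const_carrier h_mult h_const intro!: sum.cong)
qed

lemma eval_at_carrier:
  assumes "\<forall>m\<in>Poly_Mapping.keys p. Poly_Mapping.keys m \<subseteq> carrier R"
  shows "eval_at R \<phi> p \<in> carrier R"
  unfolding eval_at_def using assms
  by (intro finsum_closed) (auto intro!: m_closed finprod_closed const_carrier)

lemma alg_independent_iff:
  "alg_independent R \<phi> S \<longleftrightarrow> S \<subseteq> carrier R \<and>
     (\<forall>p. (\<forall>m\<in>Poly_Mapping.keys p. Poly_Mapping.keys m \<subseteq> S) \<and> eval_laurent h p = 0 \<longrightarrow> p = 0)"
proof -
  have "eval_at R \<phi> p = \<zero> \<longleftrightarrow> eval_laurent h p = 0"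
    if "S \<subseteq> carrier R" "\<forall>m\<in>Poly_Mapping.keys p. Poly_Mapping.keys m \<subseteq> S" for p
  proof -
    have *: "\<forall>m\<in>Poly_Mapping.keys p. Poly_Mapping.keys m \<subseteq> carrier R" using that by blast
    show ?thesis using h_eq_0_iff[OF eval_at_carrier[OF *]] h_eval_at[OF *] by simp
  qed
  then show ?thesis unfolding alg_independent_def by blast
qed

lemma eval_laurent_surj:
  assumes "a \<in> alg (h ` S)"
  shows "\<exists>p. (\<forall>m\<in>Poly_Mapping.keys p. Poly_Mapping.keys m \<subseteq> S) \<and> eval_laurent h p = a"
  using assms
proof induction
  case (alg_cst c)
  show ?case by (intro exI[of _ "Poly_Mapping.single 0 c"]) auto
next
  case (alg_gen s)
  then obtain b where "b \<in> S" "s = h b" by blast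
  then show ?case
    by (intro exI[of _ "Poly_Mapping.single (Poly_Mapping.single b 1) 1"]) (auto simp: is_rhomD[OF is_rhom_cst])
next
  case (alg_add a b)
  then obtain p q where pq: "\<forall>m\<in>Poly_Mapping.keys p. Poly_Mapping.keys m \<subseteq> S" "eval_laurent h p = a"
    "\<forall>m\<in>Poly_Mapping.keys q. Poly_Mapping.keys m \<subseteq> S" "eval_laurent h q = b" by blast
  then show ?case using Poly_Mapping.keys_add[of p q] by (intro exI[of _ "p + q"]) (auto simp: eval_laurent_add)
next
  case (alg_mult a b)
  then obtain p q where pq: "\<forall>m\<in>Poly_Mapping.keys p. Poly_Mapping.keys m \<subseteq> S" "eval_laurent h p = a"
    "\<forall>m\<in>Poly_Mapping.keys q. Poly_Mapping.keys m \<subseteq> S" "eval_laurent h q = b" by blast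
  have "Poly_Mapping.keys m \<subseteq> S" if m: "m \<in> Poly_Mapping.keys (p * q)" for m
  proof -
    obtain m1 m2 where "m = m1 + m2" "m1 \<in> Poly_Mapping.keys p" "m2 \<in> Poly_Mapping.keys q"
      using m keys_mult[of p q] by blast
    then show ?thesis using pq Poly_Mapping.keys_add[of m1 m2] by blast
  qed
  then show ?case using pq by (intro exI[of _ "p * q"]) (auto simp: eval_laurent_mult)
qed

text \<open>The basis consists of \<open>x\<close>, \<open>z\<close>, \<open>t\<close>. It is
  maximal because every element \<open>b\<close> satisfies an equation \<open>x^N b = r\<close> with
  \<open>r\<close> a polynomial in \<open>x\<close>, \<open>z\<close>, \<open>t\<close>.\<close>

theorem has_trdegR: "has_trdeg R \<phi> 3"
proof -
  obtain x z t where xzt: "x \<in> carrier R" "z \<in> carrier R" "t \<in> carrier R"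
    and hx: "h x = fls_X" "h z = fls_const z_poly" "h t = fls_const t_poly"
    using h_surj[OF russell_alg_X] h_surj[OF russell_alg_const[of z_poly]] h_surj[OF russell_alg_const[of t_poly]] by blast
  have X_const: "fls_X \<noteq> fls_const g" for g :: zt_poly
  proof
    assume "fls_X = fls_const g"
    then have "fls_X $$ 1 = fls_const g $$ 1" by simp
    then show False by simp
  qed
  have distinct: "x \<noteq> z" "x \<noteq> t" "z \<noteq> t"
  proof -
    show "x \<noteq> z" "x \<noteq> t" using X_const hx by metis+
    show "z \<noteq> t"
    proof
      assume "z = t"
      then have "fls_const z_poly = fls_const t_poly" using hx by simp
      then have "fls_const z_poly $$ 0 = fls_const t_poly $$ 0" by simp
      then show False by (simp add: z_poly_def t_poly_def)
    qed
  qed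
  define S where "S = {x, z, t}"
  have card: "finite S" "card S = 3" using distinct by (simp_all add: S_def)
  have indep: "p = 0" if p: "\<forall>m\<in>Poly_Mapping.keys p. Poly_Mapping.keys m \<subseteq> S" "eval_laurent h p = 0" for p
  proof (rule ccontr)
    assume "p \<noteq> 0"
    then obtain m where m: "m \<in> Poly_Mapping.keys p" by (metis all_not_in_conv keys_eq_empty)
    \<comment> \<open>Reads off the coefficient of the monomial \<open>m\<close>.\<close>
    define co where "co f = Polynomial.coeff (Polynomial.coeff (f $$ int (Poly_Mapping.lookup m x)) (Poly_Mapping.lookup m z)) (Poly_Mapping.lookup m t)"
      for f :: laurent
    have co_sum: "co (\<Sum>i\<in>A. f i) = (\<Sum>i\<in>A. co (f i))" for A :: "('a \<Rightarrow>\<^sub>0 nat) set" and f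
      by (simp add: co_def fls_nth_sum coeff_sum)
    have co_mon: "co (cst c * eval_mon h n) = (if n = m then c else 0)" if n: "n \<in> Poly_Mapping.keys p" for c n
    proof -
      have "eval_mon h n = h x ^ Poly_Mapping.lookup n x * (h z ^ Poly_Mapping.lookup n z * h t ^ Poly_Mapping.lookup n t)"
        using p(1) n card(1) distinct by (subst eval_mon_superset[of S]) (auto simp: S_def)
      also have "cst c * \<dots> = fls_X ^ Poly_Mapping.lookup n x *
          fls_const ([:[:c:]:] * (z_poly ^ Poly_Mapping.lookup n z * t_poly ^ Poly_Mapping.lookup n t))"
        by (simp only: hx cst_def is_rhomD[OF is_rhom_fls_const] mult.left_commute)
      also have "[:[:c:]:] * (z_poly ^ Poly_Mapping.lookup n z * t_poly ^ Poly_Mapping.lookup n t) =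
          Polynomial.monom (Polynomial.monom c (Poly_Mapping.lookup n t)) (Poly_Mapping.lookup n z)"
      proof -
        have "z_poly ^ k = Polynomial.monom 1 k" for k by (simp add: z_poly_def monom_altdef)
        moreover have "t_poly ^ k = [:Polynomial.monom 1 k:]" for k
          by (induction k) (simp_all add: t_poly_def monom_altdef one_pCons)
        ultimately show ?thesis by (simp add: smult_monom mult.commute)
      qed
      finally have "co (cst c * eval_mon h n) = (if Poly_Mapping.lookup n x = Poly_Mapping.lookup m x \<and>
         Poly_Mapping.lookup n z = Poly_Mapping.lookup m z \<and> Poly_Mapping.lookup n t = Poly_Mapping.lookup m t then c else 0)"
        by (auto simp: co_def fls_X_power_times_conv_shift)
      moreover have "n = m" if "Poly_Mapping.lookup n x = Poly_Mapping.lookup m x"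
         "Poly_Mapping.lookup n z = Poly_Mapping.lookup m z" "Poly_Mapping.lookup n t = Poly_Mapping.lookup m t"
      proof (rule poly_mapping_eqI)
        fix s
        have "Poly_Mapping.keys n \<subseteq> S" "Poly_Mapping.keys m \<subseteq> S" using p(1) n m by auto
        then have "s \<notin> Poly_Mapping.keys n" "s \<notin> Poly_Mapping.keys m" if "s \<notin> S"
          using that by auto
        then have "Poly_Mapping.lookup n s = 0 \<and> Poly_Mapping.lookup m s = 0" if "s \<notin> S"
          using that by (simp add: in_keys_iff)
        then show "Poly_Mapping.lookup n s = Poly_Mapping.lookup m s"
          using that by (cases "s \<in> S") (auto simp: S_def)
      qed
      ultimately show ?thesis by auto
    qed
    have "co (eval_laurent h p) = Poly_Mapping.lookup p m"
      using m by (simp add: eval_laurent_def co_sum co_mon)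
    then show False using p(2) m by (simp add: co_def in_keys_iff)
  qed
  have S_carrier: "S \<subseteq> carrier R" using xzt by (simp add: S_def)
  have "T = S" if T: "alg_independent R \<phi> T" "S \<subseteq> T" for T
  proof (rule ccontr)
    assume "T \<noteq> S"
    then obtain b where b: "b \<in> T" "b \<notin> S" using T by blast
    have "b \<in> carrier R" using T b by (auto simp: alg_independent_def)
    then obtain N r where r: "fls_X ^ N * h b = eval_xzt r" using clear_denominator[OF h_russell_alg] by blast
    have "h ` S = {fls_X, fls_const z_poly, fls_const t_poly}" by (simp add: S_def hx)
    then have "eval_xzt r \<in> alg (h ` S)" using eval_xzt_in_alg by simp
    then obtain p where p: "\<forall>m\<in>Poly_Mapping.keys p. Poly_Mapping.keys m \<subseteq> S" "eval_laurent h p = eval_xzt r"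
      using eval_laurent_surj by blast
    define m where "m = Poly_Mapping.single x N + Poly_Mapping.single b (1 :: nat)"
    \<comment> \<open>This is the relation \<open>x^N b - r\<close>. Its monomial \<open>m\<close>
      involves the indeterminate \<open>b\<close> outside \<open>S\<close>, so it cannot cancel
      against \<open>p\<close>.\<close>
    define q where "q = Poly_Mapping.single m 1 - p"
    have mb: "Poly_Mapping.lookup m b \<noteq> 0" by (simp add: m_def lookup_add)
    have mT: "Poly_Mapping.keys m \<subseteq> T"
      using T b Poly_Mapping.keys_add[of "Poly_Mapping.single x N" "Poly_Mapping.single b (1 :: nat)"]
      by (auto simp: m_def S_def split: if_splits)
    have "b \<in> Poly_Mapping.keys m" using mb by (simp add: in_keys_iff)
    then have "m \<notin> Poly_Mapping.keys p" using p(1) b by blast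
    then have "Poly_Mapping.lookup q m = 1"
      by (simp add: q_def lookup_minus in_keys_iff)
    then have "q \<noteq> 0" by auto
    moreover have "\<forall>n\<in>Poly_Mapping.keys q. Poly_Mapping.keys n \<subseteq> T"
    proof
      fix n assume "n \<in> Poly_Mapping.keys q"
      then have "n = m \<or> n \<in> Poly_Mapping.keys p"
        by (auto simp: q_def in_keys_iff lookup_minus lookup_single when_def split: if_splits)
      then show "Poly_Mapping.keys n \<subseteq> T" using mT p(1) T by auto
    qed
    moreover have "eval_laurent h q = 0"
      by (simp add: q_def is_rhomD[OF is_rhom_eval_laurent] is_rhomD[OF is_rhom_cst] p m_def eval_mon_add hx r)
    ultimately show False using T(1) by (auto simp: alg_independent_iff)
  qed
  moreover have "alg_independent R \<phi> S" using S_carrier indep by (auto simp: alg_independent_iff)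
  ultimately have "transcendence_basis R \<phi> S" by (auto simp: transcendence_basis_def)
  then show ?thesis using card by (auto simp: has_trdeg_def)
qed

theorem no_positive_grading: "\<not> admits_positive_Z_grading R \<phi>"
proof
  assume "admits_positive_Z_grading R \<phi>"
  then obtain G where G: "positive_Z_grading R \<phi> G" by (auto simp: admits_positive_Z_grading_def)
  then have sub: "additive_subgroup (G i) R" for i
    by (simp add: positive_Z_grading_def Z_grading_def)
  note gr = G[unfolded positive_Z_grading_def Z_grading_def]
  have Gc: "G i \<subseteq> carrier R" for i using additive_subgroup.a_subset[OF sub] .
  have "positive_grading (\<lambda>i. h ` G i)"
  proof
    fix i j :: int and a b :: laurent
    show "0 \<in> h ` G i" using additive_subgroup.zero_closed[OF sub, of i] h_zero by (metis imageI)
    show "h ` G i \<subseteq> russell_alg" using Gc h_russell_alg by blast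
    show "a + b \<in> h ` G i" if ab: "a \<in> h ` G i" "b \<in> h ` G i"
    proof -
      obtain a' b' where "a' \<in> G i" "b' \<in> G i" "a = h a'" "b = h b'" using ab by auto
      then show ?thesis
        using additive_subgroup.a_closed[OF sub, of a' i b'] h_add[of a' b'] Gc by (metis imageI subsetD)
    qed
    show "a * b \<in> h ` G (i + j)" if ab: "a \<in> h ` G i" "b \<in> h ` G j"
    proof -
      obtain a' b' where *: "a' \<in> G i" "b' \<in> G j" "a = h a'" "b = h b'" using ab by auto
      then have "a' \<otimes> b' \<in> G (i + j)" using gr by blast
      then show ?thesis using h_mult[of a' b'] Gc * by (metis imageI subsetD)
    qed
    show "h ` G i = {0}" if "i < 0" using that gr h_zero by auto
    show "h ` G 0 = range cst" using gr h_const by (auto simp: image_iff)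
    assume b: "b \<in> russell_alg"
    then obtain b' where b': "b' \<in> carrier R" "h b' = b" using h_surj by blast
    define Q where "Q f \<longleftrightarrow> (\<forall>i. f i \<in> G i) \<and> finite {i. f i \<noteq> \<zero>} \<and> b' = (\<Oplus>i\<in>{i. f i \<noteq> \<zero>}. f i)" for f
    have "\<exists>!f. Q f" unfolding Q_def using conjunct1[OF conjunct2[OF conjunct1[OF gr]]] b'(1) by (rule bspec)
    then obtain f where Qf: "Q f" and uniq': "\<forall>f'. Q f' \<longrightarrow> f' = f" by (rule ex1E)
    have f: "\<forall>i. f i \<in> G i" "finite {i. f i \<noteq> \<zero>}" "b' = (\<Oplus>i\<in>{i. f i \<noteq> \<zero>}. f i)"
      using Qf by (simp_all add: Q_def)
    have uniq: "f' = f" if "\<forall>i. f' i \<in> G i" "finite {i. f' i \<noteq> \<zero>}" "b' = (\<Oplus>i\<in>{i. f' i \<noteq> \<zero>}. f' i)" for f'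
      using uniq' that by (simp add: Q_def)
    have supp: "{i. h (f' i) \<noteq> 0} = {i. f' i \<noteq> \<zero>}" if "\<forall>i. f' i \<in> G i" for f'
      using that h_eq_0_iff Gc by blast
    have hsum: "h (\<Oplus>i\<in>{i. f' i \<noteq> \<zero>}. f' i) = (\<Sum>i | f' i \<noteq> \<zero>. h (f' i))" if "\<forall>i. f' i \<in> G i" for f'
      using that Gc by (intro h_finsum) blast
    show "\<exists>!f. (\<forall>i. f i \<in> h ` G i) \<and> finite {i. f i \<noteq> 0} \<and> b = (\<Sum>i | f i \<noteq> 0. f i)"
    proof (rule ex1I[of _ "\<lambda>i. h (f i)"])
      show "(\<forall>i. h (f i) \<in> h ` G i) \<and> finite {i. h (f i) \<noteq> 0} \<and> b = (\<Sum>i | h (f i) \<noteq> 0. h (f i))"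
        using f b' hsum[OF f(1)] by (simp add: supp[OF f(1)])
      fix g assume g: "(\<forall>i. g i \<in> h ` G i) \<and> finite {i. g i \<noteq> 0} \<and> b = (\<Sum>i | g i \<noteq> 0. g i)"
      then have "\<forall>i. \<exists>a. a \<in> G i \<and> g i = h a" by blast
      from choice[OF this] obtain f' where f': "\<And>i. f' i \<in> G i" "\<And>i. g i = h (f' i)" by blast
      have "h b' = h (\<Oplus>i\<in>{i. f' i \<noteq> \<zero>}. f' i)"
        using g b' f' by (simp add: hsum supp)
      moreover have "(\<Oplus>i\<in>{i. f' i \<noteq> \<zero>}. f' i) \<in> carrier R"
        using f' Gc by (intro finsum_closed) blast
      ultimately have "b' = (\<Oplus>i\<in>{i. f' i \<noteq> \<zero>}. f' i)" using b' h_eq_iff by blast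
      moreover have "finite {i. f' i \<noteq> \<zero>}" using g f' by (simp add: supp)
      ultimately have "f' = f" using f'(1) by (intro uniq) auto
      then show "g = (\<lambda>i. h (f i))" using f' by auto
    qed
  qed
  then show False by (rule positive_grading.contradiction)
qed

end

section \<open>Identification of the quotient ring with the Laurent model\<close>

lemma peval_comp:
  assumes "is_rhom f" "is_rhom g"
  shows "g (peval f a p) = peval (\<lambda>c. g (f c)) (g a) p"
  by (induction p) (simp_all add: peval_pCons is_rhom_comp assms is_rhomD[OF assms(2)])

definition coord :: "russell_var \<Rightarrow> laurent" where
  "coord v = (case v of Var_x \<Rightarrow> fls_X | Var_y \<Rightarrow> y_laurent | Var_z \<Rightarrow> fls_const z_poly | Var_t \<Rightarrow> fls_const t_poly)"

lemma eval_laurent_indet: "eval_laurent v (indet s) = v s"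
  by (simp add: indet_def is_rhomD[OF is_rhom_cst])

text \<open>Bridge between nested polynomials, where induction on the degree in \<open>y\<close> is
  available, and the finitely supported functions of the statement.\<close>

definition to_poly4 :: "zt_poly poly poly \<Rightarrow> poly4" where
  "to_poly4 = peval (peval (peval (peval (Poly_Mapping.single 0) (indet Var_t)) (indet Var_z)) (indet Var_x)) (indet Var_y)"

lemma is_rhom_single: "is_rhom (Poly_Mapping.single (0 :: 'v \<Rightarrow>\<^sub>0 nat) :: complex \<Rightarrow> _)"
  by (simp add: is_rhom_def single_add mult_single)

lemmas is_rhom_to_poly4_steps = is_rhom_single is_rhom_peval[OF is_rhom_single]
  is_rhom_peval[OF is_rhom_peval[OF is_rhom_single]]
  is_rhom_peval[OF is_rhom_peval[OF is_rhom_peval[OF is_rhom_single]]]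

lemma is_rhom_to_poly4: "is_rhom to_poly4"
  unfolding to_poly4_def by (intro is_rhom_peval is_rhom_single)

lemma eval_laurent_to_poly4: "eval_laurent coord (to_poly4 P) = eval_yxzt P"
proof -
  have c: "(\<lambda>c. eval_laurent coord (Poly_Mapping.single 0 c)) = cst" by simp
  have g: "(\<lambda>g. peval (peval cst (fls_const t_poly)) (fls_const z_poly) g) = fls_const"
    by (rule ext) (rule fls_const_eq_peval[symmetric])
  show ?thesis
    unfolding to_poly4_def eval_yxzt_def eval_xzt_def
    by (simp only: peval_comp[OF _ is_rhom_eval_laurent] is_rhom_to_poly4_steps eval_laurent_indet c)
       (simp add: coord_def g)
qed

lemma to_poly4_surj: "\<exists>P. to_poly4 P = p"
proof -
  define T where "T = range to_poly4"
  have T: "a + b \<in> T" "a * b \<in> T" if ab: "a \<in> T" "b \<in> T" for a b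
  proof -
    obtain P Q where "a = to_poly4 P" "b = to_poly4 Q" using ab by (auto simp: T_def)
    then have "a + b = to_poly4 (P + Q)" "a * b = to_poly4 (P * Q)" by (simp_all add: is_rhomD[OF is_rhom_to_poly4])
    then show "a + b \<in> T" "a * b \<in> T" by (simp_all add: T_def)
  qed
  have const: "Poly_Mapping.single 0 c \<in> T" for c
  proof -
    have "to_poly4 [:[:[:[:c:]:]:]:] = Poly_Mapping.single 0 c"
      unfolding to_poly4_def by (simp only: peval_const is_rhom_to_poly4_steps)
    then show ?thesis unfolding T_def by (metis rangeI)
  qed
  have one: "1 \<in> T" using const[of 1] by simp
  have ind: "indet v \<in> T" for v
  proof -
    have "to_poly4 [:0, 1:] = indet Var_y" "to_poly4 [:[:0, 1:]:] = indet Var_x"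
      "to_poly4 [:[:[:0, 1:]:]:] = indet Var_z" "to_poly4 [:[:[:[:0, 1:]:]:]:] = indet Var_t"
      unfolding to_poly4_def by (simp_all add: peval_const peval_X is_rhom_to_poly4_steps)
    then show ?thesis unfolding T_def by (cases v) (metis rangeI)+
  qed
  have pow: "indet v ^ n \<in> T" for v n by (induction n) (auto intro: T ind one)
  have monomial: "Poly_Mapping.single m 1 \<in> T" for m :: "russell_var \<Rightarrow>\<^sub>0 nat"
  proof (induction m rule: single_sum_induct)
    case zero
    then show ?case using one by simp
  next
    case (single v n)
    have "Poly_Mapping.single (Poly_Mapping.single v n) 1 = indet v ^ n"
    proof (induction n)
      case (Suc n)
      have "Poly_Mapping.single v (Suc n) = Poly_Mapping.single v 1 + Poly_Mapping.single v n"
        by (simp flip: single_add)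
      then have "Poly_Mapping.single (Poly_Mapping.single v (Suc n)) 1 =
          indet v * Poly_Mapping.single (Poly_Mapping.single v n) (1 :: complex)"
        by (simp only: indet_def mult_single mult_1)
      then show ?case using Suc by simp
    qed simp
    then show ?case using pow by simp
  next
    case (add m n)
    then show ?case using T(2)[OF add] by (simp add: mult_single)
  qed
  have "p \<in> T"
  proof (induction p rule: single_sum_induct)
    case zero
    then show ?case using const[of 0] by simp
  next
    case (single m c)
    show ?case using T(2)[OF const[of c] monomial[of m]] by (simp add: mult_single)
  qed (rule T)
  then show ?thesis by (auto simp: T_def)
qed

lemma to_poly4_russell_rel: "to_poly4 russell_rel = russell_poly"
proof -
  have t: "to_poly4 (pCons c P) = peval (peval (peval (Poly_Mapping.single 0) (indet Var_t)) (indet Var_z)) (indet Var_x) c + indet Var_y * to_poly4 P" for c P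
    unfolding to_poly4_def by (rule peval_pCons[OF is_rhom_to_poly4_steps(4)])
  have "to_poly4 0 = 0" by (simp add: is_rhomD[OF is_rhom_to_poly4])
  then show ?thesis
    unfolding russell_rel_def russell_poly_def
    by (simp add: t cusp_eq peval_pCons is_rhom_to_poly4_steps power2_eq_square power3_eq_cube algebra_simps
        is_rhomD[OF is_rhom_single] is_rhomD(2)[OF is_rhom_to_poly4_steps(2)] is_rhomD(2)[OF is_rhom_to_poly4_steps(3)])
qed

text \<open>Every polynomial comes from a nested one, so the kernel is the image of the kernel
  computed in \<open>eval_yxzt_kernel\<close>.\<close>

lemma eval_laurent_kernel: "eval_laurent coord p = 0 \<longleftrightarrow> (\<exists>q. p = q * russell_poly)"
proof
  assume "eval_laurent coord p = 0"
  moreover obtain P where P: "to_poly4 P = p" using to_poly4_surj by blast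
  ultimately have "eval_yxzt P = 0" using eval_laurent_to_poly4 by metis
  then obtain Q where "P = russell_rel * Q" using eval_yxzt_kernel by (auto elim: dvdE)
  then have "p = to_poly4 Q * russell_poly" using P by (simp add: is_rhomD[OF is_rhom_to_poly4] to_poly4_russell_rel mult.commute)
  then show "\<exists>q. p = q * russell_poly" by blast
next
  assume "\<exists>q. p = q * russell_poly"
  then show "eval_laurent coord p = 0" using eval_laurent_to_poly4[of russell_rel] by (auto simp: eval_laurent_mult to_poly4_russell_rel eval_yxzt_russell_rel)
qed

lemma range_eval_laurent: "range (eval_laurent coord) = russell_alg"
proof -
  have "eval_laurent coord p \<in> range eval_yxzt" for p
    using to_poly4_surj[of p] eval_laurent_to_poly4 by (metis rangeI)
  moreover have "eval_yxzt P \<in> range (eval_laurent coord)" for P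
    unfolding eval_laurent_to_poly4[symmetric] by simp
  ultimately show ?thesis by (auto simp: russell_alg_def)
qed

lemma poly4_ring_simps [simp]:
  "carrier poly4_ring = UNIV" "a \<otimes>\<^bsub>poly4_ring\<^esub> b = a * b" "\<one>\<^bsub>poly4_ring\<^esub> = 1"
  "\<zero>\<^bsub>poly4_ring\<^esub> = 0" "a \<oplus>\<^bsub>poly4_ring\<^esub> b = a + b"
  by (simp_all add: ring_of_type_algebra_def)

lemma cring_poly4: "cring poly4_ring"
  by (rule cring_from_type_algebra)

lemma ideal_russell: "ideal russell_ideal poly4_ring"
  unfolding russell_ideal_def by (rule cring.cgenideal_ideal[OF cring_poly4]) simp

text \<open>Evaluation is constant on each coset of the ideal, so its image there is a
  singleton.\<close>

definition russell_map :: "poly4 set \<Rightarrow> laurent" where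
  "russell_map A = the_elem (eval_laurent coord ` A)"

theorem russell_model_russell_ring: "russell_model russell_ring russell_const russell_map"
proof -
  interpret poly4: cring poly4_ring by (rule cring_poly4)
  interpret laurent: cring russell_alg_ring by (rule cring_russell_alg_ring)
  interpret ev: ring_hom_ring poly4_ring russell_alg_ring "eval_laurent coord"
    by (rule ring_hom_ringI2[OF poly4.ring_axioms laurent.ring_axioms], rule ring_hom_memI)
       (use range_eval_laurent in \<open>auto simp: is_rhomD[OF is_rhom_eval_laurent]\<close>)
  have ker: "a_kernel poly4_ring russell_alg_ring (eval_laurent coord) = russell_ideal"
    unfolding a_kernel_def' russell_ideal_def cgenideal_def by (auto simp: eval_laurent_kernel)
  show ?thesis
  proof (rule russell_model.intro)
    show "cring russell_ring"
      unfolding russell_ring_def by (rule ideal.quotient_is_cring[OF ideal_russell cring_poly4])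
    show "russell_map \<in> ring_iso russell_ring russell_alg_ring"
      using ev.FactRing_iso_set range_eval_laurent
      unfolding russell_ring_def ker russell_map_def[abs_def] by simp
    show "russell_map (russell_const c) = cst c" for c
      using ev.the_elem_simp[of "Poly_Mapping.single 0 c"]
      unfolding russell_map_def russell_const_def ker by simp
    show "russell_const c \<in> carrier russell_ring" for c
      unfolding russell_const_def russell_ring_def FactRing_def by (auto simp: A_RCOSETS_def')
  qed
qed

theorem theorem6p2:
  shows "C_iso_class russell_ring russell_const \<notin> U_C_G 3 \<and>
    contains_C russell_ring russell_const \<and>
    factorial_domain russell_ring \<and>
    has_trdeg russell_ring russell_const 3 \<and>
    \<not> admits_positive_Z_grading russell_ring russell_const"
proof -
  interpret russell_model russell_ring russell_const russell_map
    by (rule russell_model_russell_ring)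
  have "C_iso_class russell_ring russell_const \<notin> U_C_G 3"
  proof
    assume "C_iso_class russell_ring russell_const \<in> U_C_G 3"
    \<comment> \<open>Membership only provides a grading on some representative \<open>S\<close>. As
      \<open>S\<close> lies in its own class, it is isomorphic to \<open>russell_ring\<close>, which
      makes it a \<open>russell_model\<close> as well.\<close>
    then obtain S :: "poly4 set ring" and \<psi> where S: "C_iso_class russell_ring russell_const = C_iso_class S \<psi>"
      "contains_C S \<psi>" "admits_positive_Z_grading S \<psi>"
      by (auto simp: U_C_G_def)
    have "C_isomorphic S \<psi> S \<psi>"
      unfolding C_isomorphic_def by (intro bexI[of _ id] ring_iso_set_refl) simp
    then have "(S, \<psi>) \<in> C_iso_class S \<psi>"
      using S(2) by (simp add: C_iso_class_def contains_C_def)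
    then have "(S, \<psi>) \<in> C_iso_class russell_ring russell_const" using S(1) by simp
    then obtain g where g: "g \<in> ring_iso russell_ring S" "\<And>c. g (russell_const c) = \<psi> c"
      by (auto simp: C_iso_class_def C_isomorphic_def)
    define g' where "g' = inv_into (carrier russell_ring) g"
    have "g' \<in> ring_iso S russell_ring"
      unfolding g'_def by (rule ring_iso_set_sym[OF ring_axioms g(1)])
    then have "russell_model S \<psi> (russell_map \<circ> g')"
    proof (intro russell_model.intro)
      show "cring S" using S(2) by (simp add: contains_C_def C_algebra_def)
      show "russell_map \<circ> g' \<in> ring_iso S russell_alg_ring" using \<open>g' \<in> ring_iso S russell_ring\<close> h by (rule ring_iso_set_trans)
      show "\<psi> c \<in> carrier S" for c
        using ring_iso_memE(1)[OF g(1) const_carrier] g(2) by simp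
      have "g' (\<psi> c) = russell_const c" for c
        unfolding g'_def g(2)[symmetric] using ring_iso_memE(5)[OF g(1)] const_carrier
        by (simp add: bij_betw_def inv_into_f_f)
      then show "(russell_map \<circ> g') (\<psi> c) = cst c" for c by (simp add: h_const)
    qed
    then show False using russell_model.no_positive_grading S(3) by blast
  qed
  then show ?thesis
    using contains_CR factorial_domainR has_trdegR no_positive_grading by blast
qed

end
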